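(* For each integer $n\ge 1$ let $\pi_{2n+1}$ be a permutation of $\mathbb{Z}_{2n+1}$ drawn uniformly at random, and let $w(\pi_{2n+1})$ be its writhe. Then for every positive integer $k$, $$ \lim_{n\to\infty} E\left[\frac{w(\pi_{2n+1})^k}{n^k}\right] \;=\; \sum_{\sigma \in S_k} \;\prod_{\gamma \in \mathrm{cycles}(\sigma)} \lambda_{|\gamma|}\;, $$ where for even $m$ $$ \lambda_m \;=\; \frac{8^m(2^m-1)B_m^2}{2(m!)^2}\;, $$ and $\lambda_m=0$ for odd $m$, with $B_m$ denoting the $m$th Bernoulli number.
   Context: For a one-to-one function $f:\mathbb{Z}_{2n+1}\to\mathbb{R}$, where $\mathbb{Z}_{2n+1}=\mathbb{Z}/(2n+1)\mathbb{Z}$, the writhe of $f$ is $$ w(f) = \sum_{i=0}^{2n} \sum_{j=1}^{n} \mathrm{sign}\left(f(i+j)-f(i)\right), $$ where $i+j$ is taken in $\mathbb{Z}_{2n+1}$, and $\mathrm{sign}(x)=+1$ if $x>0$ and $-1$ if $x<0$. A permutation in $S_{2n+1}$ is viewed as a bijection of $\{0,\dots,2n\}$, the domain being identified with $\mathbb{Z}_{2n+1}$ and the values $0,\dots,2n$ being compared as integers. For $\sigma\in S_k$, $\mathrm{cycles}(\sigma)$ is the set of cycles of $\sigma$ (fixed points are included as cycles of length $1$), and $|\gamma|$ is the length of the cycle $\gamma$. Bernoulli numbers: $x/(e^x-1)=\sum_{m\ge 0}B_m x^m/m!$. *)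

theory Defs
  imports
    "HOL-Probability.Probability"
    "HOL-Combinatorics.Orbits"
    "HOL-Computational_Algebra.Formal_Power_Series"
begin

text \<open>Residues modulo \<open>2n + 1\<close> are represented by \<open>0, \<dots>, 2n\<close>; only the values of \<open>f\<close> there matter.\<close>

definition writhe :: "nat \<Rightarrow> (nat \<Rightarrow> real) \<Rightarrow> real" where
  "writhe n f = (\<Sum>i = 0..2 * n. \<Sum>j = 1..n. sgn (f ((i + j) mod (2 * n + 1)) - f i))"

text \<open>
  A cycle of a permutation \<open>\<sigma>\<close> of \<open>A\<close> is identified with its underlying set, an orbit of \<open>\<sigma>\<close>;
  its length is the cardinality of that set. A fixed point \<open>x\<close> contributes the singleton \<open>{x}\<close>.
\<close>

definition cycles_on :: "'a set \<Rightarrow> ('a \<Rightarrow> 'a) \<Rightarrow> 'a set set" where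
  "cycles_on A \<sigma> = orbit \<sigma> ` A"

text \<open>
  The quotient is that of formal power series: \<open>fps_exp 1 - 1\<close> has subdegree 1, so the division
  by it is exact. In particular \<open>bernoulli 1 = - 1 / 2\<close>.
\<close>

definition bernoulli :: "nat \<Rightarrow> real" where
  "bernoulli m = fact m * fps_nth (fps_X / (fps_exp 1 - 1)) m"

definition cycle_weight :: "nat \<Rightarrow> real" where
  "cycle_weight m =
    (if even m then 8 ^ m * (2 ^ m - 1) * (bernoulli m)\<^sup>2 / (2 * (fact m)\<^sup>2) else 0)"

end

theory Submission
  imports Defs
begin

text \<open>
  Let \<open>s\<close> be the \<open>\<plusminus>1\<close> kernel of the circulant tournament on \<open>\<int>/(2n+1)\<close> and put
  \<open>h(x, y) = sgn (y - x) - 2(y - x)/M\<close>. The tournament is regular, so the linear terms cancel and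
  \<open>2w(g) = \<Sum> s(i, j) h(g i, g j)\<close> for \<open>g\<close> with values in \<open>{0..<M}\<close>. The rank order of a uniformly
  random \<open>g\<close> is that of a uniformly random permutation up to a collision probability \<open>O(n\<^sup>2/M)\<close>, so
  one may average over independent values and let \<open>M \<rightarrow> \<infinity>\<close> first. The rows of \<open>h\<close> sum to zero; hence
  in the expansion of the \<open>k\<close>-th power over \<open>k\<close>-tuples of edges, tuples with a vertex of degree one
  vanish on average, and all other tuples that are not \<open>2\<close>-regular multigraphs number only \<open>O(n\<^sup>k\<^sup>-\<^sup>1)\<close>.
  A \<open>2\<close>-regular multigraph is a union of cycles; orienting the cycles turns the remaining sum into
  \<open>\<Sum>\<^sub>\<sigma> \<Prod>\<^sub>\<gamma> tr(s\<^sup>m) tr(h\<^sup>m)/2\<close> with \<open>m = |\<gamma>|\<close>. Finally \<open>s\<close> and \<open>h\<close> are circulant, and the kernels of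
  their normalised powers converge to Euler and Bernoulli polynomials, whose values at \<open>0\<close> give the traces.
\<close>

section \<open>Sums over function spaces\<close>

text \<open>Values are drawn from \<open>{0..<M}\<close> rather than from an interval, so that every
  average is a finite sum and \<open>h\<close> is circulant modulo \<open>M\<close>, as
  \<open>s\<close> is modulo \<open>2n+1\<close>; one calculus of cyclic convolution then serves
  both kernels.

  The powers of two balance as follows. The \<open>k\<close>-th power of \<open>2w\<close> carries
  \<open>2^k\<close>; counting orientations of two-regular multigraphs gives \<open>2^k\<close>
  divided by \<open>2\<close> for each cycle; what remains is \<open>1/2\<close> per cycle. Dividing
  by \<open>n\<close> instead of \<open>2n+1\<close> adds a limiting factor \<open>2^m\<close> for a
  cycle of length \<open>m\<close>.

  The collision estimate deteriorates with \<open>n\<close>, which is why \<open>M\<close> has to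
  tend to infinity at fixed \<open>n\<close>. This is harmless because the combinatorial error is
  \<open>O(1/n)\<close> uniformly in \<open>M\<close>: entries of \<open>h\<close> are bounded by
  \<open>1\<close> and enter only through normalised traces.

  The kernels jump, so their powers cannot be compared with polynomials uniformly from the start. A
  difference equation, the discrete form of the Appell relation, carries an error bound from one
  power to the next, but only up to an additive constant. The zero sum fixes this constant for
  \<open>h\<close>, antiperiodicity over half a period fixes it for \<open>s\<close>.\<close>

lemma sum_PiE_insert:
  fixes F :: "('a \<Rightarrow> 'b) \<Rightarrow> 'c::comm_monoid_add"
  assumes "x \<notin> I"
  shows "(\<Sum>g\<in>PiE (insert x I) B. F g) = (\<Sum>g\<in>PiE I B. \<Sum>y\<in>B x. F (g(x := y)))"
proof -
  have "(\<Sum>g\<in>PiE (insert x I) B. F g) = (\<Sum>(y, g)\<in>B x \<times> PiE I B. F (g(x := y)))"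
    unfolding PiE_insert_eq
    by (subst sum.reindex) (auto simp: inj_combinator assms case_prod_beta)
  also have "\<dots> = (\<Sum>y\<in>B x. \<Sum>g\<in>PiE I B. F (g(x := y)))"
    by (simp add: sum.cartesian_product)
  finally show ?thesis by (simp add: sum.swap[of _ "B x"])
qed

lemma sum_PiE_union:
  fixes F :: "('a \<Rightarrow> 'b) \<Rightarrow> 'c::comm_monoid_add"
  assumes "I \<inter> J = {}"
  shows "(\<Sum>g\<in>PiE (I \<union> J) B. F g)
    = (\<Sum>f\<in>PiE I B. \<Sum>h\<in>PiE J B. F (\<lambda>x. if x \<in> I then f x else h x))"
  unfolding sum.cartesian_product
  by (rule sum.reindex_bij_witness[where
        i = "\<lambda>(f, h) x. if x \<in> I then f x else h x" and
        j = "\<lambda>g. (restrict g I, restrict g J)"])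
     (use assms in \<open>auto simp: PiE_iff fun_eq_iff extensional_def restrict_def
        intro!: arg_cong[where f = F] split: if_splits\<close>)

lemma sum_PiE_bij:
  fixes F :: "('a \<Rightarrow> 'b) \<Rightarrow> 'c::comm_monoid_add"
  assumes p: "bij_betw p K J"
  shows "(\<Sum>g\<in>PiE J (\<lambda>_. B). F (restrict (g \<circ> p) K)) = (\<Sum>x\<in>PiE K (\<lambda>_. B). F x)"
proof (rule sum.reindex_bij_witness[where
        i = "\<lambda>x. restrict (x \<circ> inv_into K p) J" and j = "\<lambda>g. restrict (g \<circ> p) K"])
  fix g assume g: "g \<in> PiE J (\<lambda>_. B)"
  show "restrict (restrict (g \<circ> p) K \<circ> inv_into K p) J = g"
    using g p by (auto simp: fun_eq_iff PiE_iff extensional_def restrict_def bij_betw_def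
        inv_into_into f_inv_into_f)
  show "restrict (g \<circ> p) K \<in> PiE K (\<lambda>_. B)"
    using g p by (auto simp: PiE_iff bij_betw_def)
next
  fix x assume x: "x \<in> PiE K (\<lambda>_. B)"
  show "restrict (restrict (x \<circ> inv_into K p) J \<circ> p) K = x"
    using x p by (auto simp: fun_eq_iff PiE_iff extensional_def restrict_def bij_betw_def)
  show "restrict (x \<circ> inv_into K p) J \<in> PiE J (\<lambda>_. B)"
    using x p by (auto simp: PiE_iff bij_betw_def inv_into_into)
qed simp

text \<open>Coordinates outside the image of \<open>p\<close> do not enter and are summed freely;
  this reduces an average over all vertices to one over \<open>k\<close> independent values.\<close>

lemma sum_PiE_comp_inj:
  fixes G :: "('a \<Rightarrow> 'b) \<Rightarrow> real"
  assumes "finite Z" "inj_on p K" "p ` K \<subseteq> Z"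
  shows "(\<Sum>g\<in>PiE Z (\<lambda>_. B). G (restrict (g \<circ> p) K))
    = card B ^ (card Z - card K) * (\<Sum>x\<in>PiE K (\<lambda>_. B). G x)"
proof -
  have Z: "Z = p ` K \<union> (Z - p ` K)" using assms by auto
  have "(\<Sum>g\<in>PiE Z (\<lambda>_. B). G (restrict (g \<circ> p) K))
     = (\<Sum>f\<in>PiE (p ` K) (\<lambda>_. B). \<Sum>h\<in>PiE (Z - p ` K) (\<lambda>_. B). G (restrict (f \<circ> p) K))"
    by (subst Z, subst sum_PiE_union, blast)
       (intro sum.cong refl arg_cong[where f = G], auto simp: fun_eq_iff)
  also have "\<dots> = card B ^ card (Z - p ` K) * (\<Sum>f\<in>PiE (p ` K) (\<lambda>_. B). G (restrict (f \<circ> p) K))"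
    using assms by (simp add: card_PiE sum_distrib_left)
  also have "card (Z - p ` K) = card Z - card K"
    using assms by (metis card_Diff_subset card_image finite_subset)
  also have "(\<Sum>f\<in>PiE (p ` K) (\<lambda>_. B). G (restrict (f \<circ> p) K)) = (\<Sum>x\<in>PiE K (\<lambda>_. B). G x)"
    using assms by (intro sum_PiE_bij) (auto simp: bij_betw_def)
  finally show ?thesis .
qed

lemma sum_PiE_zero:
  fixes F :: "('a \<Rightarrow> 'b) \<Rightarrow> 'c::comm_monoid_add"
  assumes "i \<in> Z" and "\<And>g. g \<in> PiE (Z - {i}) (\<lambda>_. B) \<Longrightarrow> (\<Sum>y\<in>B. F (g(i := y))) = 0"
  shows "(\<Sum>g\<in>PiE Z (\<lambda>_. B). F g) = 0"
proof -
  have "Z = insert i (Z - {i})" using assms by auto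
  then show ?thesis using assms sum_PiE_insert[of i "Z - {i}" F "\<lambda>_. B"] by simp
qed

text \<open>Union bound over pairs of distinct arguments: a function with \<open>f x = f y\<close>
  is determined by its restriction to \<open>K - {y}\<close>. It serves twice, for repeated vertices
  in cycles and for collisions among random values.\<close>

lemma card_not_inj_PiE_le:
  assumes "finite K" "finite A"
  shows "card {f \<in> PiE K (\<lambda>_. A). \<not> inj_on f K} \<le> (card K)\<^sup>2 * card A ^ (card K - 1)"
proof -
  define S where "S = (\<lambda>(x, y). {f \<in> PiE K (\<lambda>_. A). f x = f y})"
  let ?P = "K \<times> K - Id"
  have finP: "finite ?P" using assms by auto
  have *: "card (S xy) \<le> card A ^ (card K - 1)" if P: "xy \<in> ?P" for xy
  proof -
    obtain x y where xy: "xy = (x, y)" "x \<in> K" "y \<in> K" "x \<noteq> y"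
      using P by (cases xy) auto
    have "inj_on (\<lambda>f. restrict f (K - {y})) (S xy)"
    proof (rule inj_onI)
      fix f g assume fg: "f \<in> S xy" "g \<in> S xy" "restrict f (K - {y}) = restrict g (K - {y})"
      have "f z = g z" if "z \<in> K" "z \<noteq> y" for z
        using fun_cong[OF fg(3), of z] that by simp
      moreover from this[of x] have "f y = g y" using fg xy by (auto simp: S_def)
      moreover have "f z = g z" if "z \<notin> K" for z
        using fg that by (auto simp: S_def xy PiE_iff extensional_def)
      ultimately show "f = g" by (metis ext)
    qed
    moreover have "(\<lambda>f. restrict f (K - {y})) ` S xy \<subseteq> PiE (K - {y}) (\<lambda>_. A)"
    proof (rule image_subsetI)
      fix f assume "f \<in> S xy"
      then have "f \<in> PiE K (\<lambda>_. A)" by (simp add: S_def xy(1))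
      then show "restrict f (K - {y}) \<in> PiE (K - {y}) (\<lambda>_. A)"
        unfolding restrict_PiE_iff by (auto simp: PiE_iff)
    qed
    ultimately have "card (S xy) \<le> card (PiE (K - {y}) (\<lambda>_. A))"
      using assms by (intro card_inj_on_le) (auto intro!: finite_PiE)
    then show ?thesis using assms xy by (simp add: card_PiE)
  qed
  have "{f \<in> PiE K (\<lambda>_. A). \<not> inj_on f K} \<subseteq> (\<Union>xy\<in>?P. S xy)"
    by (fastforce simp: inj_on_def S_def)
  then have "card {f \<in> PiE K (\<lambda>_. A). \<not> inj_on f K} \<le> card (\<Union>xy\<in>?P. S xy)"
    using assms by (intro card_mono) (auto simp: S_def intro!: finite_PiE)
  also have "\<dots> \<le> (\<Sum>xy\<in>?P. card (S xy))" using finP by (rule card_UN_le)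
  also have "\<dots> \<le> (\<Sum>xy\<in>?P. card A ^ (card K - 1))" by (intro sum_mono *)
  also have "\<dots> \<le> (card K)\<^sup>2 * card A ^ (card K - 1)"
    using assms card_mono[of "K \<times> K" ?P] by (auto simp: card_cartesian_product power2_eq_square)
  finally show ?thesis .
qed

text \<open>A function with at most \<open>q\<close> values factors through \<open>q\<close>
  symbols: a map from \<open>D\<close> to \<open>{..<q}\<close> followed by an assignment of
  elements of \<open>A\<close> to symbols.\<close>

lemma card_small_image_PiE_le:
  assumes "finite D" "finite A" "A \<noteq> {}"
  shows "card {v \<in> PiE D (\<lambda>_. A). card (v ` D) \<le> q} \<le> card A ^ q * q ^ card D"
proof -
  obtain a0 where a0: "a0 \<in> A" using assms by auto
  let ?P = "PiE {..<q} (\<lambda>_. A) \<times> PiE D (\<lambda>_. {..<q})"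
  have "{v \<in> PiE D (\<lambda>_. A). card (v ` D) \<le> q} \<subseteq> (\<lambda>(c, m). restrict (c \<circ> m) D) ` ?P"
  proof
    fix v assume v: "v \<in> {v \<in> PiE D (\<lambda>_. A). card (v ` D) \<le> q}"
    obtain e where e: "bij_betw e (v ` D) {..<card (v ` D)}"
      using ex_bij_betw_finite_nat[of "v ` D"] assms by (auto simp: atLeast0LessThan)
    define m where "m = restrict (e \<circ> v) D"
    \<comment> \<open>If fewer than \<open>q\<close> values occur, the surplus symbols receive the
      default \<open>a0\<close>.\<close>
    define c where "c = restrict (\<lambda>i. if i < card (v ` D) then inv_into (v ` D) e i else a0) {..<q}"
    have cc: "c (e a) = a" if "a \<in> v ` D" for a
    proof -
      have "e a < card (v ` D)" using e that by (auto simp: bij_betw_def)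
      moreover have "card (v ` D) \<le> q" using v by auto
      ultimately show ?thesis using e that by (auto simp: c_def bij_betw_def)
    qed
    have "v = restrict (c \<circ> m) D"
      using v cc by (auto simp: m_def fun_eq_iff PiE_iff extensional_def restrict_def)
    moreover have "c \<in> PiE {..<q} (\<lambda>_. A)"
    proof -
      have "inv_into (v ` D) e i \<in> v ` D" if "i < card (v ` D)" for i
        using that e by (intro inv_into_into) (auto simp: bij_betw_def)
      moreover have "v ` D \<subseteq> A" using v by auto
      ultimately show ?thesis using a0 by (auto simp: c_def PiE_iff)
    qed
    moreover have "m \<in> PiE D (\<lambda>_. {..<q})"
    proof -
      have "e (v x) < q" if "x \<in> D" for x
      proof -
        have "e (v x) \<in> {..<card (v ` D)}" using e that by (auto simp: bij_betw_def)
        then show ?thesis using v by auto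
      qed
      then show ?thesis by (auto simp: m_def)
    qed
    ultimately show "v \<in> (\<lambda>(c, m). restrict (c \<circ> m) D) ` ?P" by (auto intro!: image_eqI[of _ _ "(c, m)"])
  qed
  then have "card {v \<in> PiE D (\<lambda>_. A). card (v ` D) \<le> q} \<le> card ?P"
    using assms by (intro surj_card_le) (auto intro!: finite_PiE)
  then show ?thesis using assms by (simp add: card_cartesian_product card_PiE)
qed

section \<open>Traces of kernels along permutations\<close>

fun kernel_power :: "('a \<Rightarrow> 'a \<Rightarrow> real) \<Rightarrow> 'a set \<Rightarrow> nat \<Rightarrow> 'a \<Rightarrow> 'a \<Rightarrow> real" where
  "kernel_power K A 0 a b = of_bool (a = b)"
| "kernel_power K A (Suc m) a b = (\<Sum>c\<in>A. kernel_power K A m a c * K c b)"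

definition kernel_trace :: "('a \<Rightarrow> 'a \<Rightarrow> real) \<Rightarrow> 'a set \<Rightarrow> nat \<Rightarrow> real" where
  "kernel_trace K A m = (\<Sum>a\<in>A. kernel_power K A m a a)"

text \<open>The endpoint weight \<open>G\<close> is arbitrary so that the induction closes: summing
  out the last vertex yields a new endpoint weight. The choice \<open>G a b = K b a\<close> later
  closes the path.\<close>

lemma sum_paths_kernel_power:
  assumes "finite A"
  shows "(\<Sum>x\<in>PiE {..m} (\<lambda>_. A). (\<Prod>j<m. K (x j) (x (Suc j))) * G (x 0) (x m))
    = (\<Sum>a\<in>A. \<Sum>b\<in>A. kernel_power K A m a b * G a b)"
proof (induction m arbitrary: G)
  case 0
  have "(\<Sum>x\<in>PiE {..0::nat} (\<lambda>_. A). G (x 0) (x 0)) = (\<Sum>x\<in>PiE (insert (0::nat) {}) (\<lambda>_. A). G (x 0) (x 0))"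
    by (simp add: atMost_0)
  also have "\<dots> = (\<Sum>a\<in>A. G a a)"
    by (subst sum_PiE_insert) auto
  also have "\<dots> = (\<Sum>a\<in>A. \<Sum>b\<in>A. of_bool (a = b) * G a b)"
  proof (intro sum.cong refl)
    fix a assume "a \<in> A"
    have "(\<Sum>b\<in>A. of_bool (a = b) * G a b) = (\<Sum>b\<in>A. if a = b then G a b else 0)"
      by (intro sum.cong) auto
    then show "G a a = (\<Sum>b\<in>A. of_bool (a = b) * G a b)" using assms \<open>a \<in> A\<close> by simp
  qed
  finally show ?case by simp
next
  case (Suc m)
  have "(\<Sum>x\<in>PiE {..Suc m} (\<lambda>_. A). (\<Prod>j<Suc m. K (x j) (x (Suc j))) * G (x 0) (x (Suc m)))
    = (\<Sum>x\<in>PiE {..m} (\<lambda>_. A). \<Sum>y\<in>A. (\<Prod>j<m. K (x j) (x (Suc j))) * K (x m) y * G (x 0) y)"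
    unfolding atMost_Suc
    by (subst sum_PiE_insert) (auto intro!: sum.cong prod.cong)
  also have "\<dots> = (\<Sum>x\<in>PiE {..m} (\<lambda>_. A). (\<Prod>j<m. K (x j) (x (Suc j))) * (\<Sum>y\<in>A. K (x m) y * G (x 0) y))"
    by (simp add: sum_distrib_left mult.assoc)
  also have "\<dots> = (\<Sum>a\<in>A. \<Sum>c\<in>A. kernel_power K A m a c * (\<Sum>y\<in>A. K c y * G a y))"
    using Suc.IH[of "\<lambda>a c. \<Sum>y\<in>A. K c y * G a y"] by simp
  also have "\<dots> = (\<Sum>a\<in>A. \<Sum>y\<in>A. \<Sum>c\<in>A. kernel_power K A m a c * K c y * G a y)"
    unfolding sum_distrib_left by (subst sum.swap) (simp add: mult.assoc)
  finally show ?case by (simp add: sum_distrib_right)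
qed

lemma sum_closed_paths:
  assumes "finite A" "m > 0"
  shows "(\<Sum>x\<in>PiE {..<m} (\<lambda>_. A). \<Prod>j<m. K (x j) (x (Suc j mod m))) = kernel_trace K A m"
proof -
  obtain m' where m': "m = Suc m'" using assms by (cases m) auto
  have "(\<Sum>x\<in>PiE {..<m} (\<lambda>_. A). \<Prod>j<m. K (x j) (x (Suc j mod m)))
     = (\<Sum>x\<in>PiE {..m'} (\<lambda>_. A). (\<Prod>j<m'. K (x j) (x (Suc j))) * K (x m') (x 0))"
    unfolding m' lessThan_Suc_atMost[symmetric] by (intro sum.cong refl) simp
  also have "\<dots> = kernel_trace K A m"
    by (subst sum_paths_kernel_power[OF assms(1), where G = "\<lambda>a b. K b a"]) (simp add: kernel_trace_def m')
  finally show ?thesis .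
qed

text \<open>Listing the orbit as \<open>(\<sigma> ^^ j) s\<close> turns \<open>\<sigma>\<close> into
  the cyclic successor, so the product along the orbit is one along a closed path.\<close>

lemma sum_orbit_kernel:
  assumes "finite A" "finite S" "\<sigma> permutes S" "s \<in> S"
  shows "(\<Sum>x\<in>PiE (orbit \<sigma> s) (\<lambda>_. A). \<Prod>e\<in>orbit \<sigma> s. K (x e) (x (\<sigma> e)))
    = kernel_trace K A (card (orbit \<sigma> s))"
proof -
  have perm: "permutation \<sigma>" using assms by (auto simp: permutation_permutes)
  have self: "s \<in> orbit \<sigma> s" by (rule permutation_self_in_orbit[OF perm])
  define m where "m = funpow_dist1 \<sigma> s s"
  have inj: "inj_on (\<lambda>n. (\<sigma> ^^ n) s) {..<m}"
    using inj_on_funpow_dist1[OF self] by (simp add: m_def atLeast0LessThan)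
  have img: "orbit \<sigma> s = (\<lambda>n. (\<sigma> ^^ n) s) ` {..<m}"
    using orbit_conv_funpow_dist1[OF self] by (simp add: m_def atLeast0LessThan)
  have per: "(\<sigma> ^^ m) s = s" using funpow_dist1_prop[OF self] by (simp add: m_def)
  have m0: "m > 0" by (simp add: m_def)
  have card: "card (orbit \<sigma> s) = m" unfolding img using inj by (simp add: card_image)
  define p where "p = (\<lambda>n. (\<sigma> ^^ n) s)"
  have bij: "bij_betw p {..<m} (orbit \<sigma> s)" using inj img by (auto simp: bij_betw_def p_def)
  have step: "\<sigma> (p j) = p (Suc j mod m)" if "j < m" for j
  proof (cases "Suc j = m")
    case True
    then show ?thesis using per by (auto simp: p_def)
  qed (use that in \<open>simp add: p_def\<close>)
  have "(\<Sum>x\<in>PiE (orbit \<sigma> s) (\<lambda>_. A). \<Prod>e\<in>orbit \<sigma> s. K (x e) (x (\<sigma> e)))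
     = (\<Sum>x\<in>PiE (orbit \<sigma> s) (\<lambda>_. A). \<Prod>j<m. K (restrict (x \<circ> p) {..<m} j) (restrict (x \<circ> p) {..<m} (Suc j mod m)))"
    using m0 by (intro sum.cong refl, subst prod.reindex_bij_betw[OF bij, symmetric])
       (auto intro!: prod.cong simp: step)
  also have "\<dots> = (\<Sum>x\<in>PiE {..<m} (\<lambda>_. A). \<Prod>j<m. K (x j) (x (Suc j mod m)))"
    by (rule sum_PiE_bij[OF bij, where F = "\<lambda>x. \<Prod>j<m. K (x j) (x (Suc j mod m))"])
  also have "\<dots> = kernel_trace K A (card (orbit \<sigma> s))"
    using sum_closed_paths[OF assms(1) m0] card by simp
  finally show ?thesis .
qed

text \<open>One orbit is split off at a time: \<open>\<sigma>\<close> preserves both the orbit and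
  its complement, so the sum is a product of two independent sums.\<close>

lemma sum_permutation_kernel:
  assumes "finite A" "finite S" "\<sigma> permutes S"
  shows "(\<Sum>x\<in>PiE S (\<lambda>_. A). \<Prod>e\<in>S. K (x e) (x (\<sigma> e)))
    = (\<Prod>\<gamma>\<in>cycles_on S \<sigma>. kernel_trace K A (card \<gamma>))"
  using assms(2,3)
proof (induction S arbitrary: \<sigma> rule: finite_psubset_induct)
  case (psubset S)
  show ?case
  proof (cases "S = {}")
    case False
    then obtain s where s: "s \<in> S" by auto
    have perm: "permutation \<sigma>" using psubset by (auto simp: permutation_permutes)
    define O' where "O' = orbit \<sigma> s"
    define T where "T = S - O'"
    define \<tau> where "\<tau> = perm_restrict \<sigma> T"
    have self: "\<And>x. x \<in> orbit \<sigma> x" by (rule permutation_self_in_orbit[OF perm])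
    have O'S: "O' \<subseteq> S" unfolding O'_def by (rule permutes_orbit_subset) fact+
    have "s \<in> O'" by (simp add: O'_def self)
    then have TS: "T \<subset> S" using s by (auto simp: T_def)
    have cyc: "cyclic_on \<sigma> O'" unfolding O'_def by (rule cyclic_on_orbit) fact+
    have tau: "\<tau> permutes T" unfolding \<tau>_def T_def
      by (rule perm_restrict_diff_cyclic) fact+
    have tau_eq: "\<tau> x = \<sigma> x" if "x \<in> T" for x using that by (simp add: \<tau>_def perm_restrict_def)
    have tauT: "\<sigma> x \<in> T" if "x \<in> T" for x using tau tau_eq that by (metis permutes_in_image)
    have sigO: "\<sigma> x \<in> O'" if "x \<in> O'" for x using cyc that by (rule cyclic_on_inI)
    have orb: "orbit \<tau> x = orbit \<sigma> x" if "x \<in> T" for x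
      using that tauT tau_eq by (intro orbit_cong0[where A = T]) auto
    have orbT: "orbit \<sigma> x \<subseteq> T" if "x \<in> T" for x
      using orb[OF that] permutes_orbit_subset[OF tau that] by simp
    have orbO: "orbit \<sigma> x = O'" if "x \<in> O'" for x
      using orbit_cyclic_eq3[OF cyc that] .
    have S_eq: "S = O' \<union> T" and dj: "O' \<inter> T = {}" using O'S by (auto simp: T_def)
    have cycles: "cycles_on S \<sigma> = insert O' (cycles_on T \<tau>)"
      unfolding cycles_on_def S_eq image_Un using orbO \<open>s \<in> O'\<close> orb by auto
    have notin: "O' \<notin> cycles_on T \<tau>"
      using orb orbT dj \<open>s \<in> O'\<close> unfolding cycles_on_def by auto blast
    have fin: "finite O'" "finite T" using O'S psubset.hyps TS by (auto intro: finite_subset)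
    have "(\<Sum>x\<in>PiE S (\<lambda>_. A). \<Prod>e\<in>S. K (x e) (x (\<sigma> e)))
      = (\<Sum>f\<in>PiE O' (\<lambda>_. A). \<Sum>h\<in>PiE T (\<lambda>_. A).
          (\<Prod>e\<in>O'. K (f e) (f (\<sigma> e))) * (\<Prod>e\<in>T. K (h e) (h (\<tau> e))))"
    proof -
      have "(\<Prod>e\<in>O' \<union> T. K (if e \<in> O' then f e else h e) (if \<sigma> e \<in> O' then f (\<sigma> e) else h (\<sigma> e)))
         = (\<Prod>e\<in>O'. K (f e) (f (\<sigma> e))) * (\<Prod>e\<in>T. K (h e) (h (\<tau> e)))" for f h
        proof -
        have "e \<notin> O'" "\<sigma> e \<notin> O'" if "e \<in> T" for e using that dj tauT by auto
        then show ?thesis using dj fin sigO tau_eq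
          by (subst prod.union_disjoint) (auto cong: prod.cong)
      qed
      then show ?thesis unfolding S_eq sum_PiE_union[OF dj] by simp
    qed
    also have "\<dots> = (\<Sum>f\<in>PiE O' (\<lambda>_. A). \<Prod>e\<in>O'. K (f e) (f (\<sigma> e))) * (\<Sum>h\<in>PiE T (\<lambda>_. A). \<Prod>e\<in>T. K (h e) (h (\<tau> e)))"
      by (simp add: sum_product)
    also have "(\<Sum>f\<in>PiE O' (\<lambda>_. A). \<Prod>e\<in>O'. K (f e) (f (\<sigma> e))) = kernel_trace K A (card O')"
      unfolding O'_def by (rule sum_orbit_kernel) fact+
    also have "(\<Sum>h\<in>PiE T (\<lambda>_. A). \<Prod>e\<in>T. K (h e) (h (\<tau> e))) = (\<Prod>\<gamma>\<in>cycles_on T \<tau>. kernel_trace K A (card \<gamma>))"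
      by (rule psubset.IH[OF TS tau])
    also have "kernel_trace K A (card O') * \<dots> = (\<Prod>\<gamma>\<in>cycles_on S \<sigma>. kernel_trace K A (card \<gamma>))"
      unfolding cycles using notin fin by (subst prod.insert) (auto simp: cycles_on_def)
    finally show ?thesis .
  qed (simp add: cycles_on_def)
qed

section \<open>Orienting two-regular multigraphs\<close>

text \<open>Two perfect matchings together form alternating cycles of even length, hence a bipartite
  graph; \<open>L\<close> is a colour class. Later \<open>\<epsilon>\<close> exchanges the ends of
  an edge and \<open>\<rho>\<close> the two half-edges at a vertex.\<close>

lemma two_matchings_bipartite:
  fixes \<epsilon> \<rho> :: "'a::countable \<Rightarrow> 'a"
  assumes fin: "finite H"
    and eps: "\<epsilon> permutes H" "\<And>x. \<epsilon> (\<epsilon> x) = x" "\<And>x. x \<in> H \<Longrightarrow> \<epsilon> x \<noteq> x"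
    and rho: "\<rho> permutes H" "\<And>x. \<rho> (\<rho> x) = x" "\<And>x. x \<in> H \<Longrightarrow> \<rho> x \<noteq> x"
  obtains L where "\<And>x. x \<in> H \<Longrightarrow> \<epsilon> x \<in> L \<longleftrightarrow> x \<notin> L" "\<And>x. x \<in> H \<Longrightarrow> \<rho> x \<in> L \<longleftrightarrow> x \<notin> L"
proof -
  define \<phi> where "\<phi> = \<rho> \<circ> \<epsilon>"
  have phi: "\<phi> permutes H" unfolding \<phi>_def using eps rho by (intro permutes_compose)
  have perm: "permutation \<phi>" using phi fin by (auto simp: permutation_permutes)
  have inj: "inj (\<phi> ^^ i)" for i
    using permutes_inj[OF phi] by (rule inj_fn)
  have inH: "(\<phi> ^^ i) x \<in> H" if "x \<in> H" for i x
    using that by (induction i) (simp_all add: permutes_in_image[OF phi])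
  \<comment> \<open>\<open>\<epsilon>\<close> conjugates \<open>\<phi>\<close> to its inverse, so it maps orbits of \<open>\<phi>\<close> to orbits; none is fixed since
    \<open>\<epsilon>\<close> and \<open>\<rho>\<close> have no fixed points. One orbit of each pair is put into \<open>L\<close>.\<close>
  have conj: "(\<phi> ^^ i) (\<epsilon> ((\<phi> ^^ i) x)) = \<epsilon> x" for i x
  proof (induction i arbitrary: x)
    case (Suc i)
    have "(\<phi> ^^ Suc i) (\<epsilon> ((\<phi> ^^ Suc i) x)) = \<phi> ((\<phi> ^^ i) (\<epsilon> ((\<phi> ^^ i) (\<phi> x))))"
      by (simp add: funpow_swap1)
    also have "\<dots> = \<epsilon> x" unfolding Suc.IH by (simp add: \<phi>_def eps(2) rho(2))
    finally show ?case .
  qed simp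
  have nin: "\<epsilon> x \<notin> orbit \<phi> x" if x: "x \<in> H" for x
  proof
    assume "\<epsilon> x \<in> orbit \<phi> x"
    then obtain j where j: "\<epsilon> x = (\<phi> ^^ j) x" by (auto simp: orbit_altdef)
    \<comment> \<open>\<open>y\<close> is the midpoint of the path from \<open>x\<close> to
      \<open>\<epsilon> x\<close>. Cancelling \<open>i\<close> steps leaves
      \<open>\<epsilon> y = y\<close> or \<open>\<epsilon> y = \<rho> (\<epsilon> y)\<close>, a
      fixed point in either case.\<close>
    define i where "i = j div 2"
    define y where "y = (\<phi> ^^ i) x"
    have y: "y \<in> H" using inH[OF x] by (simp add: y_def)
    have "(\<phi> ^^ i) (\<epsilon> y) = (\<phi> ^^ j) x" using conj[of i x] j by (simp add: y_def)
    moreover have "(\<phi> ^^ j) x = (\<phi> ^^ i) ((\<phi> ^^ (j mod 2)) y)"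
    proof -
      have "j = i + (j mod 2 + i)" unfolding i_def by presburger
      then show ?thesis unfolding y_def by (metis funpow_add o_apply)
    qed
    ultimately have e: "\<epsilon> y = (\<phi> ^^ (j mod 2)) y" using inj[of i] by (auto dest: injD)
    show False
    proof (cases "even j")
      case True
      then show False using e eps(3)[OF y] by simp
    next
      case False
      then have "\<epsilon> y = \<rho> (\<epsilon> y)" using e by (simp add: \<phi>_def odd_iff_mod_2_eq_one)
      then show False using rho(3)[of "\<epsilon> y"] y permutes_in_image[OF eps(1)] by simp
    qed
  qed
  \<comment> \<open>A canonical label for each orbit, by which one orbit of each pair is chosen;
    countability of the type enters here.\<close>
  define f where "f x = Min (to_nat ` orbit \<phi> x)" for x
  have fin_orb: "finite (orbit \<phi> x)" for x
    by (rule finite_orbit[OF permutation_self_in_orbit[OF perm]])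
  have f_in: "\<exists>y\<in>orbit \<phi> x. f x = to_nat y" for x
  proof -
    have "f x \<in> to_nat ` orbit \<phi> x"
      unfolding f_def using fin_orb orbit_nonempty[of \<phi> x] by (intro Min_in) auto
    then show ?thesis by auto
  qed
  have cyc: "cyclic_on \<phi> (orbit \<phi> x)" for x by (rule cyclic_on_orbit'[OF perm])
  have f_neq: "f (\<epsilon> x) \<noteq> f x" if x: "x \<in> H" for x
  proof
    assume eq: "f (\<epsilon> x) = f x"
    obtain y z where "y \<in> orbit \<phi> x" "z \<in> orbit \<phi> (\<epsilon> x)" "to_nat y = to_nat z"
      using f_in[of x] f_in[of "\<epsilon> x"] eq by metis
    then have "y \<in> orbit \<phi> x" "y \<in> orbit \<phi> (\<epsilon> x)" by auto
    then have "orbit \<phi> x = orbit \<phi> (\<epsilon> x)"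
      using orbit_cyclic_eq3[OF cyc] by metis
    then show False using nin[OF x] permutation_self_in_orbit[OF perm] by metis
  qed
  define L where "L = {x. f x < f (\<epsilon> x)}"
  have "\<epsilon> x \<in> L \<longleftrightarrow> x \<notin> L" if "x \<in> H" for x
    using f_neq[OF that] by (auto simp: L_def eps(2))
  moreover have "\<rho> x \<in> L \<longleftrightarrow> x \<notin> L" if "x \<in> H" for x
  proof -
    have "\<rho> x = \<phi> (\<epsilon> x)" by (simp add: \<phi>_def eps(2))
    then have 1: "orbit \<phi> (\<rho> x) = orbit \<phi> (\<epsilon> x)" using permutation_orbit_step[OF perm] by simp
    have "\<phi> (\<epsilon> (\<rho> x)) = x" by (simp add: \<phi>_def eps(2) rho(2))
    then have 2: "orbit \<phi> (\<epsilon> (\<rho> x)) = orbit \<phi> x" using permutation_orbit_step[OF perm] by metis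
    show ?thesis using f_neq[OF that] 1 2 by (auto simp: L_def f_def)
  qed
  ultimately show thesis by (rule that)
qed

text \<open>Invariant subsets are the unions of orbits, and distinct sets of orbits have distinct
  unions.\<close>

lemma card_invariant_subsets:
  assumes "finite S" "\<sigma> permutes S"
  shows "card {T. T \<subseteq> S \<and> (\<forall>e\<in>S. \<sigma> e \<in> T \<longleftrightarrow> e \<in> T)} = 2 ^ card (cycles_on S \<sigma>)"
proof -
  have perm: "permutation \<sigma>" using assms by (auto simp: permutation_permutes)
  have self: "\<And>x. x \<in> orbit \<sigma> x" by (rule permutation_self_in_orbit[OF perm])
  have sub: "orbit \<sigma> x \<subseteq> S" if "x \<in> S" for x using permutes_orbit_subset assms that by metis
  have eq: "orbit \<sigma> y = orbit \<sigma> x" if "y \<in> orbit \<sigma> x" for x y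
    using orbit_cyclic_eq3[OF cyclic_on_orbit'[OF perm] that] .
  have "bij_betw Union (Pow (cycles_on S \<sigma>)) {T. T \<subseteq> S \<and> (\<forall>e\<in>S. \<sigma> e \<in> T \<longleftrightarrow> e \<in> T)}"
  proof (rule bij_betwI[where g = "\<lambda>T. orbit \<sigma> ` T"])
    show "Union \<in> Pow (cycles_on S \<sigma>) \<rightarrow> {T. T \<subseteq> S \<and> (\<forall>e\<in>S. \<sigma> e \<in> T \<longleftrightarrow> e \<in> T)}"
    proof (intro funcsetI CollectI conjI ballI)
      fix X assume "X \<in> Pow (cycles_on S \<sigma>)"
      then have X: "X \<subseteq> orbit \<sigma> ` S" by (simp add: cycles_on_def)
      show "\<Union>X \<subseteq> S" using X sub by blast
      fix e assume "e \<in> S"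
      have "\<sigma> e \<in> orbit \<sigma> x \<longleftrightarrow> e \<in> orbit \<sigma> x" for x
        using eq self permutation_orbit_step[OF perm] by metis
      then show "\<sigma> e \<in> \<Union>X \<longleftrightarrow> e \<in> \<Union>X" using X by blast
    qed
    show "(\<lambda>T. orbit \<sigma> ` T) \<in> {T. T \<subseteq> S \<and> (\<forall>e\<in>S. \<sigma> e \<in> T \<longleftrightarrow> e \<in> T)} \<rightarrow> Pow (cycles_on S \<sigma>)"
      by (auto simp: cycles_on_def)
    fix X assume "X \<in> Pow (cycles_on S \<sigma>)"
    then have X: "X \<subseteq> orbit \<sigma> ` S" by (simp add: cycles_on_def)
    show "orbit \<sigma> ` \<Union>X = X"
    proof (intro equalityI subsetI)
      fix c assume "c \<in> orbit \<sigma> ` \<Union>X"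
      then obtain d y where d: "d \<in> X" "y \<in> d" "c = orbit \<sigma> y" by auto
      moreover obtain x where "d = orbit \<sigma> x" using X d by auto
      ultimately show "c \<in> X" using eq by auto
    next
      fix c assume c: "c \<in> X"
      then obtain x where "c = orbit \<sigma> x" using X by auto
      then show "c \<in> orbit \<sigma> ` \<Union>X" using c self by blast
    qed
  next
    fix T assume "T \<in> {T. T \<subseteq> S \<and> (\<forall>e\<in>S. \<sigma> e \<in> T \<longleftrightarrow> e \<in> T)}"
    then have T: "T \<subseteq> S" "\<And>e. e \<in> S \<Longrightarrow> \<sigma> e \<in> T \<longleftrightarrow> e \<in> T" by auto
    have "orbit \<sigma> x \<subseteq> T" if x: "x \<in> T" for x
    proof
      fix y assume "y \<in> orbit \<sigma> x"
      then show "y \<in> T" by induct (use T x in auto)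
    qed
    then show "\<Union> (orbit \<sigma> ` T) = T" using self by blast
  qed
  then show ?thesis
    using assms by (simp add: bij_betw_same_card[symmetric] card_Pow cycles_on_def)
qed

text \<open>
  A tuple of \<open>k\<close> edges is a labelling of the half-edges \<open>(e, False)\<close> (tail) and \<open>(e, True)\<close> (head), \<open>e < k\<close>,
  by vertices. It is balanced if it is two-regular and every vertex is the head of one edge and the tail of one.
\<close>

type_synonym 'a labelling = "nat \<times> bool \<Rightarrow> 'a"

text \<open>On \<open>bool\<close> the inequality is exclusive or: the edges in \<open>T\<close>
  exchange head and tail.\<close>

definition edge_flip :: "nat set \<Rightarrow> 'a labelling \<Rightarrow> 'a labelling" where
  "edge_flip T v = (\<lambda>(e, b). v (e, b \<noteq> (e \<in> T)))"

definition half_edges :: "nat \<Rightarrow> (nat \<times> bool) set" where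
  "half_edges k = {..<k} \<times> UNIV"

definition two_regular :: "nat \<Rightarrow> 'a labelling \<Rightarrow> bool" where
  "two_regular k v \<longleftrightarrow> (\<forall>x\<in>half_edges k. card {y \<in> half_edges k. v y = v x} = 2)"

definition balanced :: "nat \<Rightarrow> 'a labelling \<Rightarrow> bool" where
  "balanced k v \<longleftrightarrow> two_regular k v \<and>
     (\<forall>x\<in>half_edges k. \<forall>y\<in>half_edges k. x \<noteq> y \<and> v x = v y \<longrightarrow> snd x \<noteq> snd y)"

section \<open>Edge reversal and two-regularity\<close>

lemma edge_flip_apply: "edge_flip T v x = v (fst x, snd x \<noteq> (fst x \<in> T))"
  by (cases x) (simp add: edge_flip_def)

lemma edge_flip_edge_flip: "edge_flip T (edge_flip U v) = edge_flip (sym_diff T U) v"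
  by (auto simp: edge_flip_def fun_eq_iff intro!: arg_cong[where f = v])

lemma edge_flip_self [simp]: "edge_flip T (edge_flip T v) = v"
  by (auto simp: edge_flip_def fun_eq_iff intro!: arg_cong[where f = v])

lemma edge_flip_PiE: "v \<in> PiE (half_edges k) (\<lambda>_. A) \<Longrightarrow> edge_flip T v \<in> PiE (half_edges k) (\<lambda>_. A)"
  by (auto simp: edge_flip_def PiE_iff half_edges_def extensional_def)

lemma finite_half_edges [simp]: "finite (half_edges k)" and card_half_edges: "card (half_edges k) = 2 * k"
  by (simp_all add: half_edges_def card_cartesian_product)

lemma two_regular_edge_flip_aux:
  assumes "two_regular k v" shows "two_regular k (edge_flip T v)"
  unfolding two_regular_def
proof
  fix x assume x: "x \<in> half_edges k"
  \<comment> \<open>The involution of half-edges with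
    \<open>edge_flip T v = v \<circ> \<tau>\<close>; it carries fibres of one labelling to fibres of
    the other.\<close>
  define \<tau> where "\<tau> = (\<lambda>x. (fst x, snd x \<noteq> (fst x \<in> T)))"
  have tt: "\<tau> (\<tau> y) = y" for y by (cases y) (auto simp: \<tau>_def)
  have th: "\<tau> y \<in> half_edges k \<longleftrightarrow> y \<in> half_edges k" for y by (cases y) (auto simp: \<tau>_def half_edges_def)
  have "{y \<in> half_edges k. edge_flip T v y = edge_flip T v x} = \<tau> ` {y \<in> half_edges k. v y = v (\<tau> x)}"
  proof (intro equalityI subsetI)
    fix y assume "y \<in> {y \<in> half_edges k. edge_flip T v y = edge_flip T v x}"
    then have "\<tau> y \<in> {y \<in> half_edges k. v y = v (\<tau> x)}"
      using th[of y] by (auto simp: edge_flip_apply \<tau>_def)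
    then show "y \<in> \<tau> ` {y \<in> half_edges k. v y = v (\<tau> x)}" using tt[of y] by (metis image_eqI)
  next
    fix y assume "y \<in> \<tau> ` {y \<in> half_edges k. v y = v (\<tau> x)}"
    then obtain z where z: "z \<in> half_edges k" "v z = v (\<tau> x)" "y = \<tau> z" by auto
    then show "y \<in> {y \<in> half_edges k. edge_flip T v y = edge_flip T v x}"
      using th[of z] tt[of z] by (auto simp: edge_flip_apply \<tau>_def)
  qed
  moreover have "inj_on \<tau> {y \<in> half_edges k. v y = v (\<tau> x)}" using tt by (metis inj_onI)
  moreover have "\<tau> x \<in> half_edges k" using th x by simp
  ultimately show "card {y \<in> half_edges k. edge_flip T v y = edge_flip T v x} = 2"
    using assms by (simp add: card_image two_regular_def)
qed

lemma two_regular_edge_flip [simp]: "two_regular k (edge_flip T v) \<longleftrightarrow> two_regular k v"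
  using two_regular_edge_flip_aux[of k v T] two_regular_edge_flip_aux[of k "edge_flip T v" T] by auto

lemma two_regular_partner:
  assumes "two_regular k v" "x \<in> half_edges k"
  shows "\<exists>!y. y \<in> half_edges k \<and> y \<noteq> x \<and> v y = v x"
proof -
  obtain a b where ab: "{y \<in> half_edges k. v y = v x} = {a, b}" "a \<noteq> b"
    using assms unfolding two_regular_def card_2_iff by blast
  have x: "x \<in> {a, b}" using assms ab(1) by blast
  have iff: "y \<in> half_edges k \<and> v y = v x \<longleftrightarrow> y \<in> {a, b}" for y unfolding ab(1)[symmetric] by simp
  have "y \<in> half_edges k \<and> y \<noteq> x \<and> v y = v x \<longleftrightarrow> y = (if x = a then b else a)" for y
    using x ab(2) iff[of y] by auto
  then show ?thesis by simp
qed

text \<open>Half-edges carry two perfect matchings: ends of the same edge, and half-edges at the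
  same vertex. A colour class \<open>L\<close> contains one end of each edge and one half-edge at
  each vertex, so it can serve as the set of tails.\<close>

lemma ex_balanced_flip:
  assumes "two_regular k v"
  shows "\<exists>T\<subseteq>{..<k}. balanced k (edge_flip T v)"
proof -
  define \<epsilon> where "\<epsilon> = (\<lambda>x. if x \<in> half_edges k then (fst x, \<not> snd x) else x)"
  define \<rho> where "\<rho> = (\<lambda>x. if x \<in> half_edges k then (THE y. y \<in> half_edges k \<and> y \<noteq> x \<and> v y = v x) else x)"
  have rho: "\<rho> x \<in> half_edges k" "\<rho> x \<noteq> x" "v (\<rho> x) = v x" if "x \<in> half_edges k" for x
    using theI'[OF two_regular_partner[OF assms that]] that by (auto simp: \<rho>_def)
  have rho_eq: "y = \<rho> x" if "x \<in> half_edges k" "y \<in> half_edges k" "y \<noteq> x" "v y = v x" for x y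
    using two_regular_partner[OF assms that(1)] that rho[OF that(1)] by blast
  have rr: "\<rho> (\<rho> x) = x" for x
  proof (cases "x \<in> half_edges k")
    case True
    show ?thesis using rho_eq[of "\<rho> x" x] rho[OF True] True by simp
  qed (simp add: \<rho>_def)
  have ee: "\<epsilon> (\<epsilon> x) = x" for x by (cases x) (auto simp: \<epsilon>_def half_edges_def)
  have perm: "f permutes half_edges k" if "\<And>x. f (f x) = x" "\<And>x. x \<notin> half_edges k \<Longrightarrow> f x = x" for f
    unfolding permutes_def using that by metis
  obtain L where L: "\<And>x. x \<in> half_edges k \<Longrightarrow> \<epsilon> x \<in> L \<longleftrightarrow> x \<notin> L" "\<And>x. x \<in> half_edges k \<Longrightarrow> \<rho> x \<in> L \<longleftrightarrow> x \<notin> L"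
  proof (rule two_matchings_bipartite[of "half_edges k" \<epsilon> \<rho>])
    show "\<epsilon> permutes half_edges k" by (rule perm) (auto simp: ee, auto simp: \<epsilon>_def)
    show "\<rho> permutes half_edges k" by (rule perm) (auto simp: rr, auto simp: \<rho>_def)
    show "\<epsilon> x \<noteq> x" if "x \<in> half_edges k" for x using that by (cases x) (auto simp: \<epsilon>_def)
  qed (use ee rr rho in auto)
  \<comment> \<open>Exactly the edges whose present tail lies outside \<open>L\<close> are reversed;
    afterwards the half-edges of \<open>L\<close> sit at the tails.\<close>
  define T where "T = {e. e < k \<and> (e, False) \<notin> L}"
  define \<tau> where "\<tau> = (\<lambda>x::nat\<times>bool. (fst x, snd x \<noteq> (fst x \<in> T)))"
  have L2: "(e, True) \<in> L \<longleftrightarrow> (e, False) \<notin> L" if "e < k" for e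
    using L(1)[of "(e, False)"] that by (simp add: \<epsilon>_def half_edges_def)
  have tauL: "\<tau> x \<in> L \<longleftrightarrow> \<not> snd x" if "x \<in> half_edges k" for x
    using that L2[of "fst x"] by (cases x; cases "snd x") (auto simp: \<tau>_def T_def half_edges_def)
  have tau: "\<tau> x \<in> half_edges k" if "x \<in> half_edges k" for x using that by (cases x) (auto simp: \<tau>_def half_edges_def)
  have "balanced k (edge_flip T v)"
    unfolding balanced_def
  proof (intro conjI ballI impI)
    fix x y assume xy: "x \<in> half_edges k" "y \<in> half_edges k" "x \<noteq> y \<and> edge_flip T v x = edge_flip T v y"
    have "\<tau> x \<noteq> \<tau> y" using xy by (cases x; cases y) (auto simp: \<tau>_def)
    moreover have "v (\<tau> x) = v (\<tau> y)" using xy by (simp add: edge_flip_apply \<tau>_def)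
    ultimately have "\<tau> x = \<rho> (\<tau> y)" using rho_eq[of "\<tau> y" "\<tau> x"] tau xy by auto
    then show "snd x \<noteq> snd y" using L(2)[OF tau[OF xy(2)]] tauL[OF xy(1)] tauL[OF xy(2)] by auto
  qed (use assms in simp)
  then show ?thesis by (intro exI[of _ T]) (auto simp: T_def)
qed

text \<open>Edge \<open>e\<close> starts at \<open>p e\<close>, and \<open>\<sigma> e\<close> is the
  edge that follows it, so the head of \<open>e\<close> is the tail of \<open>\<sigma> e\<close>.
  The cycles of \<open>\<sigma>\<close> are the oriented cycles of the multigraph.\<close>

definition perm_labelling :: "nat \<Rightarrow> (nat \<Rightarrow> nat) \<Rightarrow> (nat \<Rightarrow> 'a) \<Rightarrow> 'a labelling" where
  "perm_labelling k \<sigma> p = restrict (\<lambda>(e, b). if b then p (\<sigma> e) else p e) (half_edges k)"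

lemma perm_labelling_eq_iff:
  assumes "\<sigma> permutes {..<k}" "inj_on p {..<k}" "x \<in> half_edges k" "y \<in> half_edges k"
  shows "perm_labelling k \<sigma> p x = perm_labelling k \<sigma> p y \<longleftrightarrow>
    (if snd x then \<sigma> (fst x) else fst x) = (if snd y then \<sigma> (fst y) else fst y)"
proof -
  define i where "i z = (if snd z then \<sigma> (fst z) else fst z)" for z :: "nat \<times> bool"
  have "perm_labelling k \<sigma> p z = p (i z)" "i z \<in> {..<k}" if "z \<in> half_edges k" for z
    using that permutes_in_image[OF assms(1), of "fst z"]
    by (auto simp: perm_labelling_def i_def half_edges_def case_prod_beta)
  then have "perm_labelling k \<sigma> p x = perm_labelling k \<sigma> p y \<longleftrightarrow> i x = i y"
    using assms by (simp add: inj_on_eq_iff)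
  then show ?thesis by (simp only: i_def)
qed

lemma perm_labelling_partner:
  assumes "\<sigma> permutes {..<k}" "inj_on p {..<k}" "x \<in> half_edges k" "y \<in> half_edges k"
  shows "perm_labelling k \<sigma> p x = perm_labelling k \<sigma> p y \<and> x \<noteq> y \<longleftrightarrow>
    (snd x \<and> \<not> snd y \<and> fst y = \<sigma> (fst x)) \<or> (\<not> snd x \<and> snd y \<and> fst x = \<sigma> (fst y))"
proof -
  obtain e b f c where xy: "x = (e, b)" "y = (f, c)" by (cases x, cases y) auto
  have "\<sigma> e = \<sigma> f \<longleftrightarrow> e = f" using permutes_inj[OF assms(1)] by (simp add: inj_eq)
  then show ?thesis unfolding perm_labelling_eq_iff[OF assms] unfolding xy by (cases b; cases c) auto
qed

lemma two_regular_perm_labelling: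
  assumes s: "\<sigma> permutes {..<k}" and p: "inj_on p {..<k}"
  shows "two_regular k (perm_labelling k \<sigma> p)"
  unfolding two_regular_def
proof
  fix x assume x: "x \<in> half_edges k"
  \<comment> \<open>The partner of the head of an edge is the tail of the next edge; that of a tail
    is the head of the preceding edge.\<close>
  define z where "z = (if snd x then (\<sigma> (fst x), False) else (inv \<sigma> (fst x), True))"
  have z: "z \<in> half_edges k" using x permutes_in_image[OF s, of "fst x"]
      permutes_in_image[OF permutes_inv[OF s], of "fst x"]
    by (auto simp: z_def half_edges_def)
  have zx: "z \<noteq> x" by (cases x) (auto simp: z_def)
  have "{y \<in> half_edges k. perm_labelling k \<sigma> p y = perm_labelling k \<sigma> p x} = {z, x}"
  proof -
    have "perm_labelling k \<sigma> p y = perm_labelling k \<sigma> p x \<and> y \<noteq> x \<longleftrightarrow> y = z" if y: "y \<in> half_edges k" for y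
    proof -
      have "fst x = \<sigma> (fst y) \<longleftrightarrow> fst y = inv \<sigma> (fst x)"
        using permutes_inv_eq[OF s] by metis
      then show ?thesis unfolding perm_labelling_partner[OF s p y x] by (cases y) (auto simp: z_def)
    qed
    then show ?thesis using z x zx by blast
  qed
  then show "card {y \<in> half_edges k. perm_labelling k \<sigma> p y = perm_labelling k \<sigma> p x} = 2" using zx by simp
qed

text \<open>The head of \<open>e\<close> shares its vertex with the tail of
  \<open>\<sigma> e\<close>. After flipping they are still a head and a tail exactly when both edges
  or neither are flipped, so \<open>T\<close> must be constant along cycles.\<close>

lemma balanced_edge_flip_perm_labelling_iff:
  assumes s: "\<sigma> permutes {..<k}" and p: "inj_on p {..<k}"
  shows "balanced k (edge_flip T (perm_labelling k \<sigma> p)) \<longleftrightarrow> (\<forall>e\<in>{..<k}. \<sigma> e \<in> T \<longleftrightarrow> e \<in> T)"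
proof
  define \<tau> where "\<tau> = (\<lambda>x::nat\<times>bool. (fst x, snd x \<noteq> (fst x \<in> T)))"
  have tau: "\<tau> x \<in> half_edges k" if "x \<in> half_edges k" for x using that by (cases x) (auto simp: \<tau>_def half_edges_def)
  assume b: "balanced k (edge_flip T (perm_labelling k \<sigma> p))"
  show "\<forall>e\<in>{..<k}. \<sigma> e \<in> T \<longleftrightarrow> e \<in> T"
  proof
    fix e assume e: "e \<in> {..<k}"
    define x y where "x = \<tau> (e, True)" and "y = \<tau> (\<sigma> e, False)"
    have m: "(e, True) \<in> half_edges k" "(\<sigma> e, False) \<in> half_edges k"
      using e permutes_in_image[OF s, of e] by (auto simp: half_edges_def)
    have xy: "x \<in> half_edges k" "y \<in> half_edges k"
      using tau[OF m(1)] tau[OF m(2)] by (simp_all add: x_def y_def)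
    have tt: "\<tau> x = (e, True)" "\<tau> y = (\<sigma> e, False)" by (auto simp: x_def y_def \<tau>_def)
    have "perm_labelling k \<sigma> p (\<tau> x) = perm_labelling k \<sigma> p (\<tau> y)"
      unfolding tt using perm_labelling_partner[OF s p m] by simp
    then have "edge_flip T (perm_labelling k \<sigma> p) x = edge_flip T (perm_labelling k \<sigma> p) y"
      by (simp add: edge_flip_apply \<tau>_def)
    moreover have "x \<noteq> y" using tt by auto
    ultimately have "snd x \<noteq> snd y" using b xy unfolding balanced_def by blast
    then show "\<sigma> e \<in> T \<longleftrightarrow> e \<in> T" by (auto simp: x_def y_def \<tau>_def)
  qed
next
  define \<tau> where "\<tau> = (\<lambda>x::nat\<times>bool. (fst x, snd x \<noteq> (fst x \<in> T)))"
  have tau: "\<tau> x \<in> half_edges k" if "x \<in> half_edges k" for x using that by (cases x) (auto simp: \<tau>_def half_edges_def)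
  assume T: "\<forall>e\<in>{..<k}. \<sigma> e \<in> T \<longleftrightarrow> e \<in> T"
  show "balanced k (edge_flip T (perm_labelling k \<sigma> p))"
    unfolding balanced_def
  proof (intro conjI ballI impI)
    fix x y assume xy: "x \<in> half_edges k" "y \<in> half_edges k" "x \<noteq> y \<and> edge_flip T (perm_labelling k \<sigma> p) x = edge_flip T (perm_labelling k \<sigma> p) y"
    have "\<tau> x \<noteq> \<tau> y" using xy by (cases x; cases y) (auto simp: \<tau>_def)
    moreover have "perm_labelling k \<sigma> p (\<tau> x) = perm_labelling k \<sigma> p (\<tau> y)" using xy by (simp add: edge_flip_apply \<tau>_def)
    ultimately have "(snd (\<tau> x) \<and> \<not> snd (\<tau> y) \<and> fst (\<tau> y) = \<sigma> (fst (\<tau> x))) \<or>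
        (\<not> snd (\<tau> x) \<and> snd (\<tau> y) \<and> fst (\<tau> x) = \<sigma> (fst (\<tau> y)))"
      using perm_labelling_partner[OF s p tau tau] xy by blast
    then show "snd x \<noteq> snd y" using T xy by (auto simp: \<tau>_def half_edges_def)
  qed (simp add: two_regular_perm_labelling[OF s p])
qed

lemma balanced_perm_labelling:
  assumes "\<sigma> permutes {..<k}" "inj_on p {..<k}"
  shows "balanced k (perm_labelling k \<sigma> p)"
proof -
  have "edge_flip {} (perm_labelling k \<sigma> p) = perm_labelling k \<sigma> p" by (auto simp: edge_flip_def fun_eq_iff)
  then show ?thesis using balanced_edge_flip_perm_labelling_iff[OF assms, of "{}"] by simp
qed

lemma card_balanced_flips:
  assumes "\<sigma> permutes {..<k}" "inj_on p {..<k}"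
  shows "card {T. T \<subseteq> {..<k} \<and> balanced k (edge_flip T (perm_labelling k \<sigma> p))} = 2 ^ card (cycles_on {..<k} \<sigma>)"
  unfolding balanced_edge_flip_perm_labelling_iff[OF assms] using assms by (intro card_invariant_subsets) auto

text \<open>\<open>p\<close> is read off the tails. The head of \<open>e\<close> shares its vertex
  with the tail of one edge, and that edge is \<open>\<sigma> e\<close>; outside
  \<open>{..<k}\<close> the identity is used, as \<open>permutes\<close> demands.\<close>

lemma balanced_imp_perm_labelling:
  assumes v: "v \<in> PiE (half_edges k) (\<lambda>_. A)" and b: "balanced k v"
  obtains \<sigma> p where "\<sigma> permutes {..<k}" "p \<in> PiE {..<k} (\<lambda>_. A)" "inj_on p {..<k}" "v = perm_labelling k \<sigma> p"
proof -
  define p where "p = restrict (\<lambda>e. v (e, False)) {..<k}"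
  have neq: "snd x \<noteq> snd y" if "x \<in> half_edges k" "y \<in> half_edges k" "x \<noteq> y" "v x = v y" for x y
    using b that unfolding balanced_def by blast
  have reg: "two_regular k v" using b by (simp add: balanced_def)
  have injp: "inj_on p {..<k}"
  proof (rule inj_onI)
    fix e f assume "e \<in> {..<k}" "f \<in> {..<k}" "p e = p f"
    then show "e = f" using neq[of "(e, False)" "(f, False)"] by (auto simp: p_def half_edges_def)
  qed
  have ex: "\<exists>f<k. v (e, True) = v (f, False)" if "e < k" for e
  proof -
    have e: "(e, True) \<in> half_edges k" using that by (simp add: half_edges_def)
    obtain y where y: "y \<in> half_edges k" "y \<noteq> (e, True)" "v y = v (e, True)"
      using two_regular_partner[OF reg e] by blast
    then show ?thesis using neq[OF y(1) e y(2,3)] by (cases y) (auto simp: half_edges_def)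
  qed
  then obtain s where s: "\<And>e. e < k \<Longrightarrow> s e < k \<and> v (e, True) = v (s e, False)" by metis
  define \<sigma> where "\<sigma> e = (if e < k then s e else e)" for e
  have "inj_on s {..<k}"
  proof (rule inj_onI)
    fix e f assume "e \<in> {..<k}" "f \<in> {..<k}" "s e = s f"
    then show "e = f" using s[of e] s[of f] neq[of "(e, True)" "(f, True)"] by (auto simp: half_edges_def)
  qed
  then have "bij_betw s {..<k} {..<k}"
  proof -
    assume inj: "inj_on s {..<k}"
    have "s ` {..<k} = {..<k}" using s by (intro endo_inj_surj inj) auto
    then show ?thesis using inj by (simp add: bij_betw_def)
  qed
  then have "bij_betw \<sigma> {..<k} {..<k}"
    by (rule iffD1[OF bij_betw_cong, rotated]) (simp add: \<sigma>_def)
  then have perm: "\<sigma> permutes {..<k}" by (rule bij_imp_permutes) (simp add: \<sigma>_def)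
  have "v = perm_labelling k \<sigma> p"
  proof
    fix x show "v x = perm_labelling k \<sigma> p x"
      using v s[of "fst x"] by (cases x; cases "x \<in> half_edges k")
        (auto simp: perm_labelling_def p_def \<sigma>_def half_edges_def PiE_iff extensional_def)
  qed
  moreover have "p \<in> PiE {..<k} (\<lambda>_. A)" using v by (auto simp: p_def half_edges_def PiE_iff)
  ultimately show thesis using that perm injp by blast
qed

text \<open>The parametrisation is one-to-one: tails determine \<open>p\<close>, and since
  \<open>p\<close> is injective the heads then determine \<open>\<sigma>\<close>.\<close>

lemma sum_balanced:
  fixes F :: "'a labelling \<Rightarrow> real"
  assumes A: "finite A"
  shows "(\<Sum>v | v \<in> PiE (half_edges k) (\<lambda>_. A) \<and> balanced k v. F v)
    = (\<Sum>\<sigma> | \<sigma> permutes {..<k}. \<Sum>p | p \<in> PiE {..<k} (\<lambda>_. A) \<and> inj_on p {..<k}. F (perm_labelling k \<sigma> p))"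
proof -
  let ?S = "{\<sigma>. \<sigma> permutes {..<k}}" and ?P = "{p. p \<in> PiE {..<k} (\<lambda>_. A) \<and> inj_on p {..<k}}"
  have "bij_betw (\<lambda>(\<sigma>, p). perm_labelling k \<sigma> p) (?S \<times> ?P) {v. v \<in> PiE (half_edges k) (\<lambda>_. A) \<and> balanced k v}"
    unfolding bij_betw_def
  proof
    show "inj_on (\<lambda>(\<sigma>, p). perm_labelling k \<sigma> p) (?S \<times> ?P)"
    proof (rule inj_onI, clarify)
      fix \<sigma> p \<sigma>' p' assume a: "\<sigma> permutes {..<k}" "\<sigma>' permutes {..<k}" "p \<in> PiE {..<k} (\<lambda>_. A)"
        "p' \<in> PiE {..<k} (\<lambda>_. A)" "inj_on p {..<k}" "inj_on p' {..<k}" "perm_labelling k \<sigma> p = perm_labelling k \<sigma>' p'"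
      have 1: "p e = p' e" if "e < k" for e
        using fun_cong[OF a(7), of "(e, False)"] that by (simp add: perm_labelling_def half_edges_def)
      then have pp: "p = p'" using a(3,4) by (intro PiE_ext) auto
      have "\<sigma> e = \<sigma>' e" for e
      proof (cases "e < k")
        case True
        have "p (\<sigma> e) = p (\<sigma>' e)"
          using fun_cong[OF a(7), of "(e, True)"] True pp by (simp add: perm_labelling_def half_edges_def)
        moreover have "\<sigma> e < k" "\<sigma>' e < k"
          using permutes_in_image[OF a(1), of e] permutes_in_image[OF a(2), of e] True by auto
        ultimately show ?thesis using inj_onD[OF a(5)] by auto
      next
        case False
        then show ?thesis using a permutes_not_in by (metis lessThan_iff)
      qed
      then show "\<sigma> = \<sigma>' \<and> p = p'" using pp by auto
    qed
    show "(\<lambda>(\<sigma>, p). perm_labelling k \<sigma> p) ` (?S \<times> ?P) = {v. v \<in> PiE (half_edges k) (\<lambda>_. A) \<and> balanced k v}"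
    proof (intro equalityI subsetI)
      fix v assume "v \<in> (\<lambda>(\<sigma>, p). perm_labelling k \<sigma> p) ` (?S \<times> ?P)"
      then obtain \<sigma> p where v: "v = perm_labelling k \<sigma> p" "\<sigma> permutes {..<k}" "p \<in> PiE {..<k} (\<lambda>_. A)" "inj_on p {..<k}"
        by auto
      have "v \<in> PiE (half_edges k) (\<lambda>_. A)"
        using v permutes_in_image[OF v(2)]
        by (auto simp: perm_labelling_def half_edges_def PiE_iff split: if_splits)
      then show "v \<in> {v. v \<in> PiE (half_edges k) (\<lambda>_. A) \<and> balanced k v}" using balanced_perm_labelling v by auto
    next
      fix v assume v: "v \<in> {v. v \<in> PiE (half_edges k) (\<lambda>_. A) \<and> balanced k v}"
      then obtain \<sigma> p where "\<sigma> permutes {..<k}" "p \<in> PiE {..<k} (\<lambda>_. A)" "inj_on p {..<k}" "v = perm_labelling k \<sigma> p"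
        by (auto elim: balanced_imp_perm_labelling)
      then show "v \<in> (\<lambda>(\<sigma>, p). perm_labelling k \<sigma> p) ` (?S \<times> ?P)" by auto
    qed
  qed
  from sum.reindex_bij_betw[OF this, of F] show ?thesis
    by (simp add: sum.cartesian_product case_prod_beta)
qed

text \<open>
  Every two-regular labelling becomes balanced under some flips, and for a balanced labelling with
  permutation \<open>\<sigma>\<close> the flips that keep it balanced are the unions of cycles of \<open>\<sigma>\<close>; this double
  counting produces one factor \<open>1/2\<close> per cycle.
\<close>

lemma sum_two_regular:
  fixes F :: "'a labelling \<Rightarrow> real"
  assumes A: "finite A" and F: "\<And>T v. v \<in> PiE (half_edges k) (\<lambda>_. A) \<Longrightarrow> T \<subseteq> {..<k} \<Longrightarrow> F (edge_flip T v) = F v"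
  shows "(\<Sum>v | v \<in> PiE (half_edges k) (\<lambda>_. A) \<and> two_regular k v. F v)
    = 2 ^ k * (\<Sum>\<sigma> | \<sigma> permutes {..<k}. (\<Sum>p | p \<in> PiE {..<k} (\<lambda>_. A) \<and> inj_on p {..<k}. F (perm_labelling k \<sigma> p))
        / 2 ^ card (cycles_on {..<k} \<sigma>))"
proof -
  define V where "V = PiE (half_edges k) (\<lambda>_. A)"
  define n where "n v = card {T. T \<subseteq> {..<k} \<and> balanced k (edge_flip T v)}" for v :: "'a labelling"
  have finV: "finite V" unfolding V_def using A by (auto intro!: finite_PiE)
  \<comment> \<open>Flips compose by symmetric difference, so the balanced flips of
    \<open>edge_flip T v\<close> are those of \<open>v\<close> translated by
    \<open>T\<close>.\<close>
  have n_flip: "n (edge_flip T v) = n v" if T: "T \<subseteq> {..<k}" for T v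
  proof -
    have "bij_betw (\<lambda>U. sym_diff U T) {U. U \<subseteq> {..<k} \<and> balanced k (edge_flip U (edge_flip T v))}
        {U. U \<subseteq> {..<k} \<and> balanced k (edge_flip U v)}"
    proof (rule bij_betwI[where g = "\<lambda>U. sym_diff U T"])
      have "sym_diff (sym_diff U T) T = U" for U by auto
      then show "(\<lambda>U. sym_diff U T) \<in> {U. U \<subseteq> {..<k} \<and> balanced k (edge_flip U v)} \<rightarrow> {U. U \<subseteq> {..<k} \<and> balanced k (edge_flip U (edge_flip T v))}"
        using T unfolding edge_flip_edge_flip by auto
      show "(\<lambda>U. sym_diff U T) \<in> {U. U \<subseteq> {..<k} \<and> balanced k (edge_flip U (edge_flip T v))} \<rightarrow> {U. U \<subseteq> {..<k} \<and> balanced k (edge_flip U v)}"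
        using T unfolding edge_flip_edge_flip by auto
    qed auto
    then show ?thesis unfolding n_def by (rule bij_betw_same_card)
  qed
  have n_pos: "n v > 0" if "two_regular k v" for v
  proof -
    have "finite {T. T \<subseteq> {..<k} \<and> balanced k (edge_flip T v)}" by simp
    then show ?thesis using ex_balanced_flip[OF that] by (auto simp: n_def card_gt_0_iff)
  qed
  \<comment> \<open>\<open>F v\<close> is spread equally over the \<open>n v\<close> flips that
    balance \<open>v\<close>. After exchanging the sums, flipping by a fixed \<open>T\<close> is a
    bijection, so the inner sum is the same for each of the \<open>2 ^ k\<close> sets
    \<open>T\<close>.\<close>
  have "(\<Sum>v | v \<in> V \<and> two_regular k v. F v)
     = (\<Sum>v | v \<in> V \<and> two_regular k v. \<Sum>T\<in>Pow {..<k}. if balanced k (edge_flip T v) then F (edge_flip T v) / n (edge_flip T v) else 0)"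
  proof (intro sum.cong refl)
    fix v assume v: "v \<in> {v. v \<in> V \<and> two_regular k v}"
    have "(\<Sum>T\<in>Pow {..<k}. if balanced k (edge_flip T v) then F (edge_flip T v) / n (edge_flip T v) else 0)
      = (\<Sum>T\<in>Pow {..<k}. if balanced k (edge_flip T v) then F v / n v else 0)"
      using F v n_flip by (intro sum.cong refl) (auto simp: V_def)
    also have "\<dots> = (\<Sum>T | T \<in> Pow {..<k} \<and> balanced k (edge_flip T v). F v / n v)"
      by (rule sum.inter_filter[symmetric]) simp
    also have "\<dots> = real (n v) * (F v / real (n v))" by (simp add: n_def)
    also have "\<dots> = F v" using n_pos[of v] v by simp
    finally show "F v = (\<Sum>T\<in>Pow {..<k}. if balanced k (edge_flip T v) then F (edge_flip T v) / n (edge_flip T v) else 0)" ..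
  qed
  also have "\<dots> = (\<Sum>T\<in>Pow {..<k}. \<Sum>v | v \<in> V \<and> two_regular k v. if balanced k (edge_flip T v) then F (edge_flip T v) / n (edge_flip T v) else 0)"
    by (rule sum.swap)
  also have "\<dots> = (\<Sum>T\<in>Pow {..<k}. \<Sum>v | v \<in> V \<and> balanced k v. F v / n v)"
  proof (rule sum.cong[OF refl])
    fix T assume T: "T \<in> Pow {..<k}"
    have "(\<Sum>v | v \<in> V \<and> two_regular k v. if balanced k (edge_flip T v) then F (edge_flip T v) / n (edge_flip T v) else 0)
      = (\<Sum>v | v \<in> {v. v \<in> V \<and> two_regular k v} \<and> balanced k (edge_flip T v). F (edge_flip T v) / n (edge_flip T v))"
      using finV by (intro sum.inter_filter[symmetric]) auto
    also have "\<dots> = (\<Sum>v | v \<in> V \<and> balanced k v. F v / n v)"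
      by (rule sum.reindex_bij_witness[where i = "edge_flip T" and j = "edge_flip T"])
         (auto simp: V_def edge_flip_PiE balanced_def)
    finally show "(\<Sum>v | v \<in> V \<and> two_regular k v. if balanced k (edge_flip T v) then F (edge_flip T v) / n (edge_flip T v) else 0)
       = (\<Sum>v | v \<in> V \<and> balanced k v. F v / n v)" .
  qed
  also have "\<dots> = 2 ^ k * (\<Sum>v | v \<in> V \<and> balanced k v. F v / n v)"
    by (simp add: card_Pow)
  also have "(\<Sum>v | v \<in> V \<and> balanced k v. F v / n v)
     = (\<Sum>\<sigma> | \<sigma> permutes {..<k}. (\<Sum>p | p \<in> PiE {..<k} (\<lambda>_. A) \<and> inj_on p {..<k}. F (perm_labelling k \<sigma> p))
        / 2 ^ card (cycles_on {..<k} \<sigma>))"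
    unfolding V_def sum_balanced[OF A] sum_divide_distrib
    by (intro sum.cong refl) (simp add: n_def card_balanced_flips)
  finally show ?thesis by (simp add: V_def)
qed

section \<open>Moments of a sum over pairs with mean-zero kernels\<close>

lemma double_sum_power:
  fixes q :: "'a \<Rightarrow> 'a \<Rightarrow> real"
  assumes "finite A"
  shows "(\<Sum>i\<in>A. \<Sum>j\<in>A. q i j) ^ k
    = (\<Sum>v\<in>PiE (half_edges k) (\<lambda>_. A). \<Prod>e<k. q (v (e, False)) (v (e, True)))"
proof -
  have "(\<Sum>i\<in>A. \<Sum>j\<in>A. q i j) ^ k = (\<Prod>e<k. \<Sum>z\<in>A \<times> A. q (fst z) (snd z))"
    by (simp add: sum.cartesian_product case_prod_beta)
  also have "\<dots> = (\<Sum>f\<in>PiE {..<k} (\<lambda>_. A \<times> A). \<Prod>e<k. q (fst (f e)) (snd (f e)))"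
    using assms by (intro prod_sum_PiE) auto
  also have "\<dots> = (\<Sum>v\<in>PiE (half_edges k) (\<lambda>_. A). \<Prod>e<k. q (v (e, False)) (v (e, True)))"
  proof (rule sum.reindex_bij_witness[where
        j = "\<lambda>f. restrict (\<lambda>(e, b). if b then snd (f e) else fst (f e)) (half_edges k)" and
        i = "\<lambda>v. restrict (\<lambda>e. (v (e, False), v (e, True))) {..<k}"])
    fix v assume v: "v \<in> PiE (half_edges k) (\<lambda>_. A)"
    show "restrict (\<lambda>e. (v (e, False), v (e, True))) {..<k} \<in> PiE {..<k} (\<lambda>_. A \<times> A)"
      using v by (auto simp: half_edges_def PiE_iff)
    show "restrict (\<lambda>(e, b). if b then snd (restrict (\<lambda>e. (v (e, False), v (e, True))) {..<k} e)
        else fst (restrict (\<lambda>e. (v (e, False), v (e, True))) {..<k} e)) (half_edges k) = v"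
      using v by (auto simp: fun_eq_iff half_edges_def PiE_iff extensional_def restrict_def)
  next
    fix f :: "nat \<Rightarrow> 'a \<times> 'a" assume f: "f \<in> PiE {..<k} (\<lambda>_. A \<times> A)"
    define g where "g = restrict (\<lambda>(e, b). if b then snd (f e) else fst (f e)) (half_edges k)"
    show "restrict (\<lambda>(e, b). if b then snd (f e) else fst (f e)) (half_edges k) \<in> PiE (half_edges k) (\<lambda>_. A)"
    proof -
      have "fst (f e) \<in> A" "snd (f e) \<in> A" if "e < k" for e
        using PiE_mem[OF f, of e] that by (simp_all add: mem_Times_iff)
      then show ?thesis unfolding restrict_PiE_iff by (auto simp: half_edges_def)
    qed
    show "restrict (\<lambda>e. (restrict (\<lambda>(e, b). if b then snd (f e) else fst (f e)) (half_edges k) (e, False),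
       restrict (\<lambda>(e, b). if b then snd (f e) else fst (f e)) (half_edges k) (e, True))) {..<k} = f"
      using f by (auto simp: fun_eq_iff half_edges_def PiE_iff extensional_def restrict_def)
    show "(\<Prod>e<k. q (restrict (\<lambda>(e, b). if b then snd (f e) else fst (f e)) (half_edges k) (e, False))
           (restrict (\<lambda>(e, b). if b then snd (f e) else fst (f e)) (half_edges k) (e, True)))
       = (\<Prod>e<k. q (fst (f e)) (snd (f e)))"
      by (intro prod.cong refl) (simp add: half_edges_def)
  qed
  finally show ?thesis .
qed

locale mean_zero_kernels =
  fixes A :: "'a set" and B :: "'b set" and s :: "'a \<Rightarrow> 'a \<Rightarrow> real" and h :: "'b \<Rightarrow> 'b \<Rightarrow> real"
  assumes finite_A: "finite A" and finite_B: "finite B" and A_ne: "A \<noteq> {}" and B_ne: "B \<noteq> {}"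
    and s_anti: "s x y = - s y x" and s_le: "\<bar>s x y\<bar> \<le> 1"
    and h_anti: "h a b = - h b a" and h_le: "a \<in> B \<Longrightarrow> b \<in> B \<Longrightarrow> \<bar>h a b\<bar> \<le> 1"
    and h_zero: "a \<in> B \<Longrightarrow> (\<Sum>b\<in>B. h a b) = 0"
begin

definition mean :: "(('a \<Rightarrow> 'b) \<Rightarrow> real) \<Rightarrow> real" where
  "mean F = (\<Sum>g\<in>PiE A (\<lambda>_. B). F g) / card B ^ card A"

definition labelling_mean :: "nat \<Rightarrow> 'a labelling \<Rightarrow> real" where
  "labelling_mean k v = mean (\<lambda>g. \<Prod>e<k. s (v (e, False)) (v (e, True)) * h (g (v (e, False))) (g (v (e, True))))"

lemma mean_le:
  assumes "\<And>g. g \<in> PiE A (\<lambda>_. B) \<Longrightarrow> \<bar>F g\<bar> \<le> 1"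
  shows "\<bar>mean F\<bar> \<le> 1"
proof -
  have "\<bar>\<Sum>g\<in>PiE A (\<lambda>_. B). F g\<bar> \<le> (\<Sum>g\<in>PiE A (\<lambda>_. B). 1)"
    using assms by (intro order.trans[OF sum_abs] sum_mono) auto
  also have "\<dots> = card B ^ card A" using finite_A by (simp add: card_PiE)
  finally have "\<bar>\<Sum>g\<in>PiE A (\<lambda>_. B). F g\<bar> \<le> card B ^ card A" .
  moreover have "card B > 0" using finite_B B_ne by (simp add: card_gt_0_iff)
  ultimately show ?thesis by (simp add: mean_def divide_le_eq abs_divide)
qed

lemma mean_power:
  "mean (\<lambda>g. (\<Sum>i\<in>A. \<Sum>j\<in>A. s i j * h (g i) (g j)) ^ k) = (\<Sum>v\<in>PiE (half_edges k) (\<lambda>_. A). labelling_mean k v)"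
  unfolding mean_def labelling_mean_def double_sum_power[OF finite_A] sum_divide_distrib
  by (rule sum.swap)

lemma labelling_mean_le:
  assumes "v \<in> PiE (half_edges k) (\<lambda>_. A)"
  shows "\<bar>labelling_mean k v\<bar> \<le> 1"
  unfolding labelling_mean_def
proof (rule mean_le)
  fix g assume g: "g \<in> PiE A (\<lambda>_. B)"
  have "\<bar>s (v (e, False)) (v (e, True)) * h (g (v (e, False))) (g (v (e, True)))\<bar> \<le> 1" if "e < k" for e
  proof -
    have "v (e, b) \<in> A" for b using assms that by (auto simp: half_edges_def PiE_iff)
    then have "g (v (e, b)) \<in> B" for b using g by (auto simp: PiE_iff)
    then show ?thesis unfolding abs_mult by (intro mult_le_one s_le h_le) auto
  qed
  then show "\<bar>\<Prod>e<k. s (v (e, False)) (v (e, True)) * h (g (v (e, False))) (g (v (e, True)))\<bar> \<le> 1"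
    unfolding abs_prod by (intro prod_le_1) auto
qed

text \<open>Reversing an edge changes the sign of both antisymmetric factors, so their product stays
  the same; this is the invariance that \<open>sum_two_regular\<close> requires.\<close>

lemma labelling_mean_edge_flip: "labelling_mean k (edge_flip T v) = labelling_mean k v"
proof -
  have "s (edge_flip T v (e, False)) (edge_flip T v (e, True)) * h (g (edge_flip T v (e, False))) (g (edge_flip T v (e, True)))
     = s (v (e, False)) (v (e, True)) * h (g (v (e, False))) (g (v (e, True)))" for e and g :: "'a \<Rightarrow> 'b"
    using s_anti[of "v (e, True)" "v (e, False)"] h_anti[of "g (v (e, True))" "g (v (e, False))"]
    by (cases "e \<in> T") (simp_all add: edge_flip_def)
  then show ?thesis unfolding labelling_mean_def by simp
qed

text \<open>At a vertex \<open>i\<close> of degree one the value \<open>g i\<close> occurs only in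
  the factor of a single edge, and summing over it produces a row sum of \<open>h\<close>.\<close>

lemma labelling_mean_eq_0:
  assumes v: "v \<in> PiE (half_edges k) (\<lambda>_. A)" and x: "x \<in> half_edges k"
    and single: "{y \<in> half_edges k. v y = v x} = {x}"
  shows "labelling_mean k v = 0"
proof -
  define i where "i = v x"
  define e0 where "e0 = fst x"
  define F where "F g e = s (v (e, False)) (v (e, True)) * h (g (v (e, False))) (g (v (e, True)))" for e g
  have i: "i \<in> A" and e0: "e0 < k" using v x by (auto simp: i_def e0_def half_edges_def PiE_iff)
  have ne: "v y \<noteq> i" if "y \<in> half_edges k" "y \<noteq> x" for y using single that unfolding i_def by blast
  have "(\<Sum>g\<in>PiE A (\<lambda>_. B). \<Prod>e<k. F g e) = 0"
  proof (rule sum_PiE_zero[OF i])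
    fix g assume g: "g \<in> PiE (A - {i}) (\<lambda>_. B)"
    have "(\<Prod>e<k. F (g(i := y)) e) = F (g(i := y)) e0 * (\<Prod>e\<in>{..<k} - {e0}. F g e)" for y
    proof -
      have "(\<Prod>e<k. F (g(i := y)) e) = F (g(i := y)) e0 * (\<Prod>e\<in>{..<k} - {e0}. F (g(i := y)) e)"
        using e0 by (intro prod.remove) auto
      also have "(\<Prod>e\<in>{..<k} - {e0}. F (g(i := y)) e) = (\<Prod>e\<in>{..<k} - {e0}. F g e)"
      proof (intro prod.cong refl)
        fix e assume e: "e \<in> {..<k} - {e0}"
        have "v (e, b) \<noteq> i" for b
          by (rule ne) (use e in \<open>auto simp: half_edges_def e0_def\<close>)
        then show "F (g(i := y)) e = F g e" by (simp add: F_def)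
      qed
      finally show ?thesis .
    qed
    moreover have "(\<Sum>y\<in>B. F (g(i := y)) e0) = 0"
    proof -
      define a where "a = v (e0, \<not> snd x)"
      have mem: "(e0, \<not> snd x) \<in> half_edges k" using e0 by (simp add: half_edges_def)
      \<comment> \<open>A loop at \<open>i\<close> would occupy two half-edges; hence the other end
        of the edge keeps its value while \<open>g i\<close> varies.\<close>
      have ai: "a \<noteq> i" unfolding a_def by (rule ne[OF mem]) (cases x, auto)
      have "a \<in> A" using v mem by (auto simp: a_def)
      then have ga: "g a \<in> B" using g ai by auto
      have vx: "v (e0, snd x) = i" by (simp add: i_def e0_def)
      show ?thesis
      proof (cases "snd x")
        case True
        then have "F (g(i := y)) e0 = s a i * h (g a) y" for y
          using ai vx by (simp add: F_def a_def)
        then show ?thesis using h_zero[OF ga] by (simp add: sum_distrib_left[symmetric])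
      next
        case False
        then have "F (g(i := y)) e0 = - s i a * h (g a) y" for y
          using ai vx h_anti[of y] by (simp add: F_def a_def)
        then show ?thesis using h_zero[OF ga] by (simp add: sum_negf sum_distrib_left[symmetric])
      qed
    qed
    ultimately show "(\<Sum>y\<in>B. \<Prod>e<k. F (g(i := y)) e) = 0"
      by (simp add: sum_distrib_right[symmetric])
  qed
  then show ?thesis by (simp add: labelling_mean_def mean_def F_def)
qed

text \<open>The factors \<open>s\<close> do not see \<open>g\<close> and come out of the mean. Since
  \<open>p\<close> is injective, the values at the \<open>k\<close> vertices are independent, and
  what is left factors along cycles with one \<open>1 / card B\<close> per edge.\<close>

lemma labelling_mean_perm_labelling:
  assumes \<sigma>: "\<sigma> permutes {..<k}" and p: "p \<in> PiE {..<k} (\<lambda>_. A)" "inj_on p {..<k}"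
  shows "labelling_mean k (perm_labelling k \<sigma> p) = (\<Prod>e<k. s (p e) (p (\<sigma> e)))
    * (\<Prod>\<gamma>\<in>cycles_on {..<k} \<sigma>. kernel_trace (\<lambda>a b. h a b / card B) B (card \<gamma>))"
proof -
  have sig: "\<sigma> e < k" if "e < k" for e using permutes_in_image[OF \<sigma>, of e] that by simp
  have pA: "p ` {..<k} \<subseteq> A" using p by auto
  have kA: "k \<le> card A" using card_inj_on_le[OF p(2) pA finite_A] by simp
  have B0: "card B > 0" using finite_B B_ne by (simp add: card_gt_0_iff)
  have "labelling_mean k (perm_labelling k \<sigma> p)
    = (\<Prod>e<k. s (p e) (p (\<sigma> e))) * mean (\<lambda>g. \<Prod>e<k. h (g (p e)) (g (p (\<sigma> e))))"
    unfolding labelling_mean_def mean_def perm_labelling_def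
    by (simp add: half_edges_def prod.distrib sum_distrib_left[symmetric])
  also have "mean (\<lambda>g. \<Prod>e<k. h (g (p e)) (g (p (\<sigma> e))))
     = (\<Sum>g\<in>PiE A (\<lambda>_. B). \<Prod>e<k. h (restrict (g \<circ> p) {..<k} e) (restrict (g \<circ> p) {..<k} (\<sigma> e))) / card B ^ card A"
    unfolding mean_def using sig by (intro arg_cong2[where f = "(/)"] sum.cong prod.cong) auto
  also have "\<dots> = card B ^ (card A - k) * (\<Sum>x\<in>PiE {..<k} (\<lambda>_. B). \<Prod>e<k. h (x e) (x (\<sigma> e))) / card B ^ card A"
    using sum_PiE_comp_inj[OF finite_A p(2) pA, of "\<lambda>x. \<Prod>e<k. h (x e) (x (\<sigma> e))" B] by simp
  also have "\<dots> = (\<Sum>x\<in>PiE {..<k} (\<lambda>_. B). \<Prod>e<k. h (x e) (x (\<sigma> e))) / card B ^ k"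
    using B0 kA by (simp add: field_simps power_add[symmetric])
  also have "\<dots> = (\<Sum>x\<in>PiE {..<k} (\<lambda>_. B). \<Prod>e<k. h (x e) (x (\<sigma> e)) / card B)"
    by (simp add: sum_divide_distrib prod_dividef)
  also have "\<dots> = (\<Prod>\<gamma>\<in>cycles_on {..<k} \<sigma>. kernel_trace (\<lambda>a b. h a b / card B) B (card \<gamma>))"
    by (rule sum_permutation_kernel[OF finite_B _ \<sigma>]) simp
  finally show ?thesis .
qed

text \<open>Read backwards, \<open>sum_permutation_kernel\<close> exhibits the product as an average
  of products of entries of \<open>h\<close>; hence a bound independent of the size of
  \<open>B\<close>.\<close>

lemma abs_cycles_h_le:
  fixes k :: nat
  assumes \<sigma>: "\<sigma> permutes {..<k}"
  shows "\<bar>\<Prod>\<gamma>\<in>cycles_on {..<k} \<sigma>. kernel_trace (\<lambda>a b. h a b / card B) B (card \<gamma>)\<bar> \<le> 1"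
proof -
  have sig: "\<sigma> e < k" if "e < k" for e using permutes_in_image[OF \<sigma>, of e] that by simp
  have B0: "card B > 0" using finite_B B_ne by (simp add: card_gt_0_iff)
  have "\<bar>\<Prod>\<gamma>\<in>cycles_on {..<k} \<sigma>. kernel_trace (\<lambda>a b. h a b / card B) B (card \<gamma>)\<bar>
    = \<bar>\<Sum>x\<in>PiE {..<k} (\<lambda>_. B). \<Prod>e<k. h (x e) (x (\<sigma> e)) / card B\<bar>"
    using sum_permutation_kernel[OF finite_B _ \<sigma>, of "\<lambda>a b. h a b / card B"] by (simp only: finite_lessThan)
  also have "\<dots> \<le> (\<Sum>x\<in>PiE {..<k} (\<lambda>_. B). \<Prod>e<k. \<bar>h (x e) (x (\<sigma> e))\<bar> / card B)"
    by (intro order.trans[OF sum_abs]) (simp add: abs_prod)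
  also have "\<dots> \<le> (\<Sum>x\<in>PiE {..<k} (\<lambda>_. B). \<Prod>e<k. 1 / card B)"
    using sig B0 by (intro sum_mono prod_mono) (auto intro!: divide_right_mono h_le simp: PiE_iff)
  also have "\<dots> = 1" using B0 by (simp add: card_PiE power_divide)
  finally show ?thesis .
qed

text \<open>The first constant counts labellings with all degrees at least two that are not
  two-regular; the second is the price of dropping injectivity of \<open>p\<close>. Neither depends
  on \<open>B\<close>, so \<open>card B\<close> may tend to infinity first.\<close>

lemma mean_power_approx:
  fixes r :: real
  assumes k: "k \<ge> 1" and r: "r > 0"
  shows "\<bar>mean (\<lambda>g. (\<Sum>i\<in>A. \<Sum>j\<in>A. s i j * h (g i) (g j)) ^ k) / r ^ k
     - 2 ^ k * (\<Sum>\<sigma> | \<sigma> permutes {..<k}. \<Prod>\<gamma>\<in>cycles_on {..<k} \<sigma>.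
         kernel_trace (\<lambda>a b. s a b / r) A (card \<gamma>) * kernel_trace (\<lambda>a b. h a b / card B) B (card \<gamma>) / 2)\<bar>
    \<le> (real ((k - 1) ^ (2 * k)) + 2 ^ k * fact k * k\<^sup>2) * card A ^ (k - 1) / r ^ k"
proof -
  define V where "V = PiE (half_edges k) (\<lambda>_. A)"
  have finV: "finite V" unfolding V_def using finite_A by (auto intro!: finite_PiE)
  \<comment> \<open>Two-regular labellings, labellings with a vertex of degree one, and the
    rest.\<close>
  define TR where "TR = {v \<in> V. two_regular k v}"
  define SG where "SG = {v \<in> V. \<exists>x\<in>half_edges k. {y \<in> half_edges k. v y = v x} = {x}}"
  define BD where "BD = V - TR - SG"
  have TRSG: "TR \<inter> SG = {}"
    by (fastforce simp: TR_def SG_def two_regular_def)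
  have V_eq: "V = TR \<union> SG \<union> BD" by (auto simp: BD_def TR_def SG_def)
  have card_BD: "card BD \<le> card A ^ (k - 1) * (k - 1) ^ (2 * k)"
  proof -
    have "BD \<subseteq> {v \<in> PiE (half_edges k) (\<lambda>_. A). card (v ` half_edges k) \<le> k - 1}"
    proof
      fix v assume v: "v \<in> BD"
      define c where "c a = card {y \<in> half_edges k. v y = a}" for a
      have c0: "c (v x) \<ge> 2" if x: "x \<in> half_edges k" for x
      proof (rule ccontr)
        assume "\<not> c (v x) \<ge> 2"
        moreover have fin: "finite {y \<in> half_edges k. v y = v x}" by simp
        then have "c (v x) \<noteq> 0" unfolding c_def using x by (simp only: card_0_eq) blast
        ultimately have "card {y \<in> half_edges k. v y = v x} = 1" unfolding c_def by linarith
        then obtain z where "{y \<in> half_edges k. v y = v x} = {z}" by (rule card_1_singletonE)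
        moreover from this have "x = z" using x by blast
        ultimately have "{y \<in> half_edges k. v y = v x} = {x}" by simp
        then show False using v x by (auto simp: BD_def SG_def)
      qed
      obtain x0 where x0: "x0 \<in> half_edges k" "c (v x0) \<noteq> 2"
        using v by (auto simp: BD_def TR_def two_regular_def c_def)
      \<comment> \<open>All degrees are at least \<open>2\<close>, one is larger, and they add up to
        the \<open>2 * k\<close> half-edges; so fewer than \<open>k\<close> vertices occur.\<close>
      have "(\<Sum>a\<in>v ` half_edges k. 2) < (\<Sum>a\<in>v ` half_edges k. c a)"
      proof (rule sum_strict_mono_ex1)
        show "\<exists>a\<in>v ` half_edges k. 2 < c a"
          using x0 c0[OF x0(1)] by (intro bexI[of _ "v x0"]) auto
      qed (use c0 in auto)
      also have "\<dots> = 2 * k"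
        using sum_fun_comp[of "half_edges k" "v ` half_edges k" v "\<lambda>_. 1::nat"] by (simp add: c_def card_half_edges)
      finally have "card (v ` half_edges k) \<le> k - 1" by simp
      then show "v \<in> {v \<in> PiE (half_edges k) (\<lambda>_. A). card (v ` half_edges k) \<le> k - 1}"
        using v by (auto simp: BD_def V_def)
    qed
    then have "card BD \<le> card {v \<in> PiE (half_edges k) (\<lambda>_. A). card (v ` half_edges k) \<le> k - 1}"
      using finV by (intro card_mono) (auto simp: V_def)
    also have "\<dots> \<le> card A ^ (k - 1) * (k - 1) ^ card (half_edges k)"
      using finite_A A_ne by (intro card_small_image_PiE_le) auto
    finally show ?thesis by (simp add: card_half_edges)
  qed
  define W where "W \<sigma> = (\<Prod>\<gamma>\<in>cycles_on {..<k} \<sigma>. kernel_trace (\<lambda>a b. h a b / card B) B (card \<gamma>))" for \<sigma>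
  define I where "I = {p. p \<in> PiE {..<k} (\<lambda>_. A) \<and> inj_on p {..<k}}"
  \<comment> \<open>\<open>S1\<close> runs over distinct vertices, as the combinatorics delivers it;
    only the unrestricted \<open>S2\<close> factors into traces.\<close>
  define S1 where "S1 \<sigma> = (\<Sum>p\<in>I. \<Prod>e<k. s (p e) (p (\<sigma> e)))" for \<sigma>
  define S2 where "S2 \<sigma> = (\<Sum>p\<in>PiE {..<k} (\<lambda>_. A). \<Prod>e<k. s (p e) (p (\<sigma> e)))" for \<sigma>
  define c2 :: "(nat \<Rightarrow> nat) \<Rightarrow> real" where "c2 \<sigma> = 2 ^ card (cycles_on {..<k} \<sigma>)" for \<sigma>
  have c2: "c2 \<sigma> \<ge> 1" for \<sigma> by (simp add: c2_def)
  have TR_sum: "(\<Sum>v\<in>TR. labelling_mean k v) = 2 ^ k * (\<Sum>\<sigma> | \<sigma> permutes {..<k}. S1 \<sigma> * W \<sigma> / c2 \<sigma>)"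
    unfolding TR_def V_def
    by (subst sum_two_regular[OF finite_A labelling_mean_edge_flip])
       (auto simp: labelling_mean_perm_labelling S1_def W_def c2_def I_def sum_distrib_right intro!: sum.cong)
  have "(\<Sum>v\<in>V. labelling_mean k v) = (\<Sum>v\<in>TR. labelling_mean k v) + (\<Sum>v\<in>SG. labelling_mean k v) + (\<Sum>v\<in>BD. labelling_mean k v)"
  proof -
    have "finite TR" "finite SG" "finite BD" using finV by (auto simp: TR_def SG_def BD_def)
    then show ?thesis unfolding V_eq using TRSG
      by (subst sum.union_disjoint; (subst sum.union_disjoint)?) (auto simp: BD_def)
  qed
  also have "(\<Sum>v\<in>SG. labelling_mean k v) = 0"
    using labelling_mean_eq_0 by (intro sum.neutral) (auto simp: SG_def V_def)
  finally have split: "(\<Sum>v\<in>V. labelling_mean k v) = (\<Sum>v\<in>TR. labelling_mean k v) + (\<Sum>v\<in>BD. labelling_mean k v)" by simp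
  have BD_le: "\<bar>\<Sum>v\<in>BD. labelling_mean k v\<bar> \<le> real ((k - 1) ^ (2 * k)) * card A ^ (k - 1)"
  proof -
    have "\<bar>\<Sum>v\<in>BD. labelling_mean k v\<bar> \<le> (\<Sum>v\<in>BD. 1)"
      using labelling_mean_le by (intro order.trans[OF sum_abs] sum_mono) (auto simp: BD_def V_def)
    also have "\<dots> \<le> real (card A ^ (k - 1) * (k - 1) ^ (2 * k))" using of_nat_mono[OF card_BD, where 'a = real] by simp
    finally show ?thesis by (simp add: mult.commute)
  qed
  have S_diff: "\<bar>S1 \<sigma> - S2 \<sigma>\<bar> \<le> k\<^sup>2 * card A ^ (k - 1)" for \<sigma>
  proof -
    define J where "J = {p \<in> PiE {..<k} (\<lambda>_. A). \<not> inj_on p {..<k}}"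
    have fin: "finite (PiE {..<k} (\<lambda>_. A))" using finite_A by (auto intro!: finite_PiE)
    have IJ: "I \<inter> J = {}" "I \<union> J = PiE {..<k} (\<lambda>_. A)" by (auto simp: I_def J_def)
    have fIJ: "finite I" "finite J" using fin by (simp_all add: IJ(2)[symmetric])
    have "S2 \<sigma> - S1 \<sigma> = (\<Sum>p\<in>J. \<Prod>e<k. s (p e) (p (\<sigma> e)))"
      unfolding S1_def S2_def IJ(2)[symmetric] using fIJ IJ(1) by (simp add: sum.union_disjoint)
    moreover have "\<bar>\<Sum>p\<in>J. \<Prod>e<k. s (p e) (p (\<sigma> e))\<bar> \<le> (\<Sum>p\<in>J. 1)"
      by (intro order.trans[OF sum_abs] sum_mono) (auto simp: abs_prod intro!: prod_le_1 s_le)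
    moreover have "real (card J) \<le> real (k\<^sup>2 * card A ^ (k - 1))"
      using card_not_inj_PiE_le[of "{..<k}" A] finite_A by (intro of_nat_mono) (simp add: J_def)
    ultimately show ?thesis by (simp add: abs_minus_commute)
  qed
  have S2_eq: "S2 \<sigma> / r ^ k = (\<Prod>\<gamma>\<in>cycles_on {..<k} \<sigma>. kernel_trace (\<lambda>a b. s a b / r) A (card \<gamma>))"
    if "\<sigma> permutes {..<k}" for \<sigma>
    using sum_permutation_kernel[OF finite_A _ that, of "\<lambda>a b. s a b / r"]
    by (simp add: S2_def sum_divide_distrib prod_dividef)
  have main: "(\<Sum>\<sigma> | \<sigma> permutes {..<k}. S2 \<sigma> * W \<sigma> / c2 \<sigma>) / r ^ k
    = (\<Sum>\<sigma> | \<sigma> permutes {..<k}. \<Prod>\<gamma>\<in>cycles_on {..<k} \<sigma>.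
         kernel_trace (\<lambda>a b. s a b / r) A (card \<gamma>) * kernel_trace (\<lambda>a b. h a b / card B) B (card \<gamma>) / 2)"
    unfolding sum_divide_distrib
  proof (intro sum.cong refl)
    fix \<sigma> assume "\<sigma> \<in> {\<sigma>. \<sigma> permutes {..<k}}"
    then have \<sigma>: "\<sigma> permutes {..<k}" by simp
    have "S2 \<sigma> * W \<sigma> / c2 \<sigma> / r ^ k = (S2 \<sigma> / r ^ k) * W \<sigma> / c2 \<sigma>" by simp
    then show "S2 \<sigma> * W \<sigma> / c2 \<sigma> / r ^ k = (\<Prod>\<gamma>\<in>cycles_on {..<k} \<sigma>.
         kernel_trace (\<lambda>a b. s a b / r) A (card \<gamma>) * kernel_trace (\<lambda>a b. h a b / card B) B (card \<gamma>) / 2)"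
      unfolding S2_eq[OF \<sigma>] W_def c2_def by (simp add: prod_dividef prod.distrib)
  qed
  have diff: "\<bar>(\<Sum>\<sigma> | \<sigma> permutes {..<k}. S1 \<sigma> * W \<sigma> / c2 \<sigma>) - (\<Sum>\<sigma> | \<sigma> permutes {..<k}. S2 \<sigma> * W \<sigma> / c2 \<sigma>)\<bar>
     \<le> fact k * (k\<^sup>2 * card A ^ (k - 1))"
  proof -
    have "\<bar>(\<Sum>\<sigma> | \<sigma> permutes {..<k}. S1 \<sigma> * W \<sigma> / c2 \<sigma>) - (\<Sum>\<sigma> | \<sigma> permutes {..<k}. S2 \<sigma> * W \<sigma> / c2 \<sigma>)\<bar>
      = \<bar>\<Sum>\<sigma> | \<sigma> permutes {..<k}. (S1 \<sigma> - S2 \<sigma>) * (W \<sigma> / c2 \<sigma>)\<bar>"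
      by (simp add: sum_subtractf algebra_simps diff_divide_distrib)
    also have "\<dots> \<le> (\<Sum>\<sigma> | \<sigma> permutes {..<k}. real (k\<^sup>2 * card A ^ (k - 1)))"
    proof (intro order.trans[OF sum_abs] sum_mono)
      fix \<sigma> assume "\<sigma> \<in> {\<sigma>. \<sigma> permutes {..<k}}"
      then have "\<bar>W \<sigma>\<bar> \<le> 1" unfolding W_def by (intro abs_cycles_h_le) simp
      then have "\<bar>W \<sigma>\<bar> \<le> c2 \<sigma>" using c2[of \<sigma>] by linarith
      then have "\<bar>W \<sigma> / c2 \<sigma>\<bar> \<le> 1" using c2[of \<sigma>] by (simp add: abs_divide)
      then have "\<bar>S1 \<sigma> - S2 \<sigma>\<bar> * \<bar>W \<sigma> / c2 \<sigma>\<bar> \<le> real (k\<^sup>2 * card A ^ (k - 1)) * 1"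
        by (intro mult_mono S_diff) auto
      then show "\<bar>(S1 \<sigma> - S2 \<sigma>) * (W \<sigma> / c2 \<sigma>)\<bar> \<le> k\<^sup>2 * card A ^ (k - 1)"
        unfolding abs_mult by simp
    qed
    also have "\<dots> = fact k * (k\<^sup>2 * card A ^ (k - 1))"
      by (simp add: card_permutations[of "{..<k}" k])
    finally show ?thesis .
  qed
  define X where "X = (\<Sum>\<sigma> | \<sigma> permutes {..<k}. S1 \<sigma> * W \<sigma> / c2 \<sigma>)"
  define Y where "Y = (\<Sum>\<sigma> | \<sigma> permutes {..<k}. S2 \<sigma> * W \<sigma> / c2 \<sigma>)"
  have "(\<Sum>v\<in>V. labelling_mean k v) - 2 ^ k * Y = 2 ^ k * (X - Y) + (\<Sum>v\<in>BD. labelling_mean k v)"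
    unfolding split TR_sum X_def by (simp add: algebra_simps)
  then have "\<bar>(\<Sum>v\<in>V. labelling_mean k v) - 2 ^ k * Y\<bar> \<le> 2 ^ k * \<bar>X - Y\<bar> + \<bar>\<Sum>v\<in>BD. labelling_mean k v\<bar>"
    using abs_triangle_ineq[of "2 ^ k * (X - Y)"] by (simp add: abs_mult)
  also have "\<dots> \<le> 2 ^ k * (fact k * (k\<^sup>2 * card A ^ (k - 1))) + real ((k - 1) ^ (2 * k)) * card A ^ (k - 1)"
    using diff BD_le unfolding X_def Y_def by (intro add_mono mult_left_mono) auto
  finally have "\<bar>(\<Sum>v\<in>V. labelling_mean k v) - 2 ^ k * Y\<bar> / r ^ k
     \<le> (2 ^ k * (fact k * (k\<^sup>2 * card A ^ (k - 1))) + real ((k - 1) ^ (2 * k)) * card A ^ (k - 1)) / r ^ k"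
    using r by (intro divide_right_mono) auto
  moreover have "\<bar>(\<Sum>v\<in>V. labelling_mean k v) - 2 ^ k * Y\<bar> / r ^ k = \<bar>(\<Sum>v\<in>V. labelling_mean k v) / r ^ k - 2 ^ k * (Y / r ^ k)\<bar>"
    using r by (simp add: abs_divide diff_divide_distrib[symmetric])
  ultimately show ?thesis
    unfolding mean_power main[symmetric] Y_def[symmetric] V_def[symmetric] by (simp add: algebra_simps)
qed

end

section \<open>Powers of circulant kernels\<close>

definition periodic :: "nat \<Rightarrow> (int \<Rightarrow> real) \<Rightarrow> bool" where
  "periodic N f \<longleftrightarrow> (\<forall>x. f (x mod int N) = f x)"

lemma periodic_add: "periodic N f \<Longrightarrow> f (x + int N) = f x"
  unfolding periodic_def by (metis mod_add_self2)

lemma periodic_cong: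
  "periodic N f \<Longrightarrow> x mod int N = y mod int N \<Longrightarrow> f x = f y"
  unfolding periodic_def by metis

lemma sum_periodic_shift:
  assumes "periodic N f" "N > 0"
  shows "(\<Sum>e\<in>{0..<int N}. f (e + t)) = (\<Sum>e\<in>{0..<int N}. f e)"
proof (rule sum.reindex_bij_witness[where i = "\<lambda>e. (e - t) mod int N" and j = "\<lambda>e. (e + t) mod int N"])
  fix e assume e: "e \<in> {0..<int N}"
  show "((e + t) mod int N - t) mod int N = e" "((e - t) mod int N + t) mod int N = e"
    using e by (simp_all add: mod_simps)
  show "f ((e + t) mod int N) = f (e + t)" using assms by (simp add: periodic_def)
qed (use assms in auto)

lemma sum_periodic_reflect:
  assumes "periodic N f" "N > 0"
  shows "(\<Sum>e\<in>{0..<int N}. f (t - e)) = (\<Sum>e\<in>{0..<int N}. f e)"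
proof (rule sum.reindex_bij_witness[where i = "\<lambda>e. (t - e) mod int N" and j = "\<lambda>e. (t - e) mod int N"])
  fix e assume e: "e \<in> {0..<int N}"
  show "(t - (t - e) mod int N) mod int N = e" "(t - (t - e) mod int N) mod int N = e"
    using e by (simp_all add: mod_simps)
  show "f ((t - e) mod int N) = f (t - e)" using assms by (simp add: periodic_def)
qed (use assms in auto)

text \<open>Convolution with a point mass at \<open>c\<close> is a shift by \<open>c\<close>; the
  difference equations of the convolution powers rest on this.\<close>

lemma sum_periodic_delta:
  assumes "periodic N f" "N > 0"
  shows "(\<Sum>e\<in>{0..<int N}. f e * of_bool ((d - e) mod int N = c mod int N)) = f (d - c)"
proof -
  have "(\<Sum>e\<in>{0..<int N}. f e * of_bool ((d - e) mod int N = c mod int N))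
    = (\<Sum>e\<in>{0..<int N}. if e = (d - c) mod int N then f e else 0)"
  proof (rule sum.cong[OF refl])
    fix e assume e: "e \<in> {0..<int N}"
    have "(d - e) mod int N = c mod int N \<longleftrightarrow> e mod int N = (d - c) mod int N"
      by (simp add: mod_eq_dvd_iff) (metis diff_diff_eq diff_diff_eq2 add.commute dvd_minus_iff minus_diff_eq)
    then show "f e * of_bool ((d - e) mod int N = c mod int N) = (if e = (d - c) mod int N then f e else 0)"
      using e by simp
  qed
  also have "\<dots> = f ((d - c) mod int N)" using assms by simp
  finally show ?thesis using assms by (simp add: periodic_def)
qed

text \<open>Note the shift: \<open>circ_power \<kappa> N m\<close> is the normalised \<open>(m + 1)\<close>-fold convolution of \<open>\<kappa>\<close>.\<close>

fun circ_power :: "(int \<Rightarrow> real) \<Rightarrow> nat \<Rightarrow> nat \<Rightarrow> int \<Rightarrow> real" where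
  "circ_power \<kappa> N 0 d = \<kappa> d"
| "circ_power \<kappa> N (Suc m) d = (\<Sum>e\<in>{0..<int N}. circ_power \<kappa> N m e * \<kappa> (d - e)) / N"

lemma periodic_circ_power:
  assumes "periodic N \<kappa>"
  shows "periodic N (circ_power \<kappa> N m)"
proof (cases m)
  case (Suc m')
  have "\<kappa> (x mod int N - e) = \<kappa> (x - e)" for x e
    by (rule periodic_cong[OF assms]) (simp add: mod_simps)
  then show ?thesis by (simp add: periodic_def Suc)
qed (use assms in \<open>simp add: periodic_def\<close>)

lemma periodic_mult: "periodic N f \<Longrightarrow> periodic N g \<Longrightarrow> periodic N (\<lambda>x. f x * g x)"
  by (simp add: periodic_def)

lemma periodic_reflect: "periodic N f \<Longrightarrow> periodic N (\<lambda>x. f (t - x))"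
  unfolding periodic_def by (metis mod_diff_right_eq)

lemma kernel_power_circulant:
  assumes per: "periodic N \<kappa>" and N: "N > 0" and "a < N" "b < N"
  shows "kernel_power (\<lambda>a b. \<kappa> (int b - int a) / N) {..<N} (Suc m) a b = circ_power \<kappa> N m (int b - int a) / N"
  using assms(3,4)
proof (induction m arbitrary: b)
  case 0
  have "kernel_power (\<lambda>a b. \<kappa> (int b - int a) / N) {..<N} (Suc 0) a b
    = (\<Sum>c<N. if c = a then \<kappa> (int b - int a) / N else 0)"
    unfolding kernel_power.simps by (intro sum.cong) auto
  also have "\<dots> = \<kappa> (int b - int a) / N" using 0 by simp
  finally show ?case by simp
next
  case (Suc m)
  define f where "f e = circ_power \<kappa> N m e * \<kappa> (int b - int a - e)" for e
  have perf: "periodic N f" unfolding f_def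
    by (intro periodic_mult periodic_circ_power periodic_reflect per)
  have "kernel_power (\<lambda>a b. \<kappa> (int b - int a) / N) {..<N} (Suc (Suc m)) a b
    = (\<Sum>c<N. circ_power \<kappa> N m (int c - int a) / N * (\<kappa> (int b - int c) / N))"
    using Suc by (subst kernel_power.simps(2)) (intro sum.cong refl, simp)
  also have "\<dots> = (\<Sum>c<N. f (int c - int a)) / N / N"
    unfolding sum_divide_distrib by (intro sum.cong refl) (simp add: f_def)
  also have "(\<Sum>c<N. f (int c - int a)) = (\<Sum>e\<in>{0..<int N}. f (e + (- int a)))"
    by (rule sum.reindex_bij_witness[where i = nat and j = int]) auto
  also have "\<dots> = (\<Sum>e\<in>{0..<int N}. f e)" by (rule sum_periodic_shift[OF perf N])
  finally show ?case by (simp add: f_def)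
qed

lemma kernel_trace_circulant:
  assumes "periodic N \<kappa>" "N > 0"
  shows "kernel_trace (\<lambda>a b. \<kappa> (int b - int a) / N) {..<N} (Suc m) = circ_power \<kappa> N m 0"
  unfolding kernel_trace_def using assms by (simp add: kernel_power_circulant del: kernel_power.simps)

text \<open>Each further convolution with an odd function changes the parity. At \<open>0\<close>
  this makes the traces of odd powers vanish.\<close>

lemma circ_power_odd:
  assumes per: "periodic N \<kappa>" and N: "N > 0" and odd: "\<And>x. \<kappa> (- x) = - \<kappa> x"
  shows "circ_power \<kappa> N m (- d) = (- 1) ^ Suc m * circ_power \<kappa> N m d"
proof (induction m arbitrary: d)
  case (Suc m)
  define f where "f e = circ_power \<kappa> N m e * \<kappa> (- d - e)" for e
  have perf: "periodic N f" unfolding f_def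
    by (intro periodic_mult periodic_circ_power periodic_reflect per)
  have "(\<Sum>e\<in>{0..<int N}. f e) = (\<Sum>e\<in>{0..<int N}. f (0 - e))"
    by (rule sum_periodic_reflect[OF perf N, symmetric])
  also have "\<dots> = (\<Sum>e\<in>{0..<int N}. (- 1) ^ Suc (Suc m) * (circ_power \<kappa> N m e * \<kappa> (d - e)))"
  proof (rule sum.cong[OF refl])
    fix e
    have "\<kappa> (- d - - e) = - \<kappa> (d - e)" using odd[of "d - e"] by (simp add: algebra_simps)
    then show "f (0 - e) = (- 1) ^ Suc (Suc m) * (circ_power \<kappa> N m e * \<kappa> (d - e))"
      by (simp add: f_def Suc.IH)
  qed
  finally show ?case by (simp add: f_def sum_distrib_left[symmetric] sum_negf)
qed (simp add: odd)

lemma abs_circ_power_le: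
  assumes "\<And>x. \<bar>\<kappa> x\<bar> \<le> 1" "N > 0"
  shows "\<bar>circ_power \<kappa> N m d\<bar> \<le> 1"
proof (induction m arbitrary: d)
  case (Suc m)
  have "\<bar>\<Sum>e\<in>{0..<int N}. circ_power \<kappa> N m e * \<kappa> (d - e)\<bar> \<le> (\<Sum>e\<in>{0..<int N}. 1)"
    using assms Suc.IH by (intro order.trans[OF sum_abs] sum_mono) (auto simp: abs_mult intro!: mult_le_one)
  then show ?case using assms by (simp add: abs_divide divide_le_eq)
qed (use assms in simp)

text \<open>The sum of a convolution is a multiple of the product of the sums. For sawtooth powers
  this supplies the additive constant that their difference equation leaves open.\<close>

lemma circ_power_sum_zero:
  assumes "periodic N \<kappa>" "N > 0" "(\<Sum>e\<in>{0..<int N}. \<kappa> e) = 0"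
  shows "(\<Sum>d\<in>{0..<int N}. circ_power \<kappa> N m d) = 0"
proof (cases m)
  case (Suc m')
  have "(\<Sum>d\<in>{0..<int N}. \<Sum>e\<in>{0..<int N}. circ_power \<kappa> N m' e * \<kappa> (d - e))
     = (\<Sum>e\<in>{0..<int N}. circ_power \<kappa> N m' e * (\<Sum>d\<in>{0..<int N}. \<kappa> (d + (- e))))"
    unfolding sum_distrib_left by (subst sum.swap) simp
  then show ?thesis
    using assms unfolding sum_periodic_shift[OF assms(1,2)] by (simp add: Suc sum_divide_distrib[symmetric])
qed (use assms in simp)

declare circ_power.simps(2) [simp del]

text \<open>The Appell sequence with generating function \<open>G(z) exp(rtz)\<close>.\<close>

definition appell :: "real fps \<Rightarrow> real \<Rightarrow> nat \<Rightarrow> real \<Rightarrow> real" where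
  "appell G r m t = fps_nth (G * fps_exp (r * t)) m"

section \<open>Appell polynomials and their increments on a grid\<close>

lemma appell_eq: "appell G r m t = (\<Sum>i=0..m. fps_nth G i * (r * t) ^ (m - i) / fact (m - i))"
  unfolding appell_def fps_mult_nth by simp

lemma appell_0: "appell G r m 0 = fps_nth G m"
  by (simp add: appell_def)

text \<open>Differentiation in \<open>t\<close> multiplies \<open>exp(rtz)\<close> by
  \<open>rz\<close>, which shifts the coefficient index by one.\<close>

lemma appell_deriv: "(appell G r (Suc m) has_real_derivative r * appell G r m t) (at t)"
proof -
  have "((\<lambda>t. fps_nth G i * (r * t) ^ (Suc m - i) / fact (Suc m - i)) has_real_derivative
      r * (fps_nth G i * (r * t) ^ (m - i) / fact (m - i))) (at t)" if "i \<le> m" for i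
  proof -
    define n c where "n = m - i" and "c = fps_nth G i"
    have "((\<lambda>t. (r * t) ^ Suc n) has_real_derivative (1 + real n) * (r * (r * t) ^ n)) (at t)"
      by (rule DERIV_power_Suc[OF DERIV_cmult_Id])
    then have "((\<lambda>t. c * (r * t) ^ Suc n / fact (Suc n)) has_real_derivative
        c * ((1 + real n) * (r * (r * t) ^ n)) / fact (Suc n)) (at t)"
      by (intro DERIV_cdivide DERIV_cmult)
    also have "c * ((1 + real n) * (r * (r * t) ^ n)) / fact (Suc n) = r * (c * (r * t) ^ n / fact n)"
      by (simp add: fact_Suc divide_simps)
    finally show ?thesis using that by (simp only: n_def c_def Suc_diff_le)
  qed
  then have "((\<lambda>t. \<Sum>i=0..m. fps_nth G i * (r * t) ^ (Suc m - i) / fact (Suc m - i)) has_real_derivative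
      (\<Sum>i=0..m. r * (fps_nth G i * (r * t) ^ (m - i) / fact (m - i)))) (at t)"
    by (intro DERIV_sum) auto
  then have "((\<lambda>t. (\<Sum>i=0..m. fps_nth G i * (r * t) ^ (Suc m - i) / fact (Suc m - i)) + fps_nth G (Suc m)) has_real_derivative
      (\<Sum>i=0..m. r * (fps_nth G i * (r * t) ^ (m - i) / fact (m - i))) + 0) (at t)"
    by (intro DERIV_add) auto
  moreover have "appell G r (Suc m) = (\<lambda>t. (\<Sum>i=0..m. fps_nth G i * (r * t) ^ (Suc m - i) / fact (Suc m - i)) + fps_nth G (Suc m))"
    by (simp add: appell_eq fun_eq_iff)
  ultimately show ?thesis by (simp add: appell_eq sum_distrib_left)
qed

lemma appell_bounded: "\<exists>C. \<forall>t\<in>{0..1}. \<bar>appell G r m t\<bar> \<le> C"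
proof -
  have "continuous_on {0..1} (appell G r m)"
    unfolding appell_eq[abs_def] by (intro continuous_intros) auto
  then have "bounded (appell G r m ` {0..1})"
    by (intro compact_imp_bounded compact_continuous_image) auto
  then show ?thesis by (auto simp: bounded_iff)
qed

lemma appell_lipschitz:
  "\<exists>L\<ge>0. \<forall>x\<in>{0..1}. \<forall>y\<in>{0..1}. \<bar>appell G r m y - appell G r m x\<bar> \<le> L * \<bar>y - x\<bar>"
proof (cases m)
  case 0
  then show ?thesis by (intro exI[of _ 0]) (simp add: appell_eq)
next
  case (Suc m')
  obtain C where C: "\<And>t. t \<in> {0..1} \<Longrightarrow> \<bar>appell G r m' t\<bar> \<le> C" using appell_bounded by metis
  have "\<bar>appell G r m y - appell G r m x\<bar> \<le> \<bar>r\<bar> * C * \<bar>y - x\<bar>" if "x \<in> {0..1}" "y \<in> {0..1}" for x y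
  proof -
    have "norm (appell G r m y - appell G r m x) \<le> (\<bar>r\<bar> * C) * norm (y - x)"
    proof (rule field_differentiable_bound[where S = "{0..1}" and f' = "\<lambda>t. r * appell G r m' t"])
      show "(appell G r m has_field_derivative r * appell G r m' z) (at z within {0..1})" for z
        unfolding Suc by (rule has_field_derivative_at_within[OF appell_deriv])
      show "norm (r * appell G r m' z) \<le> \<bar>r\<bar> * C" if "z \<in> {0..1}" for z
        using C[OF that] by (simp add: abs_mult mult_left_mono)
    qed (use that in auto)
    then show ?thesis by simp
  qed
  moreover have "\<bar>r\<bar> * C \<ge> 0" using C[of 0] by (simp add: order.trans[OF abs_ge_zero])
  ultimately show ?thesis by metis
qed

lemma appell_step:
  "\<exists>C\<ge>0. \<forall>x\<in>{0..1}. \<forall>y\<in>{0..1}. x < y \<longrightarrow>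
     \<bar>appell G r (Suc m) y - appell G r (Suc m) x - r * (y - x) * appell G r m x\<bar> \<le> C * (y - x)\<^sup>2"
proof -
  obtain L where L: "L \<ge> 0" "\<And>x y. x \<in> {0..1} \<Longrightarrow> y \<in> {0..1} \<Longrightarrow> \<bar>appell G r m y - appell G r m x\<bar> \<le> L * \<bar>y - x\<bar>"
    using appell_lipschitz[of G r m] by metis
  have "\<bar>appell G r (Suc m) y - appell G r (Suc m) x - r * (y - x) * appell G r m x\<bar> \<le> (\<bar>r\<bar> * L) * (y - x)\<^sup>2"
    if xy: "x \<in> {0..1}" "y \<in> {0..1}" "x < y" for x y
  proof -
    obtain z where z: "z > x" "z < y" "appell G r (Suc m) y - appell G r (Suc m) x = (y - x) * (r * appell G r m z)"
      using MVT2[OF xy(3), of "appell G r (Suc m)" "\<lambda>t. r * appell G r m t"] appell_deriv by auto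
    have "appell G r (Suc m) y - appell G r (Suc m) x - r * (y - x) * appell G r m x
       = r * (y - x) * (appell G r m z - appell G r m x)"
      unfolding z(3) by (simp add: algebra_simps)
    then have "\<bar>appell G r (Suc m) y - appell G r (Suc m) x - r * (y - x) * appell G r m x\<bar>
       = \<bar>r\<bar> * (y - x) * \<bar>appell G r m z - appell G r m x\<bar>"
      using xy by (simp add: abs_mult)
    also have "\<dots> \<le> \<bar>r\<bar> * (y - x) * (L * (y - x))"
    proof (intro mult_left_mono)
      have "\<bar>appell G r m z - appell G r m x\<bar> \<le> L * \<bar>z - x\<bar>" using xy z by (intro L) auto
      also have "\<dots> \<le> L * (y - x)" using z L by (intro mult_left_mono) auto
      finally show "\<bar>appell G r m z - appell G r m x\<bar> \<le> L * (y - x)" .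
    qed (use xy in auto)
    finally show ?thesis by (simp add: power2_eq_square algebra_simps)
  qed
  moreover have "\<bar>r\<bar> * L \<ge> 0" using L by simp
  ultimately show ?thesis by metis
qed

text \<open>The constant does not depend on \<open>N\<close> or \<open>d\<close>; in this form the
  polynomials are compared with the difference equations of the convolution powers.\<close>

lemma appell_grid:
  "\<exists>C\<ge>0. \<forall>N d. d < N \<longrightarrow>
     \<bar>appell G r (Suc m) (real (Suc d) / real N) - appell G r (Suc m) (real d / real N)
        - r / real N * appell G r m (real d / real N)\<bar> \<le> C / real N ^ 2 \<and>
     \<bar>appell G r m (real (Suc d) / real N) - appell G r m (real d / real N)\<bar> \<le> C / real N"
proof -
  obtain C where C: "C \<ge> 0" "\<And>x y. x \<in> {0..1} \<Longrightarrow> y \<in> {0..1} \<Longrightarrow> x < y \<Longrightarrow>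
     \<bar>appell G r (Suc m) y - appell G r (Suc m) x - r * (y - x) * appell G r m x\<bar> \<le> C * (y - x)\<^sup>2"
    using appell_step[of G r m] by metis
  obtain L where L: "L \<ge> 0" "\<And>x y. x \<in> {0..1} \<Longrightarrow> y \<in> {0..1} \<Longrightarrow> \<bar>appell G r m y - appell G r m x\<bar> \<le> L * \<bar>y - x\<bar>"
    using appell_lipschitz[of G r m] by metis
  show ?thesis
  proof (intro exI[of _ "C + L"] conjI allI impI)
    fix N d :: nat assume d: "d < N"
    define x y where "x = real d / real N" and "y = real (Suc d) / real N"
    have xy: "x \<in> {0..1}" "y \<in> {0..1}" "x < y" using d by (auto simp: x_def y_def field_simps)
    have yx: "y - x = 1 / real N" by (simp add: x_def y_def diff_divide_distrib[symmetric])
    have "\<bar>appell G r (Suc m) y - appell G r (Suc m) x - r / real N * appell G r m x\<bar> \<le> C / real N ^ 2"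
      using C(2)[OF xy] unfolding yx by (simp add: power_divide)
    also have "\<dots> \<le> (C + L) / real N ^ 2" using L by (intro divide_right_mono) auto
    finally show "\<bar>appell G r (Suc m) (real (Suc d) / real N) - appell G r (Suc m) (real d / real N)
        - r / real N * appell G r m (real d / real N)\<bar> \<le> (C + L) / real N ^ 2"
      by (simp only: x_def y_def)
    have "\<bar>appell G r m y - appell G r m x\<bar> \<le> L / real N"
      using L(2)[OF xy(1,2)] unfolding yx by simp
    also have "\<dots> \<le> (C + L) / real N" using C by (intro divide_right_mono) auto
    finally show "\<bar>appell G r m (real (Suc d) / real N) - appell G r m (real d / real N)\<bar> \<le> (C + L) / real N"
      by (simp only: x_def y_def)
  qed (use C L in auto)
qed

lemma telescope_bound:
  fixes e :: "nat \<Rightarrow> real"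
  assumes "\<And>d. d < n \<Longrightarrow> \<bar>e (Suc d) - e d\<bar> \<le> b d" "d \<le> n"
  shows "\<bar>e d - e 0\<bar> \<le> (\<Sum>i<n. b i)"
proof -
  have b0: "b i \<ge> 0" if "i < n" for i using assms(1)[OF that] by linarith
  have "e d - e 0 = (\<Sum>i<d. e (Suc i) - e i)" by (simp add: sum_lessThan_telescope)
  also have "\<bar>\<dots>\<bar> \<le> (\<Sum>i<d. b i)" using assms by (intro order.trans[OF sum_abs] sum_mono) auto
  also have "\<dots> \<le> (\<Sum>i<n. b i)" using assms(2) b0 by (intro sum_mono2) auto
  finally show ?thesis .
qed

lemma kernel_trace_scale: "kernel_trace (\<lambda>a b. c * K a b) A m = c ^ m * kernel_trace K A m"
proof -
  have "kernel_power (\<lambda>a b. c * K a b) A m a b = c ^ m * kernel_power K A m a b" for a b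
    by (induction m arbitrary: b) (simp_all add: sum_distrib_left algebra_simps)
  then show ?thesis by (simp add: kernel_trace_def sum_distrib_left)
qed

lemma sum_int_eq_sum_nat: "(\<Sum>e\<in>{0..<int N}. f e) = (\<Sum>e<N. f (int e))"
  by (rule sum.reindex_bij_witness[where i = int and j = nat]) auto

section \<open>Limits of the traces\<close>

text \<open>This is \<open>h\<close> in terms of \<open>d = y - x\<close>: for negative
  \<open>d\<close> with \<open>\<bar>d\<bar> < M\<close>, replacing \<open>d\<close> by
  \<open>d + M\<close> and \<open>-1\<close> by \<open>1\<close> leaves
  \<open>sgn d - 2 d / M\<close> unchanged. The value \<open>0\<close> at the jump keeps the
  function odd.\<close>

definition sawtooth :: "nat \<Rightarrow> int \<Rightarrow> real" where
  "sawtooth M d = (if d mod int M = 0 then 0 else 1 - 2 * real_of_int (d mod int M) / M)"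

text \<open>The kernel \<open>s\<close>: it is \<open>1\<close> on the offsets \<open>1..n\<close>
  occurring in the writhe and \<open>-1\<close> on their negatives.\<close>

definition square_wave :: "nat \<Rightarrow> int \<Rightarrow> real" where
  "square_wave n d = (let r = d mod int (2 * n + 1) in if r = 0 then 0 else if r \<le> int n then 1 else - 1)"

section \<open>Symmetries of the two kernels\<close>

lemma periodic_sawtooth: "periodic M (sawtooth M)"
  by (simp add: periodic_def sawtooth_def)

lemma periodic_square_wave: "periodic (2 * n + 1) (square_wave n)"
  unfolding periodic_def square_wave_def mod_mod_trivial by simp

lemma abs_sawtooth_le: "M > 0 \<Longrightarrow> \<bar>sawtooth M d\<bar> \<le> 1"
proof -
  assume M: "M > 0"
  define r where "r = d mod int M"
  have r: "0 \<le> r" "r < int M" using M by (auto simp: r_def)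
  define q where "q = real_of_int r / real M"
  have "0 \<le> q" "q \<le> 1" using r M unfolding q_def
    by (simp_all add: divide_le_eq_1_pos)
  then have "\<bar>1 - 2 * q\<bar> \<le> 1" by linarith
  then have "\<bar>1 - 2 * real_of_int r / M\<bar> \<le> 1" by (simp add: q_def)
  then show ?thesis unfolding sawtooth_def r_def[symmetric] by simp
qed

lemma abs_square_wave_le: "\<bar>square_wave n d\<bar> \<le> 1"
  by (auto simp: square_wave_def Let_def)

lemma sawtooth_minus: "M > 0 \<Longrightarrow> sawtooth M (- d) = - sawtooth M d"
proof -
  assume M: "M > 0"
  define r where "r = d mod int M"
  have "r < int M" using M by (simp add: r_def)
  then show ?thesis using M unfolding sawtooth_def zmod_zminus1_eq_if r_def[symmetric]
    by (auto simp: field_simps)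
qed

lemma square_wave_minus: "square_wave n (- d) = - square_wave n d"
proof -
  define N where "N = int (2 * n + 1)"
  define r where "r = d mod N"
  have "N > 0" by (simp add: N_def)
  then have "r < N" "0 \<le> r" by (simp_all add: r_def)
  then show ?thesis unfolding square_wave_def N_def[symmetric] Let_def zmod_zminus1_eq_if r_def[symmetric]
    by (auto simp: N_def)
qed

lemma sum_odd_periodic_zero:
  assumes "periodic N f" "N > 0" "\<And>x. f (- x) = - f x"
  shows "(\<Sum>e\<in>{0..<int N}. f e) = 0"
proof -
  have "(\<Sum>e\<in>{0..<int N}. f e) = (\<Sum>e\<in>{0..<int N}. f (0 - e))"
    by (rule sum_periodic_reflect[OF assms(1,2), symmetric])
  also have "\<dots> = - (\<Sum>e\<in>{0..<int N}. f e)" by (simp add: assms(3) sum_negf)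
  finally show ?thesis by simp
qed

lemma succ_mod_cases:
  fixes x N :: int
  assumes "N > 0"
  shows "(x + 1) mod N = (if x mod N = N - 1 then 0 else x mod N + 1)"
proof -
  have "(x + 1) mod N = (x mod N + 1) mod N" by (simp add: mod_simps)
  moreover have "0 \<le> x mod N" "x mod N < N" using assms by simp_all
  ultimately show ?thesis by auto
qed

text \<open>The jump at multiples of \<open>M\<close> passes through the value \<open>0\<close> and
  is therefore split into two unit jumps on top of the constant slope.\<close>

lemma sawtooth_step:
  assumes "M > 0"
  shows "sawtooth M (x + 1) - sawtooth M x
    = - 2 / M + of_bool (x mod int M = 0) + of_bool (x mod int M = int M - 1)"
proof -
  define r where "r = x mod int M"
  have r: "0 \<le> r" "r < int M" using assms by (auto simp: r_def)
  define a :: real where "a = 2 / M"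
  have c: "2 * (real_of_int r + 1) / M = 2 * real_of_int r / M + a"
    by (simp add: a_def add_divide_distrib)
  have st: "(x + 1) mod int M = (if r = int M - 1 then 0 else r + 1)"
    using succ_mod_cases[of "int M" x] assms by (simp add: r_def)
  have saw0: "sawtooth M x = (if r = 0 then 0 else 1 - 2 * real_of_int r / M)"
    by (simp add: sawtooth_def r_def)
  have saw1: "sawtooth M (x + 1) = (if r = int M - 1 then 0 else 1 - 2 * (real_of_int r + 1) / M)"
    unfolding sawtooth_def st using r by simp
  have last: "2 * real_of_int r / M = 2 - a" if "r = int M - 1"
    using that assms by (simp add: a_def diff_divide_distrib)
  \<comment> \<open>Both unit jumps fall on the same residue only for \<open>M = 1\<close>.\<close>
  have a: "a = 2" if "r = 0" "r = int M - 1"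
    using that by (simp add: a_def)
  have "sawtooth M (x + 1) - sawtooth M x = - a + of_bool (r = 0) + of_bool (r = int M - 1)"
    unfolding saw0 saw1 c using last a
    by (cases "r = 0"; cases "r = int M - 1") simp_all
  then show ?thesis by (simp add: a_def r_def)
qed

lemma square_wave_step:
  "square_wave n (x + 1) - square_wave n x
    = of_bool (x mod int (2 * n + 1) = 0) + of_bool (x mod int (2 * n + 1) = int (2 * n))
      - 2 * of_bool (x mod int (2 * n + 1) = int n)"
proof -
  define N where "N = int (2 * n + 1)"
  have N0: "N > 0" by (simp add: N_def)
  define r where "r = x mod N"
  have r: "0 \<le> r" "r < N" using N0 by (auto simp: r_def)
  show ?thesis
    unfolding square_wave_def N_def[symmetric] succ_mod_cases[OF N0] r_def[symmetric] Let_def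
    using r by (auto simp: N_def)
qed

text \<open>A shift by \<open>n\<close> falls just short of half the period
  \<open>2 * n + 1\<close>, so it reverses the sign except at two residues. Reducing
  \<open>n + 1\<close> covers the case \<open>n = 0\<close>.\<close>

lemma square_wave_half:
  "square_wave n x + square_wave n (x + int n)
    = of_bool (x mod int (2 * n + 1) = 0) - of_bool (x mod int (2 * n + 1) = int (n + 1) mod int (2 * n + 1))"
proof -
  define N where "N = int (2 * n + 1)"
  have N0: "N > 0" by (simp add: N_def)
  define r where "r = x mod N"
  have r: "0 \<le> r" "r < N" using N0 by (auto simp: r_def)
  have "(x + int n) mod N = (r + int n) mod N" by (simp add: r_def mod_simps)
  also have "\<dots> = (if r + int n < N then r + int n else r + int n - N)"
  proof (cases "r + int n < N")
    case False
    have "(r + int n) mod N = (r + int n - N) mod N" by simp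
    also have "\<dots> = r + int n - N" using False r by (intro mod_pos_pos_trivial) (auto simp: N_def)
    finally show ?thesis using False by simp
  qed (use r in simp)
  finally have 1: "(x + int n) mod N = (if r + int n < N then r + int n else r + int n - N)" .
  have 2: "int (n + 1) mod N = (if n = 0 then 0 else int (n + 1))" by (simp add: N_def)
  show ?thesis
    unfolding square_wave_def N_def[symmetric] 1 2 r_def[symmetric] Let_def
  proof -
    consider "r = 0" | "0 < r" "r \<le> int n" | "r = int n + 1" | "r > int n + 1" using r by linarith
    then show "(if r = 0 then 0 else if r \<le> int n then 1 else - 1) +
      (if (if r + int n < N then r + int n else r + int n - N) = 0 then 0
       else if (if r + int n < N then r + int n else r + int n - N) \<le> int n then 1 else - 1)
      = of_bool (r = 0) - (of_bool (r = (if n = 0 then 0 else int (n + 1))) :: real)"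
      by cases (use r in \<open>simp_all add: N_def\<close>)
  qed
qed

text \<open>The constant slope meets the zero sum and drops out; the two unit jumps select
  neighbouring values. This is the discrete form of the derivative rule of \<open>bpoly\<close> with
  rate \<open>2\<close>.\<close>

lemma circ_power_sawtooth_step:
  assumes M: "M > 0"
  shows "circ_power (sawtooth M) M (Suc m) (d + 1) - circ_power (sawtooth M) M (Suc m) d
    = (circ_power (sawtooth M) M m d + circ_power (sawtooth M) M m (d + 1)) / M"
proof -
  let ?u = "circ_power (sawtooth M) M m"
  have per: "periodic M ?u" by (rule periodic_circ_power[OF periodic_sawtooth])
  have z: "(\<Sum>e\<in>{0..<int M}. ?u e) = 0"
    using M by (intro circ_power_sum_zero periodic_sawtooth sum_odd_periodic_zero sawtooth_minus)
  have st: "sawtooth M (d + 1 - e) - sawtooth M (d - e)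
    = - 2 / M + of_bool ((d - e) mod int M = 0 mod int M) + of_bool ((d - e) mod int M = (- 1) mod int M)" for e
    using sawtooth_step[OF M, of "d - e"] M by (simp add: algebra_simps zmod_minus1)
  have "(\<Sum>e\<in>{0..<int M}. ?u e * sawtooth M (d + 1 - e)) - (\<Sum>e\<in>{0..<int M}. ?u e * sawtooth M (d - e))
    = (\<Sum>e\<in>{0..<int M}. ?u e * (sawtooth M (d + 1 - e) - sawtooth M (d - e)))"
    by (simp add: sum_subtractf algebra_simps)
  also have "\<dots> = (- 2 / M) * (\<Sum>e\<in>{0..<int M}. ?u e)
      + (\<Sum>e\<in>{0..<int M}. ?u e * of_bool ((d - e) mod int M = 0 mod int M))
      + (\<Sum>e\<in>{0..<int M}. ?u e * of_bool ((d - e) mod int M = (- 1) mod int M))"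
    unfolding st by (simp only: distrib_left sum.distrib sum_distrib_left mult.commute)
  also have "\<dots> = ?u d + ?u (d + 1)"
    unfolding sum_periodic_delta[OF per M] z by simp
  finally show ?thesis by (simp add: circ_power.simps(2) diff_divide_distrib[symmetric])
qed

text \<open>The drop from \<open>1\<close> to \<open>-1\<close> selects a value about half a period
  away, which is nearly minus the local one. The slope is thus about \<open>4\<close> times the
  previous power, whence the rate \<open>4\<close> of \<open>epoly\<close>.\<close>

lemma circ_power_square_wave_step:
  fixes n :: nat
  defines "N \<equiv> 2 * n + 1"
  shows "circ_power (square_wave n) N (Suc m) (d + 1) - circ_power (square_wave n) N (Suc m) d
    = (circ_power (square_wave n) N m d + circ_power (square_wave n) N m (d + 1)
        - 2 * circ_power (square_wave n) N m (d - int n)) / N"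
proof -
  let ?u = "circ_power (square_wave n) N m"
  have per: "periodic N ?u" unfolding N_def by (rule periodic_circ_power[OF periodic_square_wave])
  have N: "N > 0" by (simp add: N_def)
  have st: "square_wave n (d + 1 - e) - square_wave n (d - e)
    = of_bool ((d - e) mod int N = 0 mod int N) + of_bool ((d - e) mod int N = (- 1) mod int N)
      - 2 * of_bool ((d - e) mod int N = int n mod int N)" for e
    using square_wave_step[of n "d - e"] by (simp add: algebra_simps zmod_minus1 N_def)
  have "(\<Sum>e\<in>{0..<int N}. ?u e * square_wave n (d + 1 - e)) - (\<Sum>e\<in>{0..<int N}. ?u e * square_wave n (d - e))
    = (\<Sum>e\<in>{0..<int N}. ?u e * (square_wave n (d + 1 - e) - square_wave n (d - e)))"
    by (simp add: sum_subtractf algebra_simps)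
  also have "\<dots> = (\<Sum>e\<in>{0..<int N}. ?u e * of_bool ((d - e) mod int N = 0 mod int N))
      + (\<Sum>e\<in>{0..<int N}. ?u e * of_bool ((d - e) mod int N = (- 1) mod int N))
      - 2 * (\<Sum>e\<in>{0..<int N}. ?u e * of_bool ((d - e) mod int N = int n mod int N))"
    unfolding st sum_distrib_left sum.distrib[symmetric] sum_subtractf[symmetric]
    by (intro sum.cong refl) (simp add: algebra_simps)
  also have "\<dots> = ?u d + ?u (d + 1) - 2 * ?u (d - int n)"
    unfolding sum_periodic_delta[OF per N] by simp
  finally show ?thesis by (simp add: circ_power.simps(2) diff_divide_distrib[symmetric])
qed

text \<open>The two exceptional residues of \<open>square_wave_half\<close> leave a difference of
  two values of the previous power, each of modulus at most \<open>1\<close>.\<close>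

lemma circ_power_square_wave_half:
  fixes n :: nat
  defines "N \<equiv> 2 * n + 1"
  shows "\<bar>circ_power (square_wave n) N (Suc m) d + circ_power (square_wave n) N (Suc m) (d + int n)\<bar> \<le> 2 / N"
proof -
  let ?u = "circ_power (square_wave n) N m"
  have per: "periodic N ?u" unfolding N_def by (rule periodic_circ_power[OF periodic_square_wave])
  have N: "N > 0" by (simp add: N_def)
  have le: "\<bar>?u x\<bar> \<le> 1" for x by (intro abs_circ_power_le abs_square_wave_le N)
  have st: "square_wave n (d - e) + square_wave n (d + int n - e)
    = of_bool ((d - e) mod int N = 0 mod int N) - of_bool ((d - e) mod int N = int (n + 1) mod int N)" for e
    using square_wave_half[of n "d - e"] by (simp add: algebra_simps N_def)
  have "(\<Sum>e\<in>{0..<int N}. ?u e * square_wave n (d - e)) + (\<Sum>e\<in>{0..<int N}. ?u e * square_wave n (d + int n - e))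
    = (\<Sum>e\<in>{0..<int N}. ?u e * (square_wave n (d - e) + square_wave n (d + int n - e)))"
    by (simp add: sum.distrib algebra_simps)
  also have "\<dots> = (\<Sum>e\<in>{0..<int N}. ?u e * of_bool ((d - e) mod int N = 0 mod int N))
      - (\<Sum>e\<in>{0..<int N}. ?u e * of_bool ((d - e) mod int N = int (n + 1) mod int N))"
    unfolding st sum_subtractf[symmetric]
    by (intro sum.cong refl) (simp add: algebra_simps)
  also have "\<dots> = ?u d - ?u (d - int (n + 1))"
    unfolding sum_periodic_delta[OF per N] by simp
  finally have "\<bar>circ_power (square_wave n) N (Suc m) d + circ_power (square_wave n) N (Suc m) (d + int n)\<bar>
     = \<bar>?u d - ?u (d - int (n + 1))\<bar> / N"
    using N by (simp add: circ_power.simps(2) add_divide_distrib[symmetric] abs_divide)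
  also have "\<dots> \<le> 2 / N"
    using le[of d] le[of "d - int (n + 1)"] N by (intro divide_right_mono) auto
  finally show ?thesis .
qed

text \<open>The series \<open>-2z / (exp(2z) - 1)\<close>, so that \<open>bpoly m t\<close> is
  \<open>-2^m B_m(t) / m!\<close> with the Bernoulli polynomial \<open>B_m\<close>. Sign and scale
  are chosen to give \<open>bpoly 1 t = 1 - 2 * t\<close>, the limit of the sawtooth.\<close>

definition bernoulli_gf :: "real fps" where
  "bernoulli_gf = Abs_fps (\<lambda>m. - (2 ^ m * bernoulli m / fact m))"

lemma bernoulli_fps: "(fps_X / (fps_exp 1 - 1)) * (fps_exp 1 - 1) = (fps_X :: real fps)"
proof -
  have ne: "fps_exp 1 - 1 \<noteq> (0 :: real fps)"
  proof
    assume "fps_exp 1 - 1 = (0 :: real fps)"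
    from arg_cong[OF this, of "\<lambda>f. fps_nth f 1"] show False by simp
  qed
  have "subdegree (fps_exp 1 - 1 :: real fps) = 1"
    by (rule subdegreeI) auto
  then have "(fps_exp 1 - 1) dvd (fps_X :: real fps)"
    using ne by (simp add: fps_dvd_iff)
  then show ?thesis by simp
qed

lemma bernoulli_gf_eq: "bernoulli_gf * (fps_exp 2 - 1) = - 2 * fps_X"
proof -
  define P where "P = (fps_X / (fps_exp 1 - 1) :: real fps)"
  have a: "bernoulli_gf = - (P oo (fps_const 2 * fps_X))"
    by (rule fps_ext) (simp add: bernoulli_gf_def bernoulli_def P_def fps_compose_linear)
  have b: "(fps_exp 2 - 1 :: real fps) = (fps_exp 1 - 1) oo (fps_const 2 * fps_X)"
  proof (rule fps_ext)
    fix m show "fps_nth (fps_exp 2 - 1 :: real fps) m = fps_nth ((fps_exp 1 - 1) oo (fps_const 2 * fps_X)) m"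
      unfolding fps_compose_linear by (cases m) (simp_all add: algebra_simps)
  qed
  have "bernoulli_gf * (fps_exp 2 - 1) = - ((P * (fps_exp 1 - 1)) oo (fps_const 2 * fps_X))"
    unfolding a b by (simp add: fps_compose_mult_distrib)
  also have "\<dots> = - (fps_const 2 * fps_X)"
    using bernoulli_fps unfolding P_def by simp
  finally show ?thesis by (simp add: numeral_fps_const)
qed

text \<open>With rate \<open>4\<close>, \<open>epoly (Suc m) t\<close> is
  \<open>2^m E_m(2t) / m!\<close> for the Euler polynomial \<open>E_m\<close>. The factor
  \<open>z\<close> aligns the indices: \<open>epoly 1\<close> is the constant \<open>1\<close>, the
  square wave on its first half period.\<close>

definition euler_gf :: "real fps" where
  "euler_gf = 2 * fps_X * inverse (1 + fps_exp 2)"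

lemma euler_gf_eq: "euler_gf * (1 + fps_exp 2) = 2 * fps_X"
proof -
  have "inverse (1 + fps_exp 2) * (1 + fps_exp 2) = (1 :: real fps)"
    by (rule inverse_mult_eq_1) simp
  then show ?thesis by (simp only: euler_gf_def mult.assoc mult_1_right)
qed

text \<open>Partial fractions: with \<open>E = exp(2z)\<close>,
  \<open>2z / (E + 1) = 2z / (E - 1) - 4z / (E^2 - 1)\<close>, and the last quotient is the
  preceding one with \<open>z\<close> doubled. This is the origin of \<open>2 ^ m - 1\<close> in
  \<open>cycle_weight\<close>.\<close>

lemma euler_gf_nth: "fps_nth euler_gf m = (1 - 2 ^ m) * (2 ^ m * bernoulli m / fact m)"
proof -
  define E where "E = (fps_exp 2 :: real fps)"
  define Q where "Q = bernoulli_gf oo (fps_const 2 * fps_X)"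
  have E2: "fps_exp 4 = E * E" by (simp add: E_def fps_exp_add_mult[symmetric])
  have "E oo (fps_const 2 * fps_X) = fps_exp 4"
    by (rule fps_ext) (simp add: fps_compose_linear E_def power_mult_distrib[symmetric])
  then have "Q * (E * E - 1) = (bernoulli_gf * (E - 1)) oo (fps_const 2 * fps_X)"
    by (simp add: Q_def fps_compose_mult_distrib fps_compose_sub_distrib E2)
  also have "\<dots> = - 4 * fps_X"
    unfolding E_def bernoulli_gf_eq
  proof (rule fps_ext)
    fix m show "fps_nth ((- 2 * fps_X) oo (fps_const 2 * fps_X)) m = fps_nth (- 4 * fps_X :: real fps) m"
      unfolding fps_compose_linear
      by (cases "m = 1") (simp_all add: numeral_fps_const fps_mult_left_const_nth)
  qed
  finally have Q: "Q * (E * E - 1) = - 4 * fps_X" .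
  have B: "bernoulli_gf * (E - 1) = - 2 * fps_X" unfolding E_def by (rule bernoulli_gf_eq)
  have "(Q - bernoulli_gf) * (E * E - 1) = Q * (E * E - 1) - (bernoulli_gf * (E - 1)) * (E + 1)"
    by (simp add: algebra_simps)
  also have "\<dots> = 2 * fps_X * (E - 1)" unfolding Q B by (simp add: algebra_simps)
  also have "\<dots> = euler_gf * (1 + E) * (E - 1)" unfolding E_def euler_gf_eq ..
  also have "\<dots> = euler_gf * (E * E - 1)" by (simp add: algebra_simps)
  finally have "(Q - bernoulli_gf) * (E * E - 1) = euler_gf * (E * E - 1)" .
  moreover have "E * E - 1 \<noteq> 0"
  proof
    assume "E * E - 1 = 0"
    then have "fps_nth (fps_exp 4 - 1 :: real fps) 1 = 0" by (simp add: E2)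
    then show False by simp
  qed
  ultimately have a: "euler_gf = Q - bernoulli_gf" by simp
  have "fps_nth Q m = 2 ^ m * fps_nth bernoulli_gf m"
    unfolding Q_def fps_compose_linear by simp
  then show ?thesis unfolding a by (simp add: bernoulli_gf_def field_simps)
qed

abbreviation bpoly :: "nat \<Rightarrow> real \<Rightarrow> real" where
  "bpoly \<equiv> appell bernoulli_gf 2"

abbreviation epoly :: "nat \<Rightarrow> real \<Rightarrow> real" where
  "epoly \<equiv> appell euler_gf 4"

text \<open>The difference of the end values has generating function \<open>-2z\<close>; only degree
  one, the sawtooth itself, has a jump.\<close>

lemma bpoly_1_minus_0: "bpoly (Suc (Suc m)) 1 = bpoly (Suc (Suc m)) 0"
proof -
  have "bpoly (Suc (Suc m)) 1 - bpoly (Suc (Suc m)) 0 = fps_nth (bernoulli_gf * (fps_exp 2 - 1)) (Suc (Suc m))"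
    by (simp add: appell_def algebra_simps)
  then show ?thesis unfolding bernoulli_gf_eq by (simp add: numeral_fps_const fps_mult_left_const_nth)
qed

lemma bpoly_1: "bpoly 1 t = 1 - 2 * t"
proof -
  have "fps_nth (bernoulli_gf * (fps_exp 2 - 1)) 1 = - 2" "fps_nth (bernoulli_gf * (fps_exp 2 - 1)) 2 = 0"
    unfolding bernoulli_gf_eq by (simp_all add: numeral_fps_const fps_mult_left_const_nth)
  then have "fps_nth bernoulli_gf 0 = - 1" "fps_nth bernoulli_gf 1 = 1"
    by (simp_all add: fps_mult_nth numeral_2_eq_2)
  then show ?thesis by (simp add: appell_eq)
qed

text \<open>At \<open>t = 1/2\<close> the rate \<open>4\<close> gives \<open>exp(2z)\<close>, and
  the sum of the two values has generating function \<open>2z\<close>: antiperiodicity in all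
  degrees but one.\<close>

lemma epoly_half: "epoly (Suc (Suc m)) (1 / 2) = - epoly (Suc (Suc m)) 0"
proof -
  have "epoly (Suc (Suc m)) (1 / 2) + epoly (Suc (Suc m)) 0 = fps_nth (euler_gf * (1 + fps_exp 2)) (Suc (Suc m))"
    by (simp add: appell_def algebra_simps)
  then show ?thesis unfolding euler_gf_eq by (simp add: numeral_fps_const fps_mult_left_const_nth)
qed

lemma epoly_1: "epoly 1 t = 1"
proof -
  have "fps_nth (euler_gf * (1 + fps_exp 2)) 0 = 0" "fps_nth (euler_gf * (1 + fps_exp 2)) 1 = 2"
    unfolding euler_gf_eq by (simp_all add: numeral_fps_const fps_mult_left_const_nth)
  then have "fps_nth euler_gf 0 = 0" "fps_nth euler_gf 1 = 1"
    by (simp_all add: fps_mult_nth)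
  then show ?thesis by (simp add: appell_eq)
qed

text \<open>
  The first convolution power has jumps and is only close to its limit in \<open>L\<^sup>1\<close>; the bound of the
  \<open>L\<^sup>1\<close> error is what the difference equation propagates.
\<close>

lemma sawtooth_power_approx:
  "\<exists>C. \<forall>M>0. (\<Sum>d<M. \<bar>circ_power (sawtooth M) M m (int d) - bpoly (Suc m) (real d / M)\<bar>) \<le> C \<and>
     (m \<ge> 1 \<longrightarrow> \<bar>circ_power (sawtooth M) M m 0 - bpoly (Suc m) 0\<bar> \<le> C / M)"
proof (induction m)
  case 0
  have "(\<Sum>d<M. \<bar>circ_power (sawtooth M) M 0 (int d) - bpoly (Suc 0) (real d / M)\<bar>) \<le> 1" if M: "M > 0" for M
  proof -
    have "\<bar>circ_power (sawtooth M) M 0 (int d) - bpoly (Suc 0) (real d / M)\<bar> = of_bool (d = 0)" if "d < M" for d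
      using that bpoly_1[of "real d / M"] by (auto simp: sawtooth_def)
    then have "(\<Sum>d<M. \<bar>circ_power (sawtooth M) M 0 (int d) - bpoly (Suc 0) (real d / M)\<bar>) = (\<Sum>d<M. if d = 0 then 1 else 0)"
      by (intro sum.cong refl) simp
    then show ?thesis using M by simp
  qed
  then show ?case by (intro exI[of _ 1]) simp
next
  case (Suc m)
  then obtain C where C: "\<And>M. M > 0 \<Longrightarrow> (\<Sum>d<M. \<bar>circ_power (sawtooth M) M m (int d) - bpoly (Suc m) (real d / M)\<bar>) \<le> C"
    by blast
  obtain C1 where C1: "\<And>t. t \<in> {0..1} \<Longrightarrow> \<bar>bpoly (Suc m) t\<bar> \<le> C1" using appell_bounded by metis
  obtain C2 where C2: "C2 \<ge> 0" "\<And>N d. d < N \<Longrightarrow>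
     \<bar>bpoly (Suc (Suc m)) (real (Suc d) / real N) - bpoly (Suc (Suc m)) (real d / real N)
        - 2 / real N * bpoly (Suc m) (real d / real N)\<bar> \<le> C2 / real N ^ 2"
     "\<And>N d. d < N \<Longrightarrow>
     \<bar>bpoly (Suc m) (real (Suc d) / real N) - bpoly (Suc m) (real d / real N)\<bar> \<le> C2 / real N"
    using appell_grid[of bernoulli_gf 2 "Suc m"] by metis
  obtain C3 where C3: "C3 \<ge> 0" "\<And>N d. d < N \<Longrightarrow>
     \<bar>bpoly (Suc (Suc (Suc m))) (real (Suc d) / real N) - bpoly (Suc (Suc (Suc m))) (real d / real N)
        - 2 / real N * bpoly (Suc (Suc m)) (real d / real N)\<bar> \<le> C3 / real N ^ 2"
    using appell_grid[of bernoulli_gf 2 "Suc (Suc m)"] by metis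
  define K where "K = 3 * C + 2 * C1 + 2 * C2"
  have main: "(\<Sum>d<M. \<bar>circ_power (sawtooth M) M (Suc m) (int d) - bpoly (Suc (Suc m)) (real d / M)\<bar>) \<le> 2 * K + C3 / 2 \<and>
     \<bar>circ_power (sawtooth M) M (Suc m) 0 - bpoly (Suc (Suc m)) 0\<bar> \<le> (2 * K + C3 / 2) / M" if M: "M > 0" for M
  proof -
    let ?u = "circ_power (sawtooth M) M m" and ?U = "circ_power (sawtooth M) M (Suc m)"
    define E where "E d = ?u (int d) - bpoly (Suc m) (real d / M)" for d
    define e where "e d = ?U (int d) - bpoly (Suc (Suc m)) (real d / M)" for d
    have M': "real M > 0" using M by simp
    have SE: "(\<Sum>d<M. \<bar>E d\<bar>) \<le> C" using C[OF M] by (simp add: E_def)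
    have step: "\<bar>e (Suc d) - e d\<bar> \<le> (\<bar>E d\<bar> + \<bar>E (Suc d)\<bar>) / M + 2 * C2 / real M ^ 2" if "d < M" for d
    proof -
      have "?U (int (Suc d)) - ?U (int d) = (?u (int d) + ?u (int (Suc d))) / M"
        using circ_power_sawtooth_step[OF M, of m "int d"] by (simp add: add.commute)
      then have "e (Suc d) - e d = (?u (int d) + ?u (int (Suc d))) / M
         - (bpoly (Suc (Suc m)) (real (Suc d) / M) - bpoly (Suc (Suc m)) (real d / M))"
        unfolding e_def by linarith
      also have "\<dots> = (E d + E (Suc d)) / M
         + (bpoly (Suc m) (real (Suc d) / M) - bpoly (Suc m) (real d / M)) / M
         - (bpoly (Suc (Suc m)) (real (Suc d) / M) - bpoly (Suc (Suc m)) (real d / M)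
            - 2 / M * bpoly (Suc m) (real d / M))"
        unfolding E_def by (simp add: add_divide_distrib diff_divide_distrib)
      finally have eq: "e (Suc d) - e d = (E d + E (Suc d)) / M
         + (bpoly (Suc m) (real (Suc d) / M) - bpoly (Suc m) (real d / M)) / M
         - (bpoly (Suc (Suc m)) (real (Suc d) / M) - bpoly (Suc (Suc m)) (real d / M)
            - 2 / M * bpoly (Suc m) (real d / M))" .
      have "\<bar>e (Suc d) - e d\<bar> \<le> (\<bar>E d\<bar> + \<bar>E (Suc d)\<bar>) / M
         + \<bar>bpoly (Suc m) (real (Suc d) / M) - bpoly (Suc m) (real d / M)\<bar> / M
         + \<bar>bpoly (Suc (Suc m)) (real (Suc d) / M) - bpoly (Suc (Suc m)) (real d / M)
            - 2 / M * bpoly (Suc m) (real d / M)\<bar>"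
      proof -
        have "\<bar>a / real M + b / real M - c\<bar> \<le> a' / real M + \<bar>b\<bar> / real M + \<bar>c\<bar>" if "\<bar>a\<bar> \<le> a'" for a b c a' :: real
        proof -
          have "\<bar>a / real M\<bar> \<le> a' / real M" "\<bar>b / real M\<bar> = \<bar>b\<bar> / real M"
            using that M' by (auto simp: abs_divide intro: divide_right_mono)
          then show ?thesis by linarith
        qed
        then show ?thesis unfolding eq by (meson abs_triangle_ineq)
      qed
      also have "\<dots> \<le> (\<bar>E d\<bar> + \<bar>E (Suc d)\<bar>) / M + (C2 / M) / M + C2 / real M ^ 2"
      proof -
        have "\<bar>bpoly (Suc m) (real (Suc d) / M) - bpoly (Suc m) (real d / M)\<bar> / M \<le> (C2 / M) / M"
          by (rule divide_right_mono[OF C2(3)[OF that]]) simp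
        then show ?thesis by (rule add_mono[OF add_left_mono C2(2)[OF that]])
      qed
      finally show ?thesis using M' by (simp add: power2_eq_square)
    qed
    \<comment> \<open>At \<open>d = M\<close> the convolution power returns to its value at
      \<open>0\<close>, but for \<open>m = 0\<close> the polynomial does not; bounding both its end
      values costs \<open>2 * C1\<close>.\<close>
    have EM: "\<bar>E M\<bar> \<le> C + 2 * C1"
    proof -
      have "?u (int M) = ?u 0"
        using periodic_add[OF periodic_circ_power[OF periodic_sawtooth], of M m 0] by simp
      then have "E M = E 0 + bpoly (Suc m) 0 - bpoly (Suc m) 1" using M' by (simp add: E_def)
      moreover have "\<bar>E 0\<bar> \<le> C" using member_le_sum[of 0 "{..<M}" "\<lambda>d. \<bar>E d\<bar>"] M SE by auto
      moreover have "\<bar>bpoly (Suc m) 0\<bar> \<le> C1" "\<bar>bpoly (Suc m) 1\<bar> \<le> C1" by (auto intro: C1)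
      ultimately show ?thesis by linarith
    qed
    have SE': "(\<Sum>d<M. \<bar>E (Suc d)\<bar>) \<le> 2 * C + 2 * C1"
    proof -
      have "(\<Sum>d<M. \<bar>E (Suc d)\<bar>) + \<bar>E 0\<bar> = (\<Sum>d<M. \<bar>E d\<bar>) + \<bar>E M\<bar>"
        using sum.lessThan_Suc_shift[of "\<lambda>d. \<bar>E d\<bar>" M] by simp
      then show ?thesis using SE EM by linarith
    qed
    have total: "(\<Sum>i<M. (\<bar>E i\<bar> + \<bar>E (Suc i)\<bar>) / M + 2 * C2 / real M ^ 2) \<le> K / M"
    proof -
      have "(\<Sum>i<M. (\<bar>E i\<bar> + \<bar>E (Suc i)\<bar>) / M + 2 * C2 / real M ^ 2)
         = ((\<Sum>i<M. \<bar>E i\<bar>) + (\<Sum>i<M. \<bar>E (Suc i)\<bar>) + 2 * C2) / M"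
        using M' by (simp add: sum.distrib sum_divide_distrib[symmetric] add_divide_distrib power2_eq_square)
      also have "\<dots> \<le> K / M" using SE SE' M' unfolding K_def by (intro divide_right_mono) auto
      finally show ?thesis .
    qed
    have e0: "\<bar>e d - e 0\<bar> \<le> K / M" if "d \<le> M" for d
      using order.trans[OF telescope_bound[where e = e, OF step that] total] .
    \<comment> \<open>The next polynomial has equal values at \<open>0\<close> and \<open>1\<close>,
      so its increments cancel and this grid sum stays bounded instead of growing like
      \<open>M\<close>.\<close>
    have riemann: "\<bar>\<Sum>d<M. bpoly (Suc (Suc m)) (real d / M)\<bar> \<le> C3 / 2"
    proof -
      let ?F = "\<lambda>d. bpoly (Suc (Suc (Suc m))) (real d / M)"
      have "(\<Sum>d<M. ?F (Suc d) - ?F d) = 0"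
      proof -
        have "(\<Sum>d<M. ?F (Suc d) - ?F d) = ?F M - ?F 0" by (rule sum_lessThan_telescope)
        then show ?thesis using M' bpoly_1_minus_0[of "Suc m"] by simp
      qed
      then have "2 / M * (\<Sum>d<M. bpoly (Suc (Suc m)) (real d / M))
          = - (\<Sum>d<M. ?F (Suc d) - ?F d - 2 / M * bpoly (Suc (Suc m)) (real d / M))"
        by (simp add: sum_subtractf sum_distrib_left)
      also have "\<bar>\<dots>\<bar> \<le> (\<Sum>d<M. C3 / real M ^ 2)"
        unfolding abs_minus_cancel using C3 by (intro order.trans[OF sum_abs] sum_mono) auto
      also have "\<dots> = C3 / M" using M' by (simp add: power2_eq_square)
      finally show ?thesis using M' by (simp add: abs_mult field_simps)
    qed
    \<comment> \<open>Increments determine \<open>e\<close> only up to a constant. Summation finds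
      it: the convolution power sums to zero, and the polynomial has a bounded grid sum.\<close>
    have "(\<Sum>d<M. ?U (int d)) = 0"
      using circ_power_sum_zero[OF periodic_sawtooth M sum_odd_periodic_zero[OF periodic_sawtooth M sawtooth_minus[OF M]], of "Suc m"]
      unfolding sum_int_eq_sum_nat .
    then have "\<bar>\<Sum>d<M. e d\<bar> \<le> C3 / 2" using riemann by (simp add: e_def sum_subtractf)
    moreover have "real M * e 0 = (\<Sum>d<M. e d) - (\<Sum>d<M. e d - e 0)" by (simp add: sum_subtractf)
    moreover have "\<bar>\<Sum>d<M. e d - e 0\<bar> \<le> K"
    proof -
      have "\<bar>\<Sum>d<M. e d - e 0\<bar> \<le> (\<Sum>d<M. K / M)"
        using e0 by (intro order.trans[OF sum_abs] sum_mono) auto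
      then show ?thesis using M' by simp
    qed
    ultimately have "\<bar>real M * e 0\<bar> \<le> K + C3 / 2" by linarith
    then have e00: "\<bar>e 0\<bar> \<le> (K + C3 / 2) / M" using M' by (simp add: abs_mult field_simps)
    have "(\<Sum>d<M. \<bar>e d\<bar>) \<le> (\<Sum>d<M. (2 * K + C3 / 2) / M)"
    proof (rule sum_mono)
      fix d assume "d \<in> {..<M}"
      then have "\<bar>e d\<bar> \<le> K / M + (K + C3 / 2) / M" using e0[of d] e00 by auto
      then show "\<bar>e d\<bar> \<le> (2 * K + C3 / 2) / M" by (simp add: add_divide_distrib)
    qed
    also have "\<dots> = 2 * K + C3 / 2" using M' by simp
    finally have 1: "(\<Sum>d<M. \<bar>e d\<bar>) \<le> 2 * K + C3 / 2" .
    have "K / M \<ge> 0" using e0[of 0] by simp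
    then have "\<bar>e 0\<bar> \<le> (2 * K + C3 / 2) / M" using e00 by (simp add: add_divide_distrib)
    then show ?thesis using 1 by (simp add: e_def)
  qed
  show ?case
    by (intro exI[of _ "2 * K + C3 / 2"] allI impI conjI)
       (rule conjunct1[OF main] conjunct2[OF main], assumption)+
qed

text \<open>Only half a period is followed, because \<open>epoly\<close> describes the limit on
  \<open>[0, 1/2]\<close> and antiperiodicity supplies the other half. Antiperiodicity also takes
  the place of the zero sum in fixing the additive constant.\<close>

lemma square_wave_power_approx:
  "\<exists>C. \<forall>n. n \<ge> 1 \<longrightarrow> (\<Sum>d\<le>n. \<bar>circ_power (square_wave n) (2 * n + 1) m (int d) - epoly (Suc m) (real d / real (2 * n + 1))\<bar>) \<le> C \<and>
     (m \<ge> 1 \<longrightarrow> \<bar>circ_power (square_wave n) (2 * n + 1) m 0 - epoly (Suc m) 0\<bar> \<le> C / real (2 * n + 1))"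
proof (induction m)
  case 0
  have "(\<Sum>d\<le>n. \<bar>circ_power (square_wave n) (2 * n + 1) 0 (int d) - epoly (Suc 0) (real d / real (2 * n + 1))\<bar>) \<le> 1" for n :: nat
  proof -
    have "\<bar>circ_power (square_wave n) (2 * n + 1) 0 (int d) - epoly (Suc 0) (real d / real (2 * n + 1))\<bar> = of_bool (d = 0)" if "d \<le> n" for d
      using that epoly_1[of "real d / real (2 * n + 1)"] by (auto simp: square_wave_def)
    then have "(\<Sum>d\<le>n. \<bar>circ_power (square_wave n) (2 * n + 1) 0 (int d) - epoly (Suc 0) (real d / real (2 * n + 1))\<bar>) = (\<Sum>d\<le>n. if d = 0 then 1 else 0)"
      by (intro sum.cong refl) simp
    then show ?thesis by simp
  qed
  then show ?case by (intro exI[of _ 1]) simp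
next
  case (Suc m)
  then obtain C where C: "\<And>n. n \<ge> 1 \<Longrightarrow> (\<Sum>d\<le>n. \<bar>circ_power (square_wave n) (2 * n + 1) m (int d) - epoly (Suc m) (real d / real (2 * n + 1))\<bar>) \<le> C"
    by blast
  obtain C2 where C2: "C2 \<ge> 0" "\<And>N d. d < N \<Longrightarrow>
     \<bar>epoly (Suc (Suc m)) (real (Suc d) / real N) - epoly (Suc (Suc m)) (real d / real N)
        - 4 / real N * epoly (Suc m) (real d / real N)\<bar> \<le> C2 / real N ^ 2"
     "\<And>N d. d < N \<Longrightarrow>
     \<bar>epoly (Suc m) (real (Suc d) / real N) - epoly (Suc m) (real d / real N)\<bar> \<le> C2 / real N"
    using appell_grid[of euler_gf 4 "Suc m"] by metis
  obtain L where L: "L \<ge> 0" "\<And>x y. x \<in> {0..1} \<Longrightarrow> y \<in> {0..1} \<Longrightarrow>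
      \<bar>epoly (Suc (Suc m)) y - epoly (Suc (Suc m)) x\<bar> \<le> L * \<bar>y - x\<bar>"
    using appell_lipschitz by metis
  \<comment> \<open>\<open>4 * C\<close> stems from \<open>E d + 3 * E (Suc d)\<close>;
    \<open>4 * C2 + 4\<close> from one grid error, three Lipschitz increments and twice the
    antiperiodicity defect \<open>2 / N\<close>.\<close>
  define K where "K = 4 * C + (4 * C2 + 4)"
  define K' where "K' = K + (K + 2 + L)"
  have main: "(\<Sum>d\<le>n. \<bar>circ_power (square_wave n) (2 * n + 1) (Suc m) (int d) - epoly (Suc (Suc m)) (real d / real (2 * n + 1))\<bar>) \<le> K' \<and>
     \<bar>circ_power (square_wave n) (2 * n + 1) (Suc m) 0 - epoly (Suc (Suc m)) 0\<bar> \<le> K' / real (2 * n + 1)" if n: "n \<ge> 1" for n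
  proof -
    define N where "N = 2 * n + 1"
    let ?u = "circ_power (square_wave n) N m" and ?U = "circ_power (square_wave n) N (Suc m)"
    define E where "E d = ?u (int d) - epoly (Suc m) (real d / real N)" for d
    define e where "e d = ?U (int d) - epoly (Suc (Suc m)) (real d / real N)" for d
    have N': "real N > 0" by (simp add: N_def)
    have SE: "(\<Sum>d\<le>n. \<bar>E d\<bar>) \<le> C" using C[OF n] by (simp add: E_def N_def)
    have anti: "\<bar>?u (int (Suc d) + int n) + ?u (int (Suc d))\<bar> \<le> 2 / N" if "d < n" for d
    proof (cases m)
      case 0
      \<comment> \<open>The arguments \<open>1..n\<close> avoid both exceptional residues, so the
        square wave itself has no defect here.\<close>
      have "square_wave n (int (Suc d)) + square_wave n (int (Suc d) + int n) = 0"
        using that by (simp add: square_wave_half)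
      then show ?thesis unfolding 0 by (simp add: add.commute)
    next
      case (Suc m')
      show ?thesis using circ_power_square_wave_half[of n m' "int (Suc d)"]
        unfolding Suc N_def by (simp add: add.commute)
    qed
    have step: "\<bar>e (Suc d) - e d\<bar> \<le> (\<bar>E d\<bar> + 3 * \<bar>E (Suc d)\<bar>) / N + (4 * C2 + 4) / real N ^ 2" if d: "d < n" for d
    proof -
      \<comment> \<open>Modulo \<open>2 * n + 1\<close>, \<open>d - n\<close> is
        \<open>Suc d + n\<close>, where the value is minus that at \<open>Suc d\<close> up to the
        defect \<open>\<theta>\<close>; hence the coefficient \<open>1 + 2 = 3\<close>.\<close>
      define \<theta> where "\<theta> = ?u (int (Suc d) + int n) + ?u (int (Suc d))"
      have th: "\<bar>\<theta>\<bar> \<le> 2 / N" unfolding \<theta>_def by (rule anti[OF d])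
      have "?u (int d - int n) = ?u (int (Suc d) + int n)"
        using periodic_add[OF periodic_circ_power[OF periodic_square_wave], of n m "int d - int n"]
        by (simp add: N_def algebra_simps)
      then have "?U (int (Suc d)) - ?U (int d) = (?u (int d) + 3 * ?u (int (Suc d)) - 2 * \<theta>) / N"
        using circ_power_square_wave_step[of n m "int d"] unfolding N_def[symmetric] \<theta>_def
        by (simp add: add.commute algebra_simps)
      then have "e (Suc d) - e d = (?u (int d) + 3 * ?u (int (Suc d)) - 2 * \<theta>) / N
         - (epoly (Suc (Suc m)) (real (Suc d) / N) - epoly (Suc (Suc m)) (real d / N))"
        unfolding e_def by linarith
      also have "\<dots> = (E d + 3 * E (Suc d)) / N
         + (3 * (epoly (Suc m) (real (Suc d) / N) - epoly (Suc m) (real d / N)) - 2 * \<theta>) / N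
         - (epoly (Suc (Suc m)) (real (Suc d) / N) - epoly (Suc (Suc m)) (real d / N)
            - 4 / N * epoly (Suc m) (real d / N))"
        unfolding E_def by (simp add: add_divide_distrib diff_divide_distrib)
      finally have "e (Suc d) - e d = (E d + 3 * E (Suc d)) / N
         + (3 * (epoly (Suc m) (real (Suc d) / N) - epoly (Suc m) (real d / N)) - 2 * \<theta>) / N
         - (epoly (Suc (Suc m)) (real (Suc d) / N) - epoly (Suc (Suc m)) (real d / N)
            - 4 / N * epoly (Suc m) (real d / N))" .
      moreover have "\<bar>a / real N + b / real N - c\<bar> \<le> a' / real N + b' / real N + c'"
        if "\<bar>a\<bar> \<le> a'" "\<bar>b\<bar> \<le> b'" "\<bar>c\<bar> \<le> c'" for a b c a' b' c' :: real
      proof -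
        have "\<bar>a / real N\<bar> \<le> a' / real N" "\<bar>b / real N\<bar> \<le> b' / real N"
          using that N' by (auto simp: abs_divide intro: divide_right_mono)
        then show ?thesis using that by linarith
      qed
      moreover have "\<bar>E d + 3 * E (Suc d)\<bar> \<le> \<bar>E d\<bar> + 3 * \<bar>E (Suc d)\<bar>" by linarith
      moreover have "\<bar>3 * (epoly (Suc m) (real (Suc d) / N) - epoly (Suc m) (real d / N)) - 2 * \<theta>\<bar> \<le> (3 * C2 + 4) / N"
      proof -
        have "\<bar>epoly (Suc m) (real (Suc d) / N) - epoly (Suc m) (real d / N)\<bar> \<le> C2 / N"
          using d by (intro C2) (simp add: N_def)
        then have "\<bar>3 * (epoly (Suc m) (real (Suc d) / N) - epoly (Suc m) (real d / N)) - 2 * \<theta>\<bar> \<le> 3 * (C2 / N) + 2 * (2 / N)"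
        proof -
          have "\<bar>3 * a - 2 * t\<bar> \<le> 3 * c + 2 * c'" if "\<bar>a\<bar> \<le> c" "\<bar>t\<bar> \<le> c'" for a t c c' :: real
            using that by linarith
          then show ?thesis using \<open>\<bar>_ - _\<bar> \<le> C2 / N\<close> th .
        qed
        then show ?thesis by (simp add: add_divide_distrib)
      qed
      moreover have "\<bar>epoly (Suc (Suc m)) (real (Suc d) / N) - epoly (Suc (Suc m)) (real d / N)
            - 4 / N * epoly (Suc m) (real d / N)\<bar> \<le> C2 / real N ^ 2"
        using d by (intro C2) (simp add: N_def)
      ultimately have "\<bar>e (Suc d) - e d\<bar> \<le> (\<bar>E d\<bar> + 3 * \<bar>E (Suc d)\<bar>) / N + ((3 * C2 + 4) / N) / N + C2 / real N ^ 2"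
        by presburger
      also have "\<dots> = (\<bar>E d\<bar> + 3 * \<bar>E (Suc d)\<bar>) / N + (4 * C2 + 4) / real N ^ 2"
        by (simp add: power2_eq_square add_divide_distrib)
      finally show ?thesis .
    qed
    have SE1: "(\<Sum>d<n. \<bar>E d\<bar>) \<le> C"
    proof -
      have "(\<Sum>d<n. \<bar>E d\<bar>) \<le> (\<Sum>d\<le>n. \<bar>E d\<bar>)" by (rule sum_mono2) auto
      then show ?thesis using SE by linarith
    qed
    have SE2: "(\<Sum>d<n. \<bar>E (Suc d)\<bar>) \<le> C"
    proof -
      have "(\<Sum>d\<le>n. \<bar>E d\<bar>) = \<bar>E 0\<bar> + (\<Sum>d<n. \<bar>E (Suc d)\<bar>)"
        using sum.lessThan_Suc_shift[of "\<lambda>d. \<bar>E d\<bar>" n] by (simp only: lessThan_Suc_atMost)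
      then show ?thesis using SE by linarith
    qed
    have total: "(\<Sum>i<n. (\<bar>E i\<bar> + 3 * \<bar>E (Suc i)\<bar>) / N + (4 * C2 + 4) / real N ^ 2) \<le> K / N"
    proof -
      have "(\<Sum>i<n. (\<bar>E i\<bar> + 3 * \<bar>E (Suc i)\<bar>) / N + (4 * C2 + 4) / real N ^ 2)
         = ((\<Sum>i<n. \<bar>E i\<bar>) + 3 * (\<Sum>i<n. \<bar>E (Suc i)\<bar>)) / N + real n * ((4 * C2 + 4) / real N ^ 2)"
        by (simp add: sum.distrib sum_divide_distrib[symmetric] sum_distrib_left)
      also have "\<dots> \<le> (4 * C) / N + real N * ((4 * C2 + 4) / real N ^ 2)"
        using SE1 SE2 N' C2(1) by (intro add_mono divide_right_mono mult_right_mono) (auto simp: N_def)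
      also have "\<dots> = K / N" using N' by (simp add: K_def power2_eq_square field_simps)
      finally show ?thesis .
    qed
    have e0: "\<bar>e d - e 0\<bar> \<le> K / N" if "d \<le> n" for d
      using order.trans[OF telescope_bound[where e = e, OF step that] total] .
    \<comment> \<open>\<open>n\<close> is close to half the period, so power and polynomial are both
      nearly negated between \<open>0\<close> and \<open>n\<close>. Together with the small
      difference \<open>e n - e 0\<close> this bounds \<open>e 0\<close>.\<close>
    have "\<bar>e n + e 0\<bar> \<le> (2 + L) / N"
    proof -
      have a: "\<bar>?U 0 + ?U (int n)\<bar> \<le> 2 / N"
        using circ_power_square_wave_half[of n m 0] by (simp add: N_def)
      have "real n / real N - 1 / 2 = - (1 / (2 * real N))" by (simp add: N_def field_simps)
      then have "\<bar>real n / real N - 1 / 2\<bar> \<le> 1 / N" by (simp add: abs_if divide_simps N_def)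
      moreover have "\<bar>epoly (Suc (Suc m)) (real n / N) - epoly (Suc (Suc m)) (1 / 2)\<bar> \<le> L * \<bar>real n / N - 1 / 2\<bar>"
        by (rule L) (auto simp: N_def)
      ultimately have "\<bar>epoly (Suc (Suc m)) (real n / N) + epoly (Suc (Suc m)) 0\<bar> \<le> L * (1 / N)"
        unfolding epoly_half using L(1) by (smt (verit) mult_left_mono)
      then show ?thesis using a by (simp add: e_def add_divide_distrib)
    qed
    moreover have "\<bar>e n - e 0\<bar> \<le> K / N" by (rule e0) simp
    ultimately have "2 * \<bar>e 0\<bar> \<le> (2 + L) / N + K / N" by linarith
    then have e00: "\<bar>e 0\<bar> \<le> (K + 2 + L) / N" by (simp add: add_divide_distrib)
    have ed: "\<bar>e d\<bar> \<le> K' / N" if "d \<le> n" for d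
      using e0[OF that] e00 unfolding K'_def by (simp add: add_divide_distrib)
    have K'0: "K' \<ge> 0" using order.trans[OF abs_ge_zero ed[of 0]] N' by (simp add: zero_le_divide_iff)
    have "(\<Sum>d\<le>n. \<bar>e d\<bar>) \<le> (\<Sum>d\<le>n. K' / N)" using ed by (intro sum_mono) auto
    also have "\<dots> = K' * (real (Suc n) / N)" by simp
    also have "\<dots> \<le> K' * 1" using K'0 by (intro mult_left_mono) (auto simp: N_def)
    finally show ?thesis using ed[of 0] by (simp add: e_def N_def)
  qed
  show ?case
    by (intro exI[of _ K'] allI impI conjI)
       (rule conjunct1[OF main] conjunct2[OF main], assumption)+
qed

lemma tendsto_of_bound:
  fixes f :: "nat \<Rightarrow> real"
  assumes "\<And>n. n \<ge> 1 \<Longrightarrow> \<bar>f n - l\<bar> \<le> C / real n"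
  shows "f \<longlonglongrightarrow> l"
proof -
  have "(\<lambda>n. C / real n) \<longlonglongrightarrow> 0" by (rule lim_const_over_n)
  then have "(\<lambda>n. f n - l) \<longlonglongrightarrow> 0"
    by (rule Lim_null_comparison[rotated]) (auto intro!: eventually_sequentiallyI[of 1] assms)
  then show ?thesis by (simp add: LIM_zero_iff)
qed

text \<open>The value \<open>bpoly m 0\<close> for even \<open>m\<close>. Odd powers have trace zero
  by parity, whereas \<open>bpoly 1 0 = 1\<close> is a one-sided limit at the jump.\<close>

definition saw_trace :: "nat \<Rightarrow> real" where
  "saw_trace m = (if even m then - (2 ^ m * bernoulli m / fact m) else 0)"

lemma kernel_trace_sawtooth_tendsto:
  assumes "m \<ge> 1"
  shows "(\<lambda>M. kernel_trace (\<lambda>a b. sawtooth M (int b - int a) / M) {..<M} m) \<longlonglongrightarrow> saw_trace m"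
proof -
  obtain m' where m: "m = Suc m'" using assms by (cases m) auto
  have tr: "kernel_trace (\<lambda>a b. sawtooth M (int b - int a) / M) {..<M} m = circ_power (sawtooth M) M m' 0" if "M > 0" for M
    unfolding m by (rule kernel_trace_circulant[OF periodic_sawtooth that])
  have "(\<lambda>M. circ_power (sawtooth M) M m' 0) \<longlonglongrightarrow> saw_trace m"
  proof (cases "even m")
    case True
    then have "m' \<ge> 1" using m by (cases m') auto
    moreover obtain C where "\<forall>M>0. (\<Sum>d<M. \<bar>circ_power (sawtooth M) M m' (int d) - bpoly (Suc m') (real d / M)\<bar>) \<le> C \<and>
        (m' \<ge> 1 \<longrightarrow> \<bar>circ_power (sawtooth M) M m' 0 - bpoly (Suc m') 0\<bar> \<le> C / M)"
      using sawtooth_power_approx[of m'] by (rule exE)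
    ultimately have C: "\<bar>circ_power (sawtooth M) M m' 0 - bpoly (Suc m') 0\<bar> \<le> C / M" if "M > 0" for M
      using that by (elim allE[of _ M]) (elim impE conjE, assumption+)
    have "(\<lambda>M. circ_power (sawtooth M) M m' 0) \<longlonglongrightarrow> bpoly (Suc m') 0"
      by (rule tendsto_of_bound[where C = C]) (rule C, simp)
    then show ?thesis using True by (simp add: appell_0 bernoulli_gf_def saw_trace_def m)
  next
    case False
    have "circ_power (sawtooth M) M m' 0 = 0" if "M > 0" for M
      using circ_power_odd[OF periodic_sawtooth that sawtooth_minus[OF that], of m' 0] False m by simp
    then have "eventually (\<lambda>M. circ_power (sawtooth M) M m' 0 = 0) sequentially"
      by (intro eventually_sequentiallyI[of 1]) auto
    then show ?thesis using False by (simp add: tendsto_eventually saw_trace_def)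
  qed
  then show ?thesis
    by (rule Lim_transform_eventually) (use tr in \<open>auto intro!: eventually_sequentiallyI[of 1]\<close>)
qed

text \<open>Normalising by \<open>n\<close> instead of \<open>2 * n + 1\<close> produces
  \<open>2 ^ m\<close>; the factor \<open>2 ^ m - 1\<close> comes from
  \<open>euler_gf_nth\<close>.\<close>

lemma kernel_trace_square_wave_tendsto:
  assumes "m \<ge> 1"
  shows "(\<lambda>n. kernel_trace (\<lambda>a b. square_wave n (int b - int a) / n) {0..2 * n} m)
     \<longlonglongrightarrow> 2 ^ m * (2 ^ m - 1) * saw_trace m"
proof -
  obtain m' where m: "m = Suc m'" using assms by (cases m) auto
  have tr: "kernel_trace (\<lambda>a b. square_wave n (int b - int a) / n) {0..2 * n} m
     = (real (2 * n + 1) / real n) ^ m * circ_power (square_wave n) (2 * n + 1) m' 0" if "n \<ge> 1" for n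
  proof -
    have "kernel_trace (\<lambda>a b. square_wave n (int b - int a) / n) {0..2 * n} m
      = kernel_trace (\<lambda>a b. (real (2 * n + 1) / real n) * (square_wave n (int b - int a) / real (2 * n + 1))) {..<2 * n + 1} m"
    proof -
      have "{0..2 * n} = {..<2 * n + 1}" by auto
      then show ?thesis by simp
    qed
    also have "\<dots> = (real (2 * n + 1) / real n) ^ m * kernel_trace (\<lambda>a b. square_wave n (int b - int a) / real (2 * n + 1)) {..<2 * n + 1} m"
      by (rule kernel_trace_scale)
    also have "kernel_trace (\<lambda>a b. square_wave n (int b - int a) / real (2 * n + 1)) {..<2 * n + 1} m = circ_power (square_wave n) (2 * n + 1) m' 0"
      unfolding m by (rule kernel_trace_circulant[OF periodic_square_wave]) simp
    finally show ?thesis .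
  qed
  have "(\<lambda>n. circ_power (square_wave n) (2 * n + 1) m' 0) \<longlonglongrightarrow> (2 ^ m - 1) * saw_trace m"
  proof (cases "even m")
    case True
    then have "m' \<ge> 1" using m by (cases m') auto
    moreover obtain C where "\<forall>n. n \<ge> 1 \<longrightarrow> (\<Sum>d\<le>n. \<bar>circ_power (square_wave n) (2 * n + 1) m' (int d) - epoly (Suc m') (real d / real (2 * n + 1))\<bar>) \<le> C \<and>
        (m' \<ge> 1 \<longrightarrow> \<bar>circ_power (square_wave n) (2 * n + 1) m' 0 - epoly (Suc m') 0\<bar> \<le> C / real (2 * n + 1))"
      using square_wave_power_approx[of m'] by (rule exE)
    ultimately have C: "\<bar>circ_power (square_wave n) (2 * n + 1) m' 0 - epoly (Suc m') 0\<bar> \<le> C / real (2 * n + 1)" if "n \<ge> 1" for n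
      using that by (elim allE[of _ n]) (elim impE conjE, assumption+)
    have "(\<lambda>n. circ_power (square_wave n) (2 * n + 1) m' 0) \<longlonglongrightarrow> epoly (Suc m') 0"
    proof (rule tendsto_of_bound)
      fix n :: nat assume n: "n \<ge> 1"
      have "\<bar>circ_power (square_wave n) (2 * n + 1) m' 0 - epoly (Suc m') 0\<bar> \<le> C / real (2 * n + 1)"
        by (rule C[OF n])
      also have "\<dots> \<le> \<bar>C\<bar> / real (2 * n + 1)" by (intro divide_right_mono) auto
      also have "\<dots> \<le> \<bar>C\<bar> / real n" using n by (intro divide_left_mono) auto
      finally show "\<bar>circ_power (square_wave n) (2 * n + 1) m' 0 - epoly (Suc m') 0\<bar> \<le> \<bar>C\<bar> / real n" .
    qed
    moreover have "epoly (Suc m') 0 = (2 ^ m - 1) * saw_trace m"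
    proof -
      have "(1 - p) * y = (p - 1) * - y" for p y :: real by (simp add: algebra_simps)
      then show ?thesis
        using True unfolding appell_0 euler_gf_nth saw_trace_def m by (simp only: if_True)
    qed
    ultimately show ?thesis by simp
  next
    case False
    have "circ_power (square_wave n) (2 * n + 1) m' 0 = 0" for n
      using circ_power_odd[OF periodic_square_wave _ square_wave_minus, of n m' 0] False m by simp
    then show ?thesis using False by (simp add: saw_trace_def)
  qed
  moreover have "(\<lambda>n. (real (2 * n + 1) / real n) ^ m) \<longlonglongrightarrow> 2 ^ m"
  proof (rule tendsto_power, rule tendsto_of_bound[where C = 1])
    fix n :: nat assume "n \<ge> 1"
    then show "\<bar>real (2 * n + 1) / real n - 2\<bar> \<le> 1 / real n" by (simp add: field_simps)
  qed
  ultimately have "(\<lambda>n. (real (2 * n + 1) / real n) ^ m * circ_power (square_wave n) (2 * n + 1) m' 0)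
     \<longlonglongrightarrow> 2 ^ m * ((2 ^ m - 1) * saw_trace m)"
    by (intro tendsto_mult)
  then show ?thesis unfolding mult.assoc
    by (rule Lim_transform_eventually) (use tr in \<open>auto intro!: eventually_sequentiallyI[of 1]\<close>)
qed

text \<open>Of \<open>8 ^ m\<close>, two factors \<open>2 ^ m\<close> sit in the two occurrences of
  \<open>saw_trace\<close> and the third is due to the normalisation by \<open>n\<close>;
  \<open>1/2\<close> is the orientation factor of a cycle.\<close>

lemma cycle_weight_eq: "cycle_weight m = (2 ^ m * (2 ^ m - 1) * saw_trace m) * saw_trace m / 2"
proof (cases "even m")
  case True
  have "(8::real) ^ m = 2 ^ m * (2 ^ m * 2 ^ m)" by (simp add: power_mult_distrib[symmetric])
  then show ?thesis using True
    by (simp add: cycle_weight_def saw_trace_def power2_eq_square field_simps)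
qed (simp add: cycle_weight_def saw_trace_def)

section \<open>The writhe\<close>

lemma sum_square_wave_zero: "(\<Sum>j\<in>{0..2 * n}. square_wave n (int j - int i)) = 0"
proof -
  have "(\<Sum>j\<in>{0..2 * n}. square_wave n (int j - int i)) = (\<Sum>e\<in>{0..<int (2 * n + 1)}. square_wave n (e + (- int i)))"
    by (rule sum.reindex_bij_witness[where i = nat and j = int]) auto
  also have "\<dots> = (\<Sum>e\<in>{0..<int (2 * n + 1)}. square_wave n e)"
    by (rule sum_periodic_shift[OF periodic_square_wave]) simp
  also have "\<dots> = 0"
    by (rule sum_odd_periodic_zero[OF periodic_square_wave]) (simp_all add: square_wave_minus)
  finally show ?thesis .
qed

lemma sum_sawtooth_zero:
  assumes "M > 0"
  shows "(\<Sum>j<M. sawtooth M (int j - int i)) = 0"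
proof -
  have "(\<Sum>j<M. sawtooth M (int j - int i)) = (\<Sum>e\<in>{0..<int M}. sawtooth M (e + (- int i)))"
    by (simp add: sum_int_eq_sum_nat)
  also have "\<dots> = (\<Sum>e\<in>{0..<int M}. sawtooth M e)"
    by (rule sum_periodic_shift[OF periodic_sawtooth assms])
  also have "\<dots> = 0"
    by (rule sum_odd_periodic_zero[OF periodic_sawtooth assms sawtooth_minus[OF assms]])
  finally show ?thesis .
qed

lemma mean_zero_kernels_writhe:
  assumes "M > 0"
  shows "mean_zero_kernels {0..2 * n} {..<M} (\<lambda>i j. square_wave n (int j - int i))
    (\<lambda>x y. sawtooth M (int y - int x))"
proof
  show "square_wave n (int y - int x) = - square_wave n (int x - int y)" for x y
    using square_wave_minus[of n "int x - int y"] by simp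
  show "sawtooth M (int y - int x) = - sawtooth M (int x - int y)" for x y
    using sawtooth_minus[OF assms, of "int x - int y"] by simp
  show "\<bar>square_wave n (int y - int x)\<bar> \<le> 1" for x y by (rule abs_square_wave_le)
  show "\<bar>sawtooth M (int y - int x)\<bar> \<le> 1" for x y by (rule abs_sawtooth_le[OF assms])
  show "(\<Sum>y<M. sawtooth M (int y - int x)) = 0" for x by (rule sum_sawtooth_zero[OF assms])
  show "{..<M} \<noteq> {}" using assms by (simp add: lessThan_empty_iff)
qed simp_all

lemma square_wave_eq_1_iff:
  "square_wave n d = 1 \<longleftrightarrow> d mod int (2 * n + 1) \<in> {1..int n}"
proof -
  define r where "r = d mod int (2 * n + 1)"
  have "0 \<le> r" by (simp add: r_def)
  then show ?thesis unfolding square_wave_def Let_def r_def[symmetric] by auto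
qed

lemma square_wave_cases: "square_wave n d \<in> {- 1, 0, 1}"
  by (auto simp: square_wave_def Let_def)

text \<open>\<open>square_wave\<close> is the tournament indicator \<open>P\<close> minus its
  transpose. As \<open>sgn\<close> is antisymmetric too, both parts contribute the full
  writhe.\<close>

lemma writhe_eq_double_sum:
  "writhe n f = (\<Sum>i\<in>{0..2 * n}. \<Sum>j\<in>{0..2 * n}. square_wave n (int j - int i) * sgn (f j - f i)) / 2"
proof -
  define A where "A = {0..2 * n}"
  define N where "N = 2 * n + 1"
  define P where "P i j = (of_bool (square_wave n (int j - int i) = 1) :: real)" for i j :: nat
  have N: "N > 0" by (simp add: N_def)
  have inner: "(\<Sum>j = 1..n. sgn (f ((i + j) mod N) - f i)) = (\<Sum>j\<in>A. P i j * sgn (f j - f i))"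
    if i: "i \<in> A" for i
  proof -
    have "(\<Sum>j = 1..n. sgn (f ((i + j) mod N) - f i))
       = (\<Sum>j | j \<in> A \<and> square_wave n (int j - int i) = 1. sgn (f j - f i))"
    proof (rule sum.reindex_bij_witness[where i = "\<lambda>j. nat ((int j - int i) mod int N)" and j = "\<lambda>j. (i + j) mod N"])
      fix j assume j: "j \<in> {1..n}"
      have e: "(int ((i + j) mod N) - int i) mod int N = int j"
      proof -
        have "(int ((i + j) mod N) - int i) mod int N = (int (i + j) - int i) mod int N"
          by (simp add: of_nat_mod mod_diff_left_eq)
        also have "\<dots> = int j" using j by (simp add: N_def)
        finally show ?thesis .
      qed
      show "nat ((int ((i + j) mod N) - int i) mod int N) = j" unfolding e by simp
      have "(i + j) mod N < N" using N by simp
      then show "(i + j) mod N \<in> {j \<in> A. square_wave n (int j - int i) = 1}"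
        using e j by (auto simp: A_def N_def square_wave_eq_1_iff)
    next
      fix j assume j: "j \<in> {j. j \<in> A \<and> square_wave n (int j - int i) = 1}"
      then have m: "(int j - int i) mod int N \<in> {1..int n}" by (simp add: square_wave_eq_1_iff N_def)
      then show "nat ((int j - int i) mod int N) \<in> {1..n}" by auto
      have "int ((i + nat ((int j - int i) mod int N)) mod N) = int j"
      proof -
        have "int ((i + nat ((int j - int i) mod int N)) mod N) = (int i + (int j - int i) mod int N) mod int N"
          using m by (simp add: of_nat_mod)
        also have "\<dots> = int j" using j by (simp add: mod_simps A_def N_def)
        finally show ?thesis .
      qed
      then show "(i + nat ((int j - int i) mod int N)) mod N = j" by simp
    qed simp
    also have "\<dots> = (\<Sum>j\<in>A. if square_wave n (int j - int i) = 1 then sgn (f j - f i) else 0)"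
      by (rule sum.inter_filter) (simp add: A_def)
    also have "\<dots> = (\<Sum>j\<in>A. P i j * sgn (f j - f i))" by (intro sum.cong) (auto simp: P_def)
    finally show ?thesis .
  qed
  have w: "writhe n f = (\<Sum>i\<in>A. \<Sum>j\<in>A. P i j * sgn (f j - f i))"
    unfolding writhe_def N_def[symmetric] using inner by (simp add: A_def)
  have sP: "square_wave n (int j - int i) = P i j - P j i" for i j
    using square_wave_cases[of n "int j - int i"] square_wave_minus[of n "int j - int i"]
    by (auto simp: P_def)
  have "(\<Sum>i\<in>A. \<Sum>j\<in>A. P j i * sgn (f j - f i)) = (\<Sum>j\<in>A. \<Sum>i\<in>A. P j i * sgn (f j - f i))"
    by (rule sum.swap)
  also have "\<dots> = (\<Sum>j\<in>A. \<Sum>i\<in>A. - (P j i * sgn (f i - f j)))"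
  proof (intro sum.cong refl)
    fix i j
    have "sgn (f j - f i) = - sgn (f i - f j)" by (metis minus_diff_eq sgn_minus)
    then show "P j i * sgn (f j - f i) = - (P j i * sgn (f i - f j))" by simp
  qed
  also have "\<dots> = - writhe n f" unfolding w by (simp add: sum_negf)
  finally have "(\<Sum>i\<in>A. \<Sum>j\<in>A. P j i * sgn (f j - f i)) = - writhe n f" .
  then have "(\<Sum>i\<in>A. \<Sum>j\<in>A. square_wave n (int j - int i) * sgn (f j - f i)) = 2 * writhe n f"
    unfolding sP left_diff_distrib sum_subtractf w[symmetric] by simp
  then show ?thesis by (simp add: A_def)
qed

lemma sawtooth_eq_sgn:
  assumes "x < M" "y < M"
  shows "sawtooth M (int y - int x) = sgn (real y - real x) - 2 * (real y - real x) / M"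
proof (cases x y rule: linorder_cases)
  case less
  then have "(int y - int x) mod int M = int y - int x" using assms by (intro mod_pos_pos_trivial) auto
  then show ?thesis using less by (simp add: sawtooth_def)
next
  case greater
  \<comment> \<open>Wrapping a negative difference adds \<open>M\<close>, which shifts the linear
    term by \<open>-2\<close> and turns \<open>1\<close> into \<open>-1\<close>.\<close>
  have "(int y - int x) mod int M = (int y - int x + int M) mod int M" by simp
  also have "\<dots> = int y - int x + int M" using greater assms by (intro mod_pos_pos_trivial) auto
  finally have m: "(int y - int x) mod int M = int y - int x + int M" .
  have "int y - int x + int M \<noteq> 0" using greater assms by linarith
  moreover have "real_of_int (int y - int x + int M) = (real y - real x) + real M" by simp
  ultimately have "sawtooth M (int y - int x) = 1 - 2 * ((real y - real x) + real M) / M"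
    unfolding sawtooth_def m by (simp only: if_False)
  also have "2 * ((real y - real x) + real M) / M = 2 * (real y - real x) / M + 2"
    unfolding distrib_left add_divide_distrib using assms by simp
  finally show ?thesis using greater by simp
qed (simp add: sawtooth_def)

text \<open>The linear part is a function of \<open>g j\<close> minus one of \<open>g i\<close>,
  annihilated by the vanishing column and row sums of \<open>s\<close>. Collisions are harmless:
  \<open>sgn\<close> and the sawtooth both vanish at \<open>0\<close>.\<close>

lemma writhe_eq_kernel_sum:
  assumes g: "g \<in> PiE {0..2 * n} (\<lambda>_. {..<M})"
  shows "2 * writhe n (\<lambda>i. real (g i))
    = (\<Sum>i\<in>{0..2 * n}. \<Sum>j\<in>{0..2 * n}. square_wave n (int j - int i) * sawtooth M (int (g j) - int (g i)))"
proof -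
  define A where "A = {0..2 * n}"
  define s where "s i j = square_wave n (int j - int i)" for i j :: nat
  have s0: "(\<Sum>j\<in>A. s i j) = 0" for i unfolding A_def s_def by (rule sum_square_wave_zero)
  have s1: "s i j = - s j i" for i j
    using square_wave_minus[of n "int i - int j"] by (simp add: s_def)
  have s2: "(\<Sum>i\<in>A. s i j) = 0" for j
    unfolding s1[of _ j] sum_negf s0 by simp
  have lin: "(\<Sum>i\<in>A. \<Sum>j\<in>A. s i j * (real (g j) - real (g i))) = 0"
  proof -
    have "(\<Sum>i\<in>A. \<Sum>j\<in>A. s i j * real (g j)) = (\<Sum>j\<in>A. (\<Sum>i\<in>A. s i j) * real (g j))"
      unfolding sum_distrib_right by (rule sum.swap)
    moreover have "(\<Sum>i\<in>A. \<Sum>j\<in>A. s i j * real (g i)) = (\<Sum>i\<in>A. (\<Sum>j\<in>A. s i j) * real (g i))"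
      unfolding sum_distrib_right ..
    ultimately show ?thesis unfolding right_diff_distrib sum_subtractf s0 s2 by simp
  qed
  have "(\<Sum>i\<in>A. \<Sum>j\<in>A. s i j * sawtooth M (int (g j) - int (g i)))
     = (\<Sum>i\<in>A. \<Sum>j\<in>A. s i j * sgn (real (g j) - real (g i)) - 2 / M * (s i j * (real (g j) - real (g i))))"
  proof (intro sum.cong refl)
    fix i j assume "i \<in> A" "j \<in> A"
    then have "g i < M" "g j < M" using g by (auto simp: A_def PiE_iff)
    then have "sawtooth M (int (g j) - int (g i))
       = sgn (real (g j) - real (g i)) - 2 * (real (g j) - real (g i)) / M"
      by (rule sawtooth_eq_sgn)
    moreover have "a * (b - 2 * c / d) = a * b - 2 / d * (a * c)" for a b c d :: real
      by (simp add: right_diff_distrib)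
    ultimately show "s i j * sawtooth M (int (g j) - int (g i))
      = s i j * sgn (real (g j) - real (g i)) - 2 / M * (s i j * (real (g j) - real (g i)))"
      by (simp only:)
  qed
  also have "\<dots> = (\<Sum>i\<in>A. \<Sum>j\<in>A. s i j * sgn (real (g j) - real (g i)))"
    unfolding sum_subtractf sum_distrib_left[symmetric] lin by simp
  finally show ?thesis unfolding writhe_eq_double_sum by (simp add: A_def s_def)
qed

section \<open>From independent values to a uniform permutation\<close>

lemma abs_writhe_le: "\<bar>writhe n f\<bar> \<le> real ((2 * n + 1) * n)"
proof -
  have "\<bar>writhe n f\<bar> \<le> (\<Sum>i = 0..2 * n. \<Sum>j = 1..n. 1)"
    unfolding writhe_def
    by (intro order.trans[OF sum_abs] sum_mono order.trans[OF sum_abs]) (simp add: abs_sgn_eq)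
  then show ?thesis by (simp add: algebra_simps)
qed

lemma writhe_cong:
  assumes "\<And>a b. a \<in> {0..2 * n} \<Longrightarrow> b \<in> {0..2 * n} \<Longrightarrow> sgn (f a - f b) = sgn (g a - g b)"
  shows "writhe n f = writhe n g"
  unfolding writhe_def
proof (intro sum.cong refl assms)
  fix i j show "(i + j) mod (2 * n + 1) \<in> {0..2 * n}"
    using mod_less_divisor[of "2 * n + 1" "i + j"] by simp
qed

lemma ex_ranking_permutation:
  fixes g :: "nat \<Rightarrow> nat"
  assumes "inj_on g {0..m}"
  shows "\<exists>r. r permutes {0..m} \<and> (\<forall>a\<in>{0..m}. \<forall>b\<in>{0..m}. r a < r b \<longleftrightarrow> g a < g b)"
proof -
  define r where "r i = (if i \<in> {0..m} then card {j \<in> {0..m}. g j < g i} else i)" for i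
  have mono: "r a < r b" if "a \<in> {0..m}" "b \<in> {0..m}" "g a < g b" for a b
  proof -
    have "{j \<in> {0..m}. g j < g a} \<subseteq> {j \<in> {0..m}. g j < g b}" using that(3) by auto
    moreover have "a \<in> {j \<in> {0..m}. g j < g b}" "a \<notin> {j \<in> {0..m}. g j < g a}" using that by simp_all
    ultimately have "{j \<in> {0..m}. g j < g a} \<subset> {j \<in> {0..m}. g j < g b}" by blast
    then show ?thesis using that by (simp add: r_def psubset_card_mono)
  qed
  have iff: "r a < r b \<longleftrightarrow> g a < g b" if ab: "a \<in> {0..m}" "b \<in> {0..m}" for a b
  proof (cases "g a" "g b" rule: linorder_cases)
    case equal
    then have "a = b" using assms ab by (auto dest: inj_onD)
    then show ?thesis by simp
  next
    case less
    then show ?thesis using mono[OF ab] by simp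
  next
    case greater
    then have "r b < r a" by (rule mono[OF ab(2,1)])
    then show ?thesis using greater by simp
  qed
  have inj: "inj_on r {0..m}"
  proof (rule inj_onI)
    fix a b assume ab: "a \<in> {0..m}" "b \<in> {0..m}" "r a = r b"
    then have "\<not> g a < g b" "\<not> g b < g a" using iff[OF ab(1,2)] iff[OF ab(2,1)] by simp_all
    then have "g a = g b" by simp
    then show "a = b" using assms ab by (auto dest: inj_onD)
  qed
  have "r i \<in> {0..m}" if i: "i \<in> {0..m}" for i
  proof -
    have "card {j \<in> {0..m}. g j < g i} \<le> card ({0..m} - {i})" by (intro card_mono) auto
    then show ?thesis using i by (simp add: r_def)
  qed
  then have "r ` {0..m} \<subseteq> {0..m}" by blast
  then have "r ` {0..m} = {0..m}" by (rule endo_inj_surj[OF finite_atLeastAtMost _ inj])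
  then have "r permutes {0..m}"
  proof (intro bij_imp_permutes)
    show "bij_betw r {0..m} {0..m}" if "r ` {0..m} = {0..m}" using that inj by (simp add: bij_betw_def)
    show "r x = x" if "x \<notin> {0..m}" for x unfolding r_def using that by (simp only: if_False)
  qed
  then show ?thesis using iff by blast
qed

lemma sgn_real_diff_cong:
  fixes a b c d :: nat
  assumes "a < b \<longleftrightarrow> c < d" "b < a \<longleftrightarrow> d < c"
  shows "sgn (real a - real b) = sgn (real c - real d)"
  using assms by (cases a b rule: linorder_cases) auto

text \<open>The sum over all \<open>g\<close> and \<open>p\<close> of the power at
  \<open>g \<circ> p\<close> is evaluated twice. For fixed \<open>p\<close>, composition permutes
  the injective maps; for fixed \<open>g\<close>, only its ranking \<open>r\<close> matters, and
  composition with \<open>r\<close> permutes the permutations.\<close>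

lemma sum_inj_writhe_power:
  fixes n M k :: nat
  defines "A \<equiv> {0..2 * n}"
  defines "I \<equiv> {g \<in> PiE A (\<lambda>_. {..<M}). inj_on g A}"
  defines "P \<equiv> {p. p permutes A}"
  shows "(\<Sum>g\<in>I. writhe n (\<lambda>i. real (g i)) ^ k)
    = card I * ((\<Sum>p\<in>P. writhe n (\<lambda>i. real (p i)) ^ k) / card P)"
proof -
  define W where "W g = writhe n (\<lambda>i. real (g i)) ^ k" for g :: "nat \<Rightarrow> nat"
  have finP: "finite P" unfolding P_def A_def by (simp add: finite_permutations)
  have "id \<in> P" by (simp add: P_def permutes_id)
  then have P0: "card P > 0" using finP by (auto simp: card_gt_0_iff)
  have 1: "(\<Sum>g\<in>I. W (g \<circ> p)) = (\<Sum>g\<in>I. W g)" if p: "p \<in> P" for p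
  proof -
    have comp: "g \<circ> q \<in> I" if "g \<in> I" "q permutes A" for g q
    proof -
      have "g \<circ> q \<in> PiE A (\<lambda>_. {..<M})"
        using that permutes_in_image[OF that(2)] permutes_not_in[OF that(2)]
        by (auto simp: I_def PiE_iff extensional_def)
      moreover have "inj_on (g \<circ> q) A"
        using that comp_inj_on[OF permutes_inj_on[OF that(2)], of g]
        by (simp add: I_def permutes_image)
      ultimately show ?thesis by (simp add: I_def)
    qed
    have pA: "p permutes A" using p by (simp add: P_def)
    show ?thesis
      by (rule sum.reindex_bij_witness[where i = "\<lambda>g. g \<circ> inv p" and j = "\<lambda>g. g \<circ> p"])
         (use comp pA permutes_inv[OF pA] permutes_inv_o[OF pA] in \<open>auto simp: comp_assoc\<close>)
  qed
  have 2: "(\<Sum>p\<in>P. W (g \<circ> p)) = (\<Sum>p\<in>P. W p)" if g: "g \<in> I" for g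
  proof -
    obtain r where r: "r permutes A" "\<And>a b. a \<in> A \<Longrightarrow> b \<in> A \<Longrightarrow> r a < r b \<longleftrightarrow> g a < g b"
      using ex_ranking_permutation[of g "2 * n"] g by (auto simp: I_def A_def)
    have "W (g \<circ> p) = W (r \<circ> p)" if p: "p \<in> P" for p
    proof -
      have "writhe n (\<lambda>i. real ((g \<circ> p) i)) = writhe n (\<lambda>i. real ((r \<circ> p) i))"
      proof (rule writhe_cong)
        fix a b assume "a \<in> {0..2 * n}" "b \<in> {0..2 * n}"
        then have "p a \<in> A" "p b \<in> A"
          using p by (auto simp: P_def A_def dest: permutes_in_image)
        then show "sgn (real ((g \<circ> p) a) - real ((g \<circ> p) b)) = sgn (real ((r \<circ> p) a) - real ((r \<circ> p) b))"
          using r(2) by (intro sgn_real_diff_cong) auto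
      qed
      then show ?thesis by (simp only: W_def)
    qed
    then have "(\<Sum>p\<in>P. W (g \<circ> p)) = (\<Sum>p\<in>P. W (r \<circ> p))" by (rule sum.cong[OF refl])
    also have "\<dots> = (\<Sum>p\<in>P. W p)"
      by (rule sum.reindex_bij_witness[where i = "\<lambda>p. inv r \<circ> p" and j = "\<lambda>p. r \<circ> p"])
         (use permutes_inv_o[OF r(1)] permutes_compose permutes_inv[OF r(1)] r(1)
          in \<open>auto simp: P_def comp_assoc[symmetric]\<close>)
    finally show ?thesis .
  qed
  have "card P * (\<Sum>g\<in>I. W g) = (\<Sum>p\<in>P. \<Sum>g\<in>I. W (g \<circ> p))" using 1 by simp
  also have "\<dots> = (\<Sum>g\<in>I. \<Sum>p\<in>P. W (g \<circ> p))" by (rule sum.swap)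
  also have "\<dots> = card I * (\<Sum>p\<in>P. W p)" using 2 by simp
  finally show ?thesis using P0 by (simp add: W_def field_simps)
qed

lemma expectation_writhe_power:
  "measure_pmf.expectation (pmf_of_set {p. p permutes {0..2 * n}}) (\<lambda>p. writhe n (\<lambda>i. real (p i)) ^ k / c)
    = (\<Sum>p | p permutes {0..2 * n}. writhe n (\<lambda>i. real (p i)) ^ k) / card {p. p permutes {0..2 * n}} / c"
proof -
  have "finite {p. p permutes {0..2 * n}}" by (simp add: finite_permutations)
  moreover have "{p. p permutes {0..2 * n}} \<noteq> {}" using permutes_id by blast
  ultimately show ?thesis by (simp add: integral_pmf_of_set sum_divide_distrib[symmetric])
qed

text \<open>On injective maps the average is exact, and the others have proportion at most
  \<open>(card A)^2 / M\<close>. The bound \<open>c\<close> on the power grows with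
  \<open>n\<close>, which is fixed here.\<close>

lemma mean_writhe_power_tendsto:
  fixes n k :: nat
  defines "A \<equiv> {0..2 * n}"
  shows "(\<lambda>M. (\<Sum>g\<in>PiE A (\<lambda>_. {..<M}). writhe n (\<lambda>i. real (g i)) ^ k) / real M ^ card A)
    \<longlonglongrightarrow> (\<Sum>p | p permutes A. writhe n (\<lambda>i. real (p i)) ^ k) / card {p. p permutes A}"
proof -
  define W where "W g = writhe n (\<lambda>i. real (g i)) ^ k" for g :: "nat \<Rightarrow> nat"
  define E where "E = (\<Sum>p | p permutes A. W p) / card {p. p permutes A}"
  define c where "c = real ((2 * n + 1) * n) ^ k"
  have Wc: "\<bar>W g\<bar> \<le> c" for g
    unfolding W_def c_def power_abs by (intro power_mono abs_writhe_le) simp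
  have finA: "finite A" by (simp add: A_def)
  have finP: "finite {p. p permutes A}" using finA by (simp add: finite_permutations)
  have "id \<in> {p. p permutes A}" by (simp add: permutes_id)
  then have cardP: "card {p. p permutes A} > 0" using finP card_gt_0_iff by blast
  have Ec: "\<bar>E\<bar> \<le> c"
  proof -
    have "\<bar>\<Sum>p | p permutes A. W p\<bar> \<le> (\<Sum>p | p permutes A. c)"
      using Wc by (intro order.trans[OF sum_abs] sum_mono)
    then show ?thesis using cardP by (simp add: E_def abs_divide divide_le_eq mult.commute)
  qed
  have "\<bar>(\<Sum>g\<in>PiE A (\<lambda>_. {..<M}). W g) / real M ^ card A - E\<bar> \<le> 2 * c * (card A)\<^sup>2 / real M" if M: "M \<ge> 1" for M
  proof -
    define V where "V = PiE A (\<lambda>_. {..<M})"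
    define I where "I = {g \<in> V. inj_on g A}"
    define J where "J = {g \<in> V. \<not> inj_on g A}"
    have finV: "finite V" unfolding V_def using finA by (auto intro!: finite_PiE)
    have IJ: "V = I \<union> J" "I \<inter> J = {}" "finite I" "finite J" using finV by (auto simp: I_def J_def)
    have cV: "real M ^ card A = real (card I) + real (card J)"
    proof -
      have "card V = M ^ card A" using finA by (simp add: V_def card_PiE)
      moreover have "card V = card I + card J" unfolding IJ(1) using IJ(2-4) by (rule card_Un_disjoint[rotated 2])
      ultimately show ?thesis by (metis of_nat_add of_nat_power)
    qed
    have pos: "real M ^ card A > 0" using M by simp
    have cJ: "real (card J) \<le> (card A)\<^sup>2 * real M ^ card A / real M"
    proof -
      have "card A > 0" by (simp add: A_def)
      then have "real M ^ card A = real M * real M ^ (card A - 1)" by (metis Suc_diff_1 power_Suc)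
      moreover have "card J \<le> (card A)\<^sup>2 * M ^ (card A - 1)"
        using card_not_inj_PiE_le[OF finA, of "{..<M}"] by (simp add: J_def V_def)
      then have "real (card J) \<le> real ((card A)\<^sup>2 * M ^ (card A - 1))" by (rule of_nat_mono)
      ultimately show ?thesis using M by simp
    qed
    have "(\<Sum>g\<in>V. W g) = (\<Sum>g\<in>I. W g) + (\<Sum>g\<in>J. W g)"
      unfolding IJ(1) using IJ(2-4) by (simp add: sum.union_disjoint)
    also have "(\<Sum>g\<in>I. W g) = card I * E"
      using sum_inj_writhe_power[where n = n and M = M and k = k] by (simp add: I_def V_def A_def W_def E_def)
    finally have "(\<Sum>g\<in>V. W g) - E * real M ^ card A = (\<Sum>g\<in>J. W g) - card J * E"
      unfolding cV by (simp add: algebra_simps)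
    also have "\<bar>(\<Sum>g\<in>J. W g) - card J * E\<bar> \<le> 2 * c * card J"
    proof -
      have "\<bar>\<Sum>g\<in>J. W g\<bar> \<le> (\<Sum>g\<in>J. c)" using Wc by (intro order.trans[OF sum_abs] sum_mono)
      moreover have "\<bar>card J * E\<bar> \<le> card J * c" unfolding abs_mult using Ec by (intro mult_mono) auto
      ultimately show ?thesis by (simp add: algebra_simps)
    qed
    finally have "\<bar>(\<Sum>g\<in>V. W g) - E * real M ^ card A\<bar> \<le> 2 * c * card J" .
    also have "\<dots> \<le> 2 * c * ((card A)\<^sup>2 * real M ^ card A / real M)"
      using cJ order.trans[OF abs_ge_zero Ec] by (intro mult_left_mono) auto
    finally have "\<bar>(\<Sum>g\<in>V. W g) - E * real M ^ card A\<bar> / real M ^ card A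
        \<le> 2 * c * ((card A)\<^sup>2 * real M ^ card A / real M) / real M ^ card A"
      using pos by (intro divide_right_mono) auto
    moreover have "\<bar>(\<Sum>g\<in>V. W g) / real M ^ card A - E\<bar> = \<bar>(\<Sum>g\<in>V. W g) - E * real M ^ card A\<bar> / real M ^ card A"
    proof -
      have "(\<Sum>g\<in>V. W g) / real M ^ card A - E = ((\<Sum>g\<in>V. W g) - E * real M ^ card A) / real M ^ card A"
        using pos by (simp add: diff_divide_distrib)
      then show ?thesis using pos by (simp only: abs_divide abs_of_pos)
    qed
    moreover have "a * (x * p / q) / p = a * x / q" if "p > 0" for a x p q :: real using that by simp
    ultimately show ?thesis unfolding V_def using pos by (simp only:)
  qed
  then have "(\<lambda>M. (\<Sum>g\<in>PiE A (\<lambda>_. {..<M}). W g) / real M ^ card A) \<longlonglongrightarrow> E"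
    by (rule tendsto_of_bound)
  then show ?thesis by (simp only: W_def E_def)
qed

lemma card_cycles_pos:
  fixes k :: nat
  assumes "\<sigma> permutes {..<k}" "\<gamma> \<in> cycles_on {..<k} \<sigma>"
  shows "card \<gamma> \<ge> 1"
proof -
  obtain x where x: "x \<in> {..<k}" "\<gamma> = orbit \<sigma> x" using assms by (auto simp: cycles_on_def)
  have "finite \<gamma>" using permutes_orbit_subset[OF assms(1) x(1)] x(2) finite_subset by blast
  moreover have "\<gamma> \<noteq> {}" using x orbit_nonempty by simp
  ultimately have "card \<gamma> \<noteq> 0" by simp
  then show ?thesis by simp
qed

theorem theorem1:
  fixes k :: nat
  assumes "k \<ge> 1"
  shows "(\<lambda>n. measure_pmf.expectation (pmf_of_set {p. p permutes {0..2 * n}})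
            (\<lambda>p. writhe n (\<lambda>i. real (p i)) ^ k / real n ^ k))
         \<longlonglongrightarrow> (\<Sum>\<sigma> | \<sigma> permutes {..<k}. \<Prod>\<gamma>\<in>cycles_on {..<k} \<sigma>. cycle_weight (card \<gamma>))"
proof -
  define E where "E n = (\<Sum>p | p permutes {0..2 * n}. writhe n (\<lambda>i. real (p i)) ^ k) / card {p. p permutes {0..2 * n}}" for n
  define S where "S n m = kernel_trace (\<lambda>a b. square_wave n (int b - int a) / n) {0..2 * n} m" for n m
  define T where "T M m = kernel_trace (\<lambda>a b. sawtooth M (int b - int a) / M) {..<M} m" for M m
  define D where "D = real ((k - 1) ^ (2 * k)) + 2 ^ k * fact k * k\<^sup>2"
  have D0: "D \<ge> 0" by (simp add: D_def)
  \<comment> \<open>Here \<open>M\<close> tends to infinity at fixed \<open>n\<close>: the sawtooth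
    traces reach their limits, those of the square wave still depend on \<open>n\<close>.\<close>
  have bound: "\<bar>E n / real n ^ k - (\<Sum>\<sigma> | \<sigma> permutes {..<k}. \<Prod>\<gamma>\<in>cycles_on {..<k} \<sigma>. S n (card \<gamma>) * saw_trace (card \<gamma>) / 2)\<bar>
      \<le> D * 3 ^ (k - 1) / real n" if n: "n \<ge> 1" for n
  proof -
    define m where "m M = (\<Sum>g\<in>PiE {0..2 * n} (\<lambda>_. {..<M}). writhe n (\<lambda>i. real (g i)) ^ k) / real M ^ card {0..2 * n}" for M
    define R where "R M = (\<Sum>\<sigma> | \<sigma> permutes {..<k}. \<Prod>\<gamma>\<in>cycles_on {..<k} \<sigma>. S n (card \<gamma>) * T M (card \<gamma>) / 2)" for M
    have le: "\<bar>m M / real n ^ k - R M\<bar> \<le> D * 3 ^ (k - 1) / real n" if M: "M \<ge> 1" for M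
    proof -
      interpret mean_zero_kernels "{0..2 * n}" "{..<M}" "\<lambda>i j. square_wave n (int j - int i)"
        "\<lambda>x y. sawtooth M (int y - int x)"
        using M by (intro mean_zero_kernels_writhe) simp
      have "mean (\<lambda>g. (\<Sum>i\<in>{0..2 * n}. \<Sum>j\<in>{0..2 * n}. square_wave n (int j - int i) * sawtooth M (int (g j) - int (g i))) ^ k)
        = 2 ^ k * m M"
      proof -
        have "(\<Sum>g\<in>PiE {0..2 * n} (\<lambda>_. {..<M}). (\<Sum>i\<in>{0..2 * n}. \<Sum>j\<in>{0..2 * n}. square_wave n (int j - int i) * sawtooth M (int (g j) - int (g i))) ^ k)
          = (\<Sum>g\<in>PiE {0..2 * n} (\<lambda>_. {..<M}). 2 ^ k * writhe n (\<lambda>i. real (g i)) ^ k)"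
          by (intro sum.cong refl) (simp only: writhe_eq_kernel_sum[symmetric] power_mult_distrib)
        then show ?thesis unfolding mean_def m_def sum_distrib_left[symmetric] by simp
      qed
      then have a1: "\<bar>2 ^ k * m M / real n ^ k - 2 ^ k * R M\<bar> \<le> D * card {0..2 * n} ^ (k - 1) / real n ^ k"
        using mean_power_approx[OF assms, of "real n"] n by (simp only: R_def S_def T_def D_def card_lessThan)
      \<comment> \<open>Both terms carry \<open>2 ^ k\<close>, one from doubling the writhe and one
        from edge orientations; it is then discarded by \<open>1 \<le> 2 ^ k\<close>.\<close>
      have a2: "\<bar>2 ^ k * m M / real n ^ k - 2 ^ k * R M\<bar> = 2 ^ k * \<bar>m M / real n ^ k - R M\<bar>"
      proof -
        have "2 ^ k * m M / real n ^ k - 2 ^ k * R M = 2 ^ k * (m M / real n ^ k - R M)"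
          by (simp add: right_diff_distrib)
        then show ?thesis by (simp only: abs_mult power_abs abs_numeral)
      qed
      have a3: "1 * \<bar>m M / real n ^ k - R M\<bar> \<le> 2 ^ k * \<bar>m M / real n ^ k - R M\<bar>"
        by (intro mult_right_mono) auto
      have "\<bar>m M / real n ^ k - R M\<bar> \<le> D * card {0..2 * n} ^ (k - 1) / real n ^ k"
        using order.trans[OF a3 a1[unfolded a2]] by (simp only: mult_1)
      \<comment> \<open>Uses \<open>2 * n + 1 \<le> 3 * n\<close>; one power of \<open>n\<close> is
        left in the denominator.\<close>
      also have "\<dots> \<le> D * (3 * real n) ^ (k - 1) / real n ^ k"
      proof -
        have "real (card {0..2 * n} ^ (k - 1)) \<le> (3 * real n) ^ (k - 1)"
          using n unfolding of_nat_power by (intro power_mono) auto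
        then show ?thesis using D0 by (intro divide_right_mono mult_left_mono) auto
      qed
      also have "\<dots> = D * 3 ^ (k - 1) / real n"
      proof -
        have "real n ^ k = real n * real n ^ (k - 1)" using assms by (metis Suc_diff_1 power_Suc less_le_trans zero_less_one)
        then show ?thesis using n by (simp add: power_mult_distrib)
      qed
      finally show ?thesis .
    qed
    have "m \<longlonglongrightarrow> E n" unfolding m_def E_def by (rule mean_writhe_power_tendsto)
    moreover have "R \<longlonglongrightarrow> (\<Sum>\<sigma> | \<sigma> permutes {..<k}. \<Prod>\<gamma>\<in>cycles_on {..<k} \<sigma>. S n (card \<gamma>) * saw_trace (card \<gamma>) / 2)"
      unfolding R_def T_def
      by (intro tendsto_sum tendsto_prod tendsto_divide tendsto_mult tendsto_const kernel_trace_sawtooth_tendsto)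
         (auto dest: card_cycles_pos)
    ultimately have "(\<lambda>M. \<bar>m M / real n ^ k - R M\<bar>) \<longlonglongrightarrow>
       \<bar>E n / real n ^ k - (\<Sum>\<sigma> | \<sigma> permutes {..<k}. \<Prod>\<gamma>\<in>cycles_on {..<k} \<sigma>. S n (card \<gamma>) * saw_trace (card \<gamma>) / 2)\<bar>"
      using n by (intro tendsto_rabs tendsto_diff tendsto_divide tendsto_const) auto
    \<comment> \<open>The estimate \<open>le\<close> is uniform in \<open>M\<close> and so survives
      the limit.\<close>
    then show ?thesis by (rule LIMSEQ_le_const2) (use le in blast)
  qed
  have l1: "(\<lambda>n. E n / real n ^ k - (\<Sum>\<sigma> | \<sigma> permutes {..<k}. \<Prod>\<gamma>\<in>cycles_on {..<k} \<sigma>. S n (card \<gamma>) * saw_trace (card \<gamma>) / 2)) \<longlonglongrightarrow> 0"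
    by (rule tendsto_of_bound) (use bound in auto)
  have l2: "(\<lambda>n. \<Sum>\<sigma> | \<sigma> permutes {..<k}. \<Prod>\<gamma>\<in>cycles_on {..<k} \<sigma>. S n (card \<gamma>) * saw_trace (card \<gamma>) / 2)
     \<longlonglongrightarrow> (\<Sum>\<sigma> | \<sigma> permutes {..<k}. \<Prod>\<gamma>\<in>cycles_on {..<k} \<sigma>. cycle_weight (card \<gamma>))"
    unfolding cycle_weight_eq S_def
    by (intro tendsto_sum tendsto_prod tendsto_divide tendsto_mult[where b = "saw_trace _"] tendsto_const kernel_trace_square_wave_tendsto)
       (auto dest: card_cycles_pos)
  have "(\<lambda>n. E n / real n ^ k) \<longlonglongrightarrow> (\<Sum>\<sigma> | \<sigma> permutes {..<k}. \<Prod>\<gamma>\<in>cycles_on {..<k} \<sigma>. cycle_weight (card \<gamma>))"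
    using tendsto_add[OF l1 l2] by simp
  then show ?thesis unfolding expectation_writhe_power E_def .
qed

end
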